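(* Let $I$ be an open subinterval of $\mathbb{R}$, $U$ an open subset of $\mathbb{R}^n$, $\tilde t_0$ a near-standard point in $\tilde I_c$ with $\tilde t_0\approx t_0\in I$, $\tilde x_0\in\tilde U_c$ and $F\in\mathcal{G}(I\times U)^n$. Let $\alpha>0$ be chosen such that $[t_0-\alpha,t_0+\alpha]\subset\subset I$. Let $(\tilde x_{0\varepsilon})_\varepsilon$ be a representative of $\tilde x_0$ and let $L\subset\subset U$, $\varepsilon_0\in(0,1]$ be such that $\tilde x_{0\varepsilon}\in L$ for all $\varepsilon\le\varepsilon_0$. With $\beta>0$ satisfying $L_\beta:=L+\overline{B_\beta(0)}\subset\subset U$ set $$Q:=[t_0-\alpha,t_0+\alpha]\times L_\beta\qquad(\subset\subset I\times U).$$ Assume that $F$ has a representative $(F_\varepsilon)_\varepsilon$ satisfying $$\sup_{(t,x)\in Q}|F_\varepsilon(t,x)|\le a\qquad(\varepsilon\le\varepsilon_0)$$ for some constant $a>0$. Set $h:=\min(\alpha,\beta/a)$, $J:=(t_0-h,t_0+h)$ and $W:=L+B_\beta(0)$. Then the following holds: (i) The initial value problem $$\dot u(t)=F(t,u(t)),\quad u(\tilde t_0)=\tilde x_0,\qquad( * )$$ has a solution $u\in\mathcal{G}[J,W]$. (ii) Every solution of $( * )$ in $\mathcal{G}[J,U]$ is already an element of $\mathcal{G}[J,W]$. (iii) The solution of $( * )$ is unique in $\mathcal{G}[J,U]$ if, in addition, the representative $(F_\varepsilon)_\varepsilon$ satisfies $$\sup_{(t,x)\in J\times W}|\partial_2F_\varepsilon(t,x)|=O(|\log\varepsilon|)\quad\text{as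 }\varepsilon\to0.$$
   Context: Notation. $A\subset\subset B$ means that $A$ is a compact subset of the interior of $B$. $B_r(x)$ is the open ball with centre $x$ and radius $r>0$. $\partial_2F_\varepsilon$ is the derivative with respect to the second slot ($x\in U$). Special Colombeau algebra. For a non-empty open $U\subseteq\mathbb{R}^n$ let $\mathcal{E}(U):=C^\infty(U,\mathbb{R})^{(0,1]}$. $\mathcal{E}_M(U)$ (moderate nets) is the set of $(u_\varepsilon)_\varepsilon\in\mathcal{E}(U)$ such that for all $K\subset\subset U$ and all $\alpha\in\mathbb{N}_0^n$ there is $N\in\mathbb{N}$ with $\sup_{x\in K}|\partial^\alpha u_\varepsilon(x)|=O(\varepsilon^{-N})$ as $\varepsilon\to0$. $\mathcal{N}(U)$ (negligible nets) is the set of $(u_\varepsilon)_\varepsilon\in\mathcal{E}(U)$ such that for all $K\subset\subset U$, $\alpha\in\mathbb{N}_0^n$, $m\in\mathbb{N}$ one has $\sup_{x\in K}|\partial^\alpha u_\varepsilon(x)|=O(\varepsilon^m)$ as $\varepsilon\to0$. $\mathcal{G}(U):=\mathcal{E}_M(U)/\mathcal{N}(U)$; the class of $(u_\varepsilon)_\varepsilon$ is $[(u_\varepsilon)_\varepsilon]$. Derivatives are taken componentwise in $\varepsilon$. Generalized functions with values in $\mathbb{R}^m$ are elements of $\mathcal{G}(U)^m$. c-boundedness. For open $U\subseteq\mathbb{R}^n$, $V\subseteq\mathbb{R}^m$, a net $(u_\varepsilon)_\varepsilon\in\mathcal{E}_M(U)^m$ is c-bounded from $U$ into $V$ if (a)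 there is $\varepsilon_0\in(0,1]$ with $u_\varepsilon(U)\subseteq V$ for all $\varepsilon\le\varepsilon_0$, and (b) for every $K\subset\subset U$ there are $L\subset\subset V$ and $\varepsilon_0\in(0,1]$ with $u_\varepsilon(K)\subseteq L$ for all $\varepsilon\le\varepsilon_0$. $\mathcal{G}[U,V]$ is the set of $u\in\mathcal{G}(U)^m$ having a representative that is c-bounded from $U$ into $V$. For $u\in\mathcal{G}[U,V]$ and $v\in\mathcal{G}(V)^l$ the composition $v\circ u:=[(v_\varepsilon\circ u_\varepsilon)_\varepsilon]\in\mathcal{G}(U)^l$ is well defined (with a c-bounded representative $(u_\varepsilon)_\varepsilon$; only small $\varepsilon$ matter). Generalized points. $U_M$ is the set of nets $(x_\varepsilon)_\varepsilon\in U^{(0,1]}$ with $|x_\varepsilon|=O(\varepsilon^{-N})$ for some $N\in\mathbb{N}$; $(x_\varepsilon)_\varepsilon\sim(y_\varepsilon)_\varepsilon$ iff $|x_\varepsilon-y_\varepsilon|=O(\varepsilon^m)$ for all $m\in\mathbb{N}$; $\tilde U:=U_M/\!\sim$. $\tilde U_c$ (compactly supported points) is the set of $\tilde x=[(\tilde x_\varepsilon)_\varepsilon]\in\tilde U$ for which there are $K\subset\subset U$ and $\varepsilon_0\in(0,1]$ with $\tilde x_\varepsilon\in K$ for all $\varepsilon\le\varepsilon_0$. For $u\in\mathcal{G}(U)^m$, $\tilde x\in\tilde U_c$, the point value is $u(\tilde x):=[(u_\varepsilon(\tilde x_\varepsilon))_\varepsilon]$. A point $\tilde x\in\tilde U_c$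 is near-standard, written $\tilde x\approx x$, if there is $x\in U$ with $\tilde x_\varepsilon\to x$ as $\varepsilon\to0$ for one (hence every) representative. Solutions. For an open subinterval $J$ of $I$, a solution of $\dot u(t)=F(t,u(t))$, $u(\tilde t_0)=\tilde x_0$ on $J$ (around $\tilde t_0$) is a $u\in\mathcal{G}[J,U]$ such that the differential equation holds in $\mathcal{G}(J)^n$, where $F(t,u(t))$ is the composition $F\circ(\mathrm{id},u)$, and the initial condition holds as an equality in the set $\tilde U$ of generalized points. *)

theory Defs
  imports "HOL-Analysis.Analysis" "HOL-Library.Landau_Symbols" "HOL-Library.Set_Algebras"
begin

text \<open>
  Nets are functions on all of \<open>real\<close>, but only the indices in \<open>{0<..1}\<close> matter. A net of
  functions on an open set \<open>U\<close> has values outside \<open>U\<close> too; these are never inspected, and the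
  equivalence relations below identify nets that differ only there.
\<close>

definition compactly_inside :: "'a::topological_space set \<Rightarrow> 'a set \<Rightarrow> bool"
    (infix "\<subset>\<subset>" 50) where
  "A \<subset>\<subset> B \<longleftrightarrow> compact A \<and> A \<subseteq> interior B"

text \<open>
  \<open>sup_bigo K f g\<close> says that the supremum over \<open>x \<in> K\<close> of \<open>\<bar>f \<epsilon> x\<bar>\<close> is \<open>O(g \<epsilon>)\<close> as
  \<open>\<epsilon>\<close> tends to \<open>0\<close>. It is written with a uniform bound because \<open>Sup\<close> on \<open>real\<close> is
  unspecified for empty and for unbounded sets.
\<close>

definition sup_bigo :: "'a set \<Rightarrow> (real \<Rightarrow> 'a \<Rightarrow> real) \<Rightarrow> (real \<Rightarrow> real) \<Rightarrow> bool" where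
  "sup_bigo K f g \<longleftrightarrow> (\<exists>C. \<forall>\<^sub>F \<epsilon> in at_right 0. \<forall>x\<in>K. \<bar>f \<epsilon> x\<bar> \<le> C * \<bar>g \<epsilon>\<bar>)"


subsection \<open>Smooth functions\<close>

definition partial_deriv ::
    "'a::real_normed_vector \<Rightarrow> ('a \<Rightarrow> 'b::real_normed_vector) \<Rightarrow> 'a \<Rightarrow> 'b" where
  "partial_deriv b f x = vector_derivative (\<lambda>s. f (x + s *\<^sub>R b)) (at 0)"

text \<open>
  A multi-index is given as a list of directions from \<open>Basis\<close>. For smooth functions on open
  sets the order of the directions is irrelevant, so quantifying over all such lists is
  quantifying over all multi-indices.
\<close>

definition partial_derivs ::
    "'a::real_normed_vector list \<Rightarrow> ('a \<Rightarrow> 'b::real_normed_vector) \<Rightarrow> 'a \<Rightarrow> 'b" where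
  "partial_derivs bs f = foldr partial_deriv bs f"

definition smooth_on :: "'a::euclidean_space set \<Rightarrow> ('a \<Rightarrow> real) \<Rightarrow> bool" where
  "smooth_on U f \<longleftrightarrow>
     (\<forall>bs. set bs \<subseteq> Basis \<longrightarrow>
        continuous_on U (partial_derivs bs f) \<and>
        (\<forall>x\<in>U. \<forall>b\<in>Basis. (\<lambda>s. partial_derivs bs f (x + s *\<^sub>R b)) differentiable at 0))"


subsection \<open>The special Colombeau algebra\<close>

definition moderate :: "'a::euclidean_space set \<Rightarrow> (real \<Rightarrow> 'a \<Rightarrow> real) set" where
  "moderate U = {u. (\<forall>\<epsilon>\<in>{0<..1}. smooth_on U (u \<epsilon>)) \<and>
     (\<forall>K bs. K \<subset>\<subset> U \<longrightarrow> set bs \<subseteq> Basis \<longrightarrow>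
        (\<exists>N::nat. sup_bigo K (\<lambda>\<epsilon>. partial_derivs bs (u \<epsilon>)) (\<lambda>\<epsilon>. inverse (\<epsilon> ^ N))))}"

definition negligible_nets :: "'a::euclidean_space set \<Rightarrow> (real \<Rightarrow> 'a \<Rightarrow> real) set" where
  "negligible_nets U = {u. (\<forall>\<epsilon>\<in>{0<..1}. smooth_on U (u \<epsilon>)) \<and>
     (\<forall>K bs. K \<subset>\<subset> U \<longrightarrow> set bs \<subseteq> Basis \<longrightarrow>
        (\<forall>m::nat. sup_bigo K (\<lambda>\<epsilon>. partial_derivs bs (u \<epsilon>)) (\<lambda>\<epsilon>. \<epsilon> ^ m)))}"

definition moderate_vec ::
    "'a::euclidean_space set \<Rightarrow> (real \<Rightarrow> 'a \<Rightarrow> 'b::euclidean_space) set" where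
  "moderate_vec U = {u. \<forall>j\<in>Basis. (\<lambda>\<epsilon> x. u \<epsilon> x \<bullet> j) \<in> moderate U}"

definition negligible_vec ::
    "'a::euclidean_space set \<Rightarrow> (real \<Rightarrow> 'a \<Rightarrow> 'b::euclidean_space) set" where
  "negligible_vec U = {u. \<forall>j\<in>Basis. (\<lambda>\<epsilon> x. u \<epsilon> x \<bullet> j) \<in> negligible_nets U}"

definition gf_rel ::
    "'a::euclidean_space set \<Rightarrow>
     ((real \<Rightarrow> 'a \<Rightarrow> 'b::euclidean_space) \<times> (real \<Rightarrow> 'a \<Rightarrow> 'b)) set" where
  "gf_rel U = {(u, v). u \<in> moderate_vec U \<and> v \<in> moderate_vec U \<and>
                       (\<lambda>\<epsilon> x. u \<epsilon> x - v \<epsilon> x) \<in> negligible_vec U}"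

text \<open>
  Generalized functions on \<open>U\<close> with values in \<open>'b\<close>. Operations on them are defined below by
  taking the union of the classes obtained from all admissible representatives; all these
  classes coincide.
\<close>

definition colombeau ::
    "'a::euclidean_space set \<Rightarrow> (real \<Rightarrow> 'a \<Rightarrow> 'b::euclidean_space) set set" where
  "colombeau U = moderate_vec U // gf_rel U"

definition gf_class ::
    "'a::euclidean_space set \<Rightarrow> (real \<Rightarrow> 'a \<Rightarrow> 'b::euclidean_space) \<Rightarrow> (real \<Rightarrow> 'a \<Rightarrow> 'b) set" where
  "gf_class U u = gf_rel U `` {u}"

definition gf_partial ::
    "'a::euclidean_space \<Rightarrow> 'a set \<Rightarrow> (real \<Rightarrow> 'a \<Rightarrow> 'b::euclidean_space) set \<Rightarrow>
     (real \<Rightarrow> 'a \<Rightarrow> 'b) set" where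
  "gf_partial b U u = (\<Union>u'\<in>u. gf_class U (\<lambda>\<epsilon>. partial_deriv b (u' \<epsilon>)))"


subsection \<open>C-boundedness and composition\<close>

definition c_bounded ::
    "'a::euclidean_space set \<Rightarrow> 'b::euclidean_space set \<Rightarrow> (real \<Rightarrow> 'a \<Rightarrow> 'b) \<Rightarrow> bool" where
  "c_bounded U V u \<longleftrightarrow> u \<in> moderate_vec U \<and>
     (\<exists>\<epsilon>\<^sub>0\<in>{0<..1}. \<forall>\<epsilon>\<in>{0<..\<epsilon>\<^sub>0}. u \<epsilon> ` U \<subseteq> V) \<and>
     (\<forall>K. K \<subset>\<subset> U \<longrightarrow> (\<exists>L. L \<subset>\<subset> V \<and> (\<exists>\<epsilon>\<^sub>0\<in>{0<..1}. \<forall>\<epsilon>\<in>{0<..\<epsilon>\<^sub>0}. u \<epsilon> ` K \<subseteq> L)))"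

definition colombeau_cb ::
    "'a::euclidean_space set \<Rightarrow> 'b::euclidean_space set \<Rightarrow> (real \<Rightarrow> 'a \<Rightarrow> 'b) set set" where
  "colombeau_cb U V = {u \<in> colombeau U. \<exists>u'\<in>u. c_bounded U V u'}"

text \<open>
  For those \<open>\<epsilon>\<close> with \<open>u \<epsilon> ` U\<close> not contained in \<open>V\<close> the composition is undefined;
  it is set to \<open>0\<close>, which keeps it smooth. Only small \<open>\<epsilon>\<close> matter for the class.
\<close>

definition comp_net ::
    "'a set \<Rightarrow> 'b set \<Rightarrow> (real \<Rightarrow> 'b \<Rightarrow> 'c::zero) \<Rightarrow> (real \<Rightarrow> 'a \<Rightarrow> 'b) \<Rightarrow> real \<Rightarrow> 'a \<Rightarrow> 'c" where
  "comp_net U V v u = (\<lambda>\<epsilon> x. if u \<epsilon> ` U \<subseteq> V then v \<epsilon> (u \<epsilon> x) else 0)"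

definition gf_comp ::
    "'a::euclidean_space set \<Rightarrow> 'b::euclidean_space set \<Rightarrow>
     (real \<Rightarrow> 'b \<Rightarrow> 'c::euclidean_space) set \<Rightarrow> (real \<Rightarrow> 'a \<Rightarrow> 'b) set \<Rightarrow> (real \<Rightarrow> 'a \<Rightarrow> 'c) set" where
  "gf_comp U V v u = (\<Union>v'\<in>v. \<Union>u'\<in>{u'\<in>u. c_bounded U V u'}. gf_class U (comp_net U V v' u'))"

text \<open>The generalized function \<open>(id, u)\<close>.\<close>

definition gf_graph ::
    "'a::euclidean_space set \<Rightarrow> (real \<Rightarrow> 'a \<Rightarrow> 'b::euclidean_space) set \<Rightarrow>
     (real \<Rightarrow> 'a \<Rightarrow> 'a \<times> 'b) set" where
  "gf_graph U u = (\<Union>u'\<in>u. gf_class U (\<lambda>\<epsilon> x. (x, u' \<epsilon> x)))"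


subsection \<open>Generalized points\<close>

definition gp_nets :: "'a::euclidean_space set \<Rightarrow> (real \<Rightarrow> 'a) set" where
  "gp_nets U = {x. (\<forall>\<epsilon>\<in>{0<..1}. x \<epsilon> \<in> U) \<and>
     (\<exists>N::nat. (\<lambda>\<epsilon>. norm (x \<epsilon>)) \<in> O[at_right 0](\<lambda>\<epsilon>. inverse (\<epsilon> ^ N)))}"

definition gp_equiv :: "(real \<Rightarrow> 'a::euclidean_space) \<Rightarrow> (real \<Rightarrow> 'a) \<Rightarrow> bool" where
  "gp_equiv x y \<longleftrightarrow> (\<forall>m::nat. (\<lambda>\<epsilon>. norm (x \<epsilon> - y \<epsilon>)) \<in> O[at_right 0](\<lambda>\<epsilon>. \<epsilon> ^ m))"

definition gp_rel :: "'a::euclidean_space set \<Rightarrow> ((real \<Rightarrow> 'a) \<times> (real \<Rightarrow> 'a)) set" where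
  "gp_rel U = {(x, y). x \<in> gp_nets U \<and> y \<in> gp_nets U \<and> gp_equiv x y}"

definition gen_points :: "'a::euclidean_space set \<Rightarrow> (real \<Rightarrow> 'a) set set" where
  "gen_points U = gp_nets U // gp_rel U"

definition gp_class :: "'a::euclidean_space set \<Rightarrow> (real \<Rightarrow> 'a) \<Rightarrow> (real \<Rightarrow> 'a) set" where
  "gp_class U x = gp_rel U `` {x}"

definition gen_points_c :: "'a::euclidean_space set \<Rightarrow> (real \<Rightarrow> 'a) set set" where
  "gen_points_c U = {x \<in> gen_points U.
     \<exists>x'\<in>x. \<exists>K. K \<subset>\<subset> U \<and> (\<exists>\<epsilon>\<^sub>0\<in>{0<..1}. \<forall>\<epsilon>\<in>{0<..\<epsilon>\<^sub>0}. x' \<epsilon> \<in> K)}"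

definition near_standard ::
    "'a::euclidean_space set \<Rightarrow> (real \<Rightarrow> 'a) set \<Rightarrow> 'a \<Rightarrow> bool" where
  "near_standard U x p \<longleftrightarrow>
     x \<in> gen_points_c U \<and> p \<in> U \<and> (\<exists>x'\<in>x. (x' \<longlongrightarrow> p) (at_right 0))"

text \<open>
  \<open>gp_in V x\<close> is the generalized point \<open>x\<close> regarded as a generalized point of \<open>V\<close>: the class
  of those nets with all values in \<open>V\<close> that are equivalent to the representatives of \<open>x\<close>. A
  point of \<open>I\<close> that lies in a smaller set \<open>J\<close> for small \<open>\<epsilon>\<close> only is in this way a point of \<open>J\<close>.
\<close>

definition gp_in :: "'a::euclidean_space set \<Rightarrow> (real \<Rightarrow> 'a) set \<Rightarrow> (real \<Rightarrow> 'a) set" where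
  "gp_in V x = {y \<in> gp_nets V. \<exists>x'\<in>x. gp_equiv x' y}"

definition point_value ::
    "(real \<Rightarrow> 'a::euclidean_space \<Rightarrow> 'b::euclidean_space) set \<Rightarrow> (real \<Rightarrow> 'a) set \<Rightarrow>
     (real \<Rightarrow> 'b) set" where
  "point_value u x = (\<Union>u'\<in>u. \<Union>x'\<in>x. gp_class UNIV (\<lambda>\<epsilon>. u' \<epsilon> (x' \<epsilon>)))"


subsection \<open>Initial value problems\<close>

text \<open>
  The initial time is first regarded as a point of \<open>J\<close>, where the solution lives, and the
  value of the solution there as a point of \<open>U\<close>.
\<close>

definition ivp_solution ::
    "real set \<Rightarrow> 'b::euclidean_space set \<Rightarrow> (real \<Rightarrow> real \<times> 'b \<Rightarrow> 'b) set \<Rightarrow>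
     (real \<Rightarrow> real) set \<Rightarrow> (real \<Rightarrow> 'b) set \<Rightarrow> real set \<Rightarrow> (real \<Rightarrow> real \<Rightarrow> 'b) set \<Rightarrow> bool" where
  "ivp_solution I U F t\<^sub>0 x\<^sub>0 J u \<longleftrightarrow>
     u \<in> colombeau_cb J U \<and>
     gf_partial 1 J u = gf_comp J (I \<times> U) F (gf_graph J u) \<and>
     gp_in U (point_value u (gp_in J t\<^sub>0)) = x\<^sub>0"

end

theory Submission
  imports Defs
begin

text \<open>
  The theorem is Picard's theorem applied for each index \<open>\<epsilon>\<close> separately, together with estimates that show
  that the resulting nets are moderate, c-bounded and, under the logarithmic condition, unique up to negligible
  nets.

  The sets \<open>I\<close>, \<open>U\<close>, \<open>L\<close>, \<open>W\<close> and the numbers \<open>\<alpha>\<close>, \<open>\<beta>\<close>, \<open>a\<close>, \<open>h\<close> are those of the theorem, \<open>F\<close> is a representative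
  of the right hand side, and \<open>\<tau> \<epsilon>\<close>, \<open>y \<epsilon>\<close> are representatives of the initial time and of the initial value.

  All identities between generalized functions on an interval reduce to estimates of values: a moderate net
  whose values are negligible has negligible derivatives (\<open>negligible_netsI\<close>). Composition is compatible
  with the choice of representatives (\<open>comp_net_cong\<close>), and so are point values. Hence a c-bounded net
  \<open>w\<close> represents a solution exactly if \<open>w' - F \<circ> (id, w)\<close> and \<open>w \<epsilon> (\<tau> \<epsilon>) - y \<epsilon>\<close> are negligible
  (\<open>ivp_solution_iff\<close>).

  Existence. A curve that starts at \<open>(\<tau> \<epsilon>, y \<epsilon>)\<close> with velocity at most \<open>a\<close> stays in the ball of radius \<open>\<beta>\<close>
  around \<open>y \<epsilon>\<close> up to distance \<open>\<beta> / a\<close> from \<open>\<tau> \<epsilon>\<close>. On this convex compact ball the right hand side is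
  bounded by \<open>a\<close> and Lipschitz continuous, so the classical solution exists (\<open>smooth_solution_exists\<close>). Since
  \<open>\<tau> \<epsilon>\<close> converges to \<open>t\<^sub>0\<close> but need not equal it, this solution can leave \<open>W\<close> or cease to exist near
  the ends of \<open>J\<close>. A smooth cutoff function replaces it there by the constant \<open>y \<epsilon>\<close> (\<open>cutoff_net\<close>), on
  intervals that shrink to the end points as \<open>\<epsilon>\<close> tends to \<open>0\<close>, which is invisible on compact subsets of \<open>J\<close>. The derivatives are
  moderate by bootstrapping in the differential equation (\<open>ode_solution_moderate\<close>).

  Localization. A representative \<open>w\<close> of an arbitrary solution satisfies the equation up to a negligible error, and on
  a compact subinterval of \<open>J\<close> the same bound for the velocity leaves a margin that absorbs all errors
  (\<open>solution_estimate\<close>). Hence \<open>w\<close> takes values in a compact subset of \<open>W\<close> there, for small indices.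
  The same cutoff turns \<open>w\<close> into an equivalent net with values in \<open>W\<close> on all of \<open>J\<close> (\<open>solution_in_W\<close>).

  Uniqueness. Two solutions stay in the same ball around \<open>y \<epsilon>\<close>, in which \<open>F\<close> has a Lipschitz constant
  \<open>C \<bar>ln \<epsilon>\<bar>\<close>. Gronwall's inequality bounds their difference by a negligible net times a
  multiple of \<open>exp (2 h C \<bar>ln \<epsilon>\<bar>)\<close>, a power of \<open>1 / \<epsilon>\<close>, so the difference is negligible (\<open>solution_unique\<close>).
\<close>

section \<open>Nets and their order of growth\<close>

text \<open>
  A constant factor in an estimate is absorbed by one further power of \<open>\<epsilon>\<close>, as \<open>C \<le> 1 / \<epsilon>\<close> for small
  \<open>\<epsilon>\<close>. Growth conditions are therefore stated without constants.
\<close>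

definition moderate_on :: "'a set \<Rightarrow> (real \<Rightarrow> 'a \<Rightarrow> 'b::real_normed_vector) \<Rightarrow> bool" where
  "moderate_on K f \<longleftrightarrow>
     (\<exists>N::nat. \<forall>\<^sub>F \<epsilon> in at_right 0. \<forall>x\<in>K. norm (f \<epsilon> x) \<le> inverse (\<epsilon> ^ N))"

definition negligible_on :: "'a set \<Rightarrow> (real \<Rightarrow> 'a \<Rightarrow> 'b::real_normed_vector) \<Rightarrow> bool" where
  "negligible_on K f \<longleftrightarrow>
     (\<forall>m::nat. \<forall>\<^sub>F \<epsilon> in at_right 0. \<forall>x\<in>K. norm (f \<epsilon> x) \<le> \<epsilon> ^ m)"

lemma eventually_index_less:
  assumes "c > 0"
  shows "\<forall>\<^sub>F \<epsilon> in at_right (0::real). 0 < \<epsilon> \<and> \<epsilon> < c"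
  using eventually_at_right_real[OF assms] by eventually_elim auto

lemma eventually_index: "\<forall>\<^sub>F \<epsilon> in at_right (0::real). 0 < \<epsilon> \<and> \<epsilon> < 1"
  by (rule eventually_index_less) simp

lemma eventually_le_inverse:
  "\<forall>\<^sub>F \<epsilon> in at_right (0::real). C \<le> inverse \<epsilon>"
proof -
  have "\<forall>\<^sub>F \<epsilon> in at_right (0::real). 0 < \<epsilon> \<and> \<epsilon> < inverse (max C 1)"
    by (rule eventually_index_less) simp
  then show ?thesis
  proof eventually_elim
    case (elim \<epsilon>)
    have "max C 1 \<le> inverse \<epsilon>"
      using elim by (metis inverse_inverse_eq le_imp_inverse_le less_imp_le)
    then show ?case by simp
  qed
qed

lemma eventually_mult_le_one:
  assumes "0 < (\<epsilon>::real)" "C \<le> inverse \<epsilon>"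
  shows "C * \<epsilon> \<le> 1"
  using assms by (simp add: field_simps)

lemma inverse_power_mono:
  assumes "0 < (\<epsilon>::real)" "\<epsilon> < 1" "N \<le> M"
  shows "inverse (\<epsilon> ^ N) \<le> inverse (\<epsilon> ^ M)"
  using assms by (intro le_imp_inverse_le power_decreasing) auto

lemma moderate_onI:
  assumes "\<forall>\<^sub>F \<epsilon> in at_right 0. \<forall>x\<in>K. norm (f \<epsilon> x) \<le> C * inverse (\<epsilon> ^ N)"
  shows "moderate_on K f"
  unfolding moderate_on_def
proof
  show "\<forall>\<^sub>F \<epsilon> in at_right 0. \<forall>x\<in>K. norm (f \<epsilon> x) \<le> inverse (\<epsilon> ^ Suc N)"
    using assms eventually_le_inverse[of C] eventually_index
  proof eventually_elim
    case (elim \<epsilon>)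
    have "C * inverse (\<epsilon> ^ N) \<le> inverse (\<epsilon> ^ Suc N)"
      using elim by (auto intro!: mult_right_mono)
    then show ?case using elim by (meson order_trans)
  qed
qed

lemma negligible_onI:
  assumes "\<And>m. \<exists>C. \<forall>\<^sub>F \<epsilon> in at_right 0. \<forall>x\<in>K. norm (f \<epsilon> x) \<le> C * \<epsilon> ^ m"
  shows "negligible_on K f"
  unfolding negligible_on_def
proof
  fix m
  obtain C where "\<forall>\<^sub>F \<epsilon> in at_right 0. \<forall>x\<in>K. norm (f \<epsilon> x) \<le> C * \<epsilon> ^ Suc m"
    using assms by blast
  then show "\<forall>\<^sub>F \<epsilon> in at_right 0. \<forall>x\<in>K. norm (f \<epsilon> x) \<le> \<epsilon> ^ m"
    using eventually_le_inverse[of C] eventually_index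
  proof eventually_elim
    case (elim \<epsilon>)
    have "(C * \<epsilon>) * \<epsilon> ^ m \<le> 1 * \<epsilon> ^ m"
      using elim by (intro mult_right_mono eventually_mult_le_one) auto
    then have "C * \<epsilon> ^ Suc m \<le> \<epsilon> ^ m" by (simp add: mult.assoc)
    then show ?case using elim by (meson order_trans)
  qed
qed

lemma moderate_on_iff_sup_bigo:
  "(\<exists>N::nat. sup_bigo K f (\<lambda>\<epsilon>. inverse (\<epsilon> ^ N))) \<longleftrightarrow> moderate_on K f"
proof
  assume "\<exists>N::nat. sup_bigo K f (\<lambda>\<epsilon>. inverse (\<epsilon> ^ N))"
  then obtain N C
    where *: "\<forall>\<^sub>F \<epsilon> in at_right 0. \<forall>x\<in>K. \<bar>f \<epsilon> x\<bar> \<le> C * \<bar>inverse (\<epsilon> ^ N)\<bar>"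
    unfolding sup_bigo_def by blast
  show "moderate_on K f"
    by (rule moderate_onI[where C=C and N=N])
       (use * eventually_index in \<open>eventually_elim, auto\<close>)
next
  assume "moderate_on K f"
  then obtain N where *: "\<forall>\<^sub>F \<epsilon> in at_right 0. \<forall>x\<in>K. \<bar>f \<epsilon> x\<bar> \<le> inverse (\<epsilon> ^ N)"
    unfolding moderate_on_def by auto
  have "\<forall>\<^sub>F \<epsilon> in at_right 0. \<forall>x\<in>K. \<bar>f \<epsilon> x\<bar> \<le> 1 * \<bar>inverse (\<epsilon> ^ N)\<bar>"
    using * eventually_index by eventually_elim auto
  then show "\<exists>N::nat. sup_bigo K f (\<lambda>\<epsilon>. inverse (\<epsilon> ^ N))"
    unfolding sup_bigo_def by blast
qed

lemma negligible_on_iff_sup_bigo: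
  "(\<forall>m::nat. sup_bigo K f (\<lambda>\<epsilon>. \<epsilon> ^ m)) \<longleftrightarrow> negligible_on K f"
proof
  assume *: "\<forall>m::nat. sup_bigo K f (\<lambda>\<epsilon>. \<epsilon> ^ m)"
  show "negligible_on K f"
  proof (rule negligible_onI)
    fix m
    obtain C where "\<forall>\<^sub>F \<epsilon> in at_right 0. \<forall>x\<in>K. \<bar>f \<epsilon> x\<bar> \<le> C * \<bar>\<epsilon> ^ m\<bar>"
      using * unfolding sup_bigo_def by blast
    then have "\<forall>\<^sub>F \<epsilon> in at_right 0. \<forall>x\<in>K. norm (f \<epsilon> x) \<le> C * \<epsilon> ^ m"
      using eventually_index by eventually_elim auto
    then show "\<exists>C. \<forall>\<^sub>F \<epsilon> in at_right 0. \<forall>x\<in>K. norm (f \<epsilon> x) \<le> C * \<epsilon> ^ m" ..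
  qed
next
  assume *: "negligible_on K f"
  show "\<forall>m::nat. sup_bigo K f (\<lambda>\<epsilon>. \<epsilon> ^ m)"
  proof
    fix m
    have "\<forall>\<^sub>F \<epsilon> in at_right 0. \<forall>x\<in>K. \<bar>f \<epsilon> x\<bar> \<le> \<epsilon> ^ m"
      using * unfolding negligible_on_def by auto
    then have "\<forall>\<^sub>F \<epsilon> in at_right 0. \<forall>x\<in>K. \<bar>f \<epsilon> x\<bar> \<le> 1 * \<bar>\<epsilon> ^ m\<bar>"
      using eventually_index by eventually_elim auto
    then show "sup_bigo K f (\<lambda>\<epsilon>. \<epsilon> ^ m)"
      unfolding sup_bigo_def by blast
  qed
qed

lemma moderate_on_bounded:
  assumes "\<forall>\<^sub>F \<epsilon> in at_right 0. \<forall>x\<in>K. norm (f \<epsilon> x) \<le> C"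
  shows "moderate_on K f"
  by (rule moderate_onI[where N=0 and C=C]) (use assms in simp)

lemma moderate_on_le:
  assumes "moderate_on K g"
    and "\<forall>\<^sub>F \<epsilon> in at_right 0. \<forall>x\<in>K. norm (f \<epsilon> x) \<le> norm (g \<epsilon> x)"
  shows "moderate_on K f"
proof -
  obtain N where "\<forall>\<^sub>F \<epsilon> in at_right 0. \<forall>x\<in>K. norm (g \<epsilon> x) \<le> inverse (\<epsilon> ^ N)"
    using assms(1) unfolding moderate_on_def by blast
  with assms(2) have "\<forall>\<^sub>F \<epsilon> in at_right 0. \<forall>x\<in>K. norm (f \<epsilon> x) \<le> inverse (\<epsilon> ^ N)"
    by eventually_elim force
  then show ?thesis unfolding moderate_on_def by blast
qed

lemma negligible_on_le:
  assumes "negligible_on K g"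
    and "\<forall>\<^sub>F \<epsilon> in at_right 0. \<forall>x\<in>K. norm (f \<epsilon> x) \<le> norm (g \<epsilon> x)"
  shows "negligible_on K f"
  unfolding negligible_on_def
proof
  fix m
  have "\<forall>\<^sub>F \<epsilon> in at_right 0. \<forall>x\<in>K. norm (g \<epsilon> x) \<le> \<epsilon> ^ m"
    using assms(1) unfolding negligible_on_def by blast
  with assms(2) show "\<forall>\<^sub>F \<epsilon> in at_right 0. \<forall>x\<in>K. norm (f \<epsilon> x) \<le> \<epsilon> ^ m"
    by eventually_elim force
qed

lemma moderate_on_add:
  assumes "moderate_on K f" "moderate_on K g"
  shows "moderate_on K (\<lambda>\<epsilon> x. f \<epsilon> x + g \<epsilon> x)"
proof -
  obtain N M where N: "\<forall>\<^sub>F \<epsilon> in at_right 0. \<forall>x\<in>K. norm (f \<epsilon> x) \<le> inverse (\<epsilon> ^ N)"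
    and M: "\<forall>\<^sub>F \<epsilon> in at_right 0. \<forall>x\<in>K. norm (g \<epsilon> x) \<le> inverse (\<epsilon> ^ M)"
    using assms unfolding moderate_on_def by blast
  have "\<forall>\<^sub>F \<epsilon> in at_right 0. \<forall>x\<in>K. norm (f \<epsilon> x + g \<epsilon> x) \<le> 2 * inverse (\<epsilon> ^ max N M)"
    using N M eventually_index
  proof eventually_elim
    case (elim \<epsilon>)
    show ?case
    proof
      fix x assume "x \<in> K"
      have "inverse (\<epsilon> ^ N) \<le> inverse (\<epsilon> ^ max N M)" "inverse (\<epsilon> ^ M) \<le> inverse (\<epsilon> ^ max N M)"
        using elim by (auto intro!: inverse_power_mono)
      then show "norm (f \<epsilon> x + g \<epsilon> x) \<le> 2 * inverse (\<epsilon> ^ max N M)"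
        using elim(1,2) \<open>x \<in> K\<close> norm_triangle_ineq[of "f \<epsilon> x" "g \<epsilon> x"] by (smt (verit))
    qed
  qed
  then show ?thesis by (rule moderate_onI)
qed

lemma moderate_on_mult:
  fixes f g :: "real \<Rightarrow> 'a \<Rightarrow> real"
  assumes "moderate_on K f" "moderate_on K g"
  shows "moderate_on K (\<lambda>\<epsilon> x. f \<epsilon> x * g \<epsilon> x)"
proof -
  obtain N M where N: "\<forall>\<^sub>F \<epsilon> in at_right 0. \<forall>x\<in>K. norm (f \<epsilon> x) \<le> inverse (\<epsilon> ^ N)"
    and M: "\<forall>\<^sub>F \<epsilon> in at_right 0. \<forall>x\<in>K. norm (g \<epsilon> x) \<le> inverse (\<epsilon> ^ M)"
    using assms unfolding moderate_on_def by blast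
  have "\<forall>\<^sub>F \<epsilon> in at_right 0. \<forall>x\<in>K. norm (f \<epsilon> x * g \<epsilon> x) \<le> inverse (\<epsilon> ^ (N + M))"
    using N M eventually_index
  proof eventually_elim
    case (elim \<epsilon>)
    show ?case
    proof
      fix x assume "x \<in> K"
      then have "norm (f \<epsilon> x) * norm (g \<epsilon> x) \<le> inverse (\<epsilon> ^ N) * inverse (\<epsilon> ^ M)"
        using elim by (intro mult_mono) auto
      then show "norm (f \<epsilon> x * g \<epsilon> x) \<le> inverse (\<epsilon> ^ (N + M))"
        by (simp add: power_add abs_mult)
    qed
  qed
  then show ?thesis unfolding moderate_on_def by blast
qed

lemma negligible_on_add:
  assumes "negligible_on K f" "negligible_on K g"
  shows "negligible_on K (\<lambda>\<epsilon> x. f \<epsilon> x + g \<epsilon> x)"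
proof (rule negligible_onI)
  fix m
  have "\<forall>\<^sub>F \<epsilon> in at_right 0. \<forall>x\<in>K. norm (f \<epsilon> x) \<le> \<epsilon> ^ m"
    "\<forall>\<^sub>F \<epsilon> in at_right 0. \<forall>x\<in>K. norm (g \<epsilon> x) \<le> \<epsilon> ^ m"
    using assms unfolding negligible_on_def by blast+
  then have "\<forall>\<^sub>F \<epsilon> in at_right 0. \<forall>x\<in>K. norm (f \<epsilon> x + g \<epsilon> x) \<le> 2 * \<epsilon> ^ m"
  proof eventually_elim
    case (elim \<epsilon>)
    show ?case
    proof
      fix x assume "x \<in> K"
      then show "norm (f \<epsilon> x + g \<epsilon> x) \<le> 2 * \<epsilon> ^ m"
        using elim norm_triangle_ineq[of "f \<epsilon> x" "g \<epsilon> x"] by fastforce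
    qed
  qed
  then show "\<exists>C. \<forall>\<^sub>F \<epsilon> in at_right 0. \<forall>x\<in>K. norm (f \<epsilon> x + g \<epsilon> x) \<le> C * \<epsilon> ^ m" ..
qed

lemma negligible_on_minus_commute:
  "negligible_on K (\<lambda>\<epsilon> x. f \<epsilon> x - g \<epsilon> x) \<longleftrightarrow> negligible_on K (\<lambda>\<epsilon> x. g \<epsilon> x - f \<epsilon> x)"
  by (simp add: negligible_on_def norm_minus_commute)

lemma negligible_on_trans:
  assumes "negligible_on K (\<lambda>\<epsilon> x. f \<epsilon> x - g \<epsilon> x)" "negligible_on K (\<lambda>\<epsilon> x. g \<epsilon> x - h \<epsilon> x)"
  shows "negligible_on K (\<lambda>\<epsilon> x. f \<epsilon> x - h \<epsilon> x)"
  using negligible_on_add[OF assms] by simp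

lemma moderate_on_cong:
  assumes "\<forall>\<^sub>F \<epsilon> in at_right 0. \<forall>x\<in>K. f \<epsilon> x = g \<epsilon> x"
  shows "moderate_on K f \<longleftrightarrow> moderate_on K g"
  using assms by (auto intro: moderate_on_le elim!: eventually_mono)

lemma negligible_on_sum:
  assumes "\<And>i. i \<in> A \<Longrightarrow> negligible_on K (f i)"
  shows "negligible_on K (\<lambda>\<epsilon> x. \<Sum>i\<in>A. f i \<epsilon> x)"
  using assms
proof (induction A rule: infinite_finite_induct)
  case (insert i A)
  then have "negligible_on K (\<lambda>\<epsilon> x. f i \<epsilon> x + (\<Sum>i\<in>A. f i \<epsilon> x))"
    by (intro negligible_on_add) auto
  then show ?case using insert by simp
qed (auto simp: negligible_on_def intro!: eventually_mono[OF eventually_index])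

lemma negligible_on_componentwise:
  fixes f :: "real \<Rightarrow> 'a \<Rightarrow> 'b::euclidean_space"
  shows "negligible_on K f \<longleftrightarrow> (\<forall>j\<in>Basis. negligible_on K (\<lambda>\<epsilon> x. f \<epsilon> x \<bullet> j))"
proof (intro iffI ballI)
  fix j :: 'b assume "negligible_on K f" "j \<in> Basis"
  then show "negligible_on K (\<lambda>\<epsilon> x. f \<epsilon> x \<bullet> j)"
    by (rule_tac negligible_on_le) (auto simp: Basis_le_norm)
next
  assume "\<forall>j\<in>Basis. negligible_on K (\<lambda>\<epsilon> x. f \<epsilon> x \<bullet> j)"
  then have "negligible_on K (\<lambda>\<epsilon> x. \<Sum>j\<in>Basis. \<bar>f \<epsilon> x \<bullet> j\<bar>)"
    by (intro negligible_on_sum) (auto simp: negligible_on_def)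
  then show "negligible_on K f"
    by (rule negligible_on_le) (auto simp: norm_le_l1 sum_nonneg)
qed

section \<open>Compact subsets of open sets\<close>

text \<open>
  Room around a compact set is needed for segments between neighbouring points, for difference
  quotients, and for derivatives, which depend on the values in a neighbourhood.
\<close>

lemma compactly_inside_enlarge:
  fixes V :: "'a::euclidean_space set"
  assumes "K \<subset>\<subset> V"
  obtains r K' where "r > 0" "K' \<subset>\<subset> V" "\<And>x. x \<in> K \<Longrightarrow> cball x r \<subseteq> K'" "K \<subseteq> interior K'"
proof -
  have K: "compact K" "K \<subseteq> interior V" using assms by (auto simp: compactly_inside_def)
  obtain r where r: "r > 0" "(\<Union>x\<in>K. cball x r) \<subseteq> interior V"
    using compact_subset_open_imp_cball_epsilon_subset[OF K(1) open_interior K(2)] by metis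
  define K' where "K' = (\<Union>x\<in>K. cball x r)"
  have eq: "K' = (\<Union>x\<in>K. \<Union>y\<in>cball 0 r. {x + y})"
  proof -
    have "z \<in> (\<Union>x\<in>K. \<Union>y\<in>cball 0 r. {x + y})" if "x \<in> K" "z \<in> cball x r" for x z
      using that by (intro UN_I[of x] UN_I[of "z - x"]) (auto simp: dist_norm norm_minus_commute)
    then show ?thesis by (auto simp: K'_def dist_norm)
  qed
  have "compact K'"
    unfolding eq by (rule compact_sums'[OF K(1) compact_cball])
  moreover have "K \<subseteq> interior K'"
  proof
    fix x assume "x \<in> K"
    then have "ball x r \<subseteq> K'" unfolding K'_def by (meson UN_upper ball_subset_cball order_trans)
    then show "x \<in> interior K'" using r(1) by (meson centre_in_ball interiorI open_ball)
  qed
  ultimately show thesis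
    using r by (intro that[of r K']) (auto simp: K'_def compactly_inside_def)
qed

lemma compactly_inside_open: "open V \<Longrightarrow> K \<subset>\<subset> V \<longleftrightarrow> compact K \<and> K \<subseteq> V"
  by (simp add: compactly_inside_def interior_open)

lemma compactly_inside_interval:
  fixes l r :: real
  assumes "K \<subset>\<subset> {l<..<r}"
  obtains \<eta> where "\<eta> > 0" "K \<subseteq> {l + \<eta>..r - \<eta>}"
proof -
  obtain e K' where e: "e > 0" "K' \<subset>\<subset> {l<..<r}" "\<And>x. x \<in> K \<Longrightarrow> cball x e \<subseteq> K'"
    using compactly_inside_enlarge[OF assms] by metis
  have "x \<in> {l + e..r - e}" if "x \<in> K" for x
  proof -
    have "{x - e..x + e} \<subseteq> {l<..<r}"
      using e(2) e(3)[OF that] by (auto simp: compactly_inside_open cball_eq_atLeastAtMost)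
    then have "x - e \<in> {l<..<r}" "x + e \<in> {l<..<r}" using e(1) by (auto simp: subset_iff)
    then show ?thesis by auto
  qed
  then show thesis using e(1) that by blast
qed

section \<open>Calculus of smooth functions\<close>

lemma partial_derivs_simps [simp]:
  "partial_derivs [] f = f"
  "partial_derivs (b # bs) f = partial_deriv b (partial_derivs bs f)"
  by (auto simp: partial_derivs_def)

lemma partial_derivs_snoc: "partial_derivs (bs @ [b]) f = partial_derivs bs (partial_deriv b f)"
  by (induction bs) auto

lemma eventually_line_in_open:
  fixes x :: "'a::real_normed_vector"
  assumes "open S" "x \<in> S"
  shows "\<forall>\<^sub>F s::real in nhds 0. x + s *\<^sub>R b \<in> S"
proof -
  have "isCont (\<lambda>s::real. x + s *\<^sub>R b) 0"
    by (intro continuous_intros)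
  then have "((\<lambda>s::real. x + s *\<^sub>R b) \<longlongrightarrow> x + 0 *\<^sub>R b) (nhds 0)"
    using tendsto_at_iff_tendsto_nhds[of "\<lambda>s::real. x + s *\<^sub>R b" 0] by (simp add: isCont_def)
  then show ?thesis
    using assms by (auto dest: topological_tendstoD)
qed

lemma partial_deriv_cong_open:
  assumes "open S" "x \<in> S" "\<And>y. y \<in> S \<Longrightarrow> f y = g y"
  shows "partial_deriv b f x = partial_deriv b g x"
proof -
  have "\<forall>\<^sub>F s::real in nhds 0. x + s *\<^sub>R b \<in> S"
    by (rule eventually_line_in_open[OF assms(1,2)])
  then have "\<forall>\<^sub>F s::real in nhds 0. f (x + s *\<^sub>R b) = g (x + s *\<^sub>R b)"
    by eventually_elim (use assms(3) in auto)
  then show ?thesis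
    unfolding partial_deriv_def by (intro vector_derivative_cong_eq) auto
qed

lemma partial_derivs_cong_open:
  assumes "open S" "\<And>y. y \<in> S \<Longrightarrow> f y = g y" "x \<in> S"
  shows "partial_derivs bs f x = partial_derivs bs g x"
  using assms(3)
proof (induction bs arbitrary: x)
  case (Cons b bs)
  then show ?case
    using partial_deriv_cong_open[OF assms(1), of x "partial_derivs bs f" "partial_derivs bs g" b]
    by simp
qed (use assms(2) in auto)

text \<open>
  Nets are unconstrained outside their open domain, so every notion has to be invariant under changes there.
\<close>

lemma smooth_on_cong:
  assumes "open S" "smooth_on S f" "\<And>y. y \<in> S \<Longrightarrow> f y = g y"
  shows "smooth_on S g"
  unfolding smooth_on_def
proof (intro allI impI conjI ballI)
  fix bs :: "'a list" assume bs: "set bs \<subseteq> Basis"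
  have eq: "\<And>x. x \<in> S \<Longrightarrow> partial_derivs bs f x = partial_derivs bs g x"
    by (rule partial_derivs_cong_open[where S=S]) (use assms in auto)
  show "continuous_on S (partial_derivs bs g)"
    using assms(2) bs continuous_on_cong[OF refl, of S "partial_derivs bs f" "partial_derivs bs g"] eq
    unfolding smooth_on_def by auto
  fix x b assume x: "x \<in> S" and "b \<in> (Basis::'a set)"
  then have "(\<lambda>s. partial_derivs bs f (x + s *\<^sub>R b)) differentiable at 0"
    using assms(2) bs unfolding smooth_on_def by blast
  then obtain D where D: "((\<lambda>s. partial_derivs bs f (x + s *\<^sub>R b)) has_derivative D) (at 0)"
    unfolding differentiable_def by blast
  have "\<forall>\<^sub>F s::real in at 0. x + s *\<^sub>R b \<in> S"
    using eventually_line_in_open[OF assms(1) x, of b] unfolding eventually_at_filter by (rule eventually_mono) simp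
  then have "\<forall>\<^sub>F s::real in at 0. partial_derivs bs f (x + s *\<^sub>R b) = partial_derivs bs g (x + s *\<^sub>R b)"
    by eventually_elim (rule eq)
  then have "((\<lambda>s. partial_derivs bs g (x + s *\<^sub>R b)) has_derivative D) (at 0)"
    by (rule has_derivative_transform_eventually[OF D]) (use eq x in auto)
  then show "(\<lambda>s. partial_derivs bs g (x + s *\<^sub>R b)) differentiable at 0"
    unfolding differentiable_def by blast
qed

lemma smooth_on_Un:
  assumes "open S" "open T" "smooth_on S f" "smooth_on T f"
  shows "smooth_on (S \<union> T) f"
  using assms unfolding smooth_on_def by (auto intro: continuous_on_open_Un)

lemma smooth_on_subset: "smooth_on S f \<Longrightarrow> T \<subseteq> S \<Longrightarrow> smooth_on T f"
  unfolding smooth_on_def by (meson continuous_on_subset subsetD)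

lemma smooth_on_partial_deriv: "smooth_on S f \<Longrightarrow> b \<in> Basis \<Longrightarrow> smooth_on S (partial_deriv b f)"
  unfolding smooth_on_def
  by (intro allI impI) (drule_tac x="bs @ [b]" in spec, simp add: partial_derivs_snoc)

lemma smooth_on_imp_continuous_on: "smooth_on S f \<Longrightarrow> continuous_on S f"
  unfolding smooth_on_def by (drule spec[of _ "[]"]) simp

lemma smooth_on_line_derivative:
  assumes "smooth_on S f" "b \<in> Basis" "y + s *\<^sub>R b \<in> S"
  shows "((\<lambda>s. f (y + s *\<^sub>R b)) has_real_derivative partial_deriv b f (y + s *\<^sub>R b)) (at s)"
proof -
  have "(\<lambda>h. f (y + s *\<^sub>R b + h *\<^sub>R b)) differentiable at 0"
    using assms unfolding smooth_on_def by (auto dest: spec[of _ "[]"])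
  then have "((\<lambda>h. f (y + s *\<^sub>R b + h *\<^sub>R b)) has_real_derivative partial_deriv b f (y + s *\<^sub>R b)) (at 0)"
    unfolding partial_deriv_def
    by (simp add: vector_derivative_works has_real_derivative_iff_has_vector_derivative)
  then have "((\<lambda>h. f (y + (h + s) *\<^sub>R b)) has_real_derivative partial_deriv b f (y + s *\<^sub>R b)) (at 0)"
    by (simp add: algebra_simps)
  then show ?thesis
    using DERIV_shift[of "\<lambda>s. f (y + s *\<^sub>R b)" _ 0 s] by simp
qed

text \<open>
  Continuous partial derivatives give the total derivative: moving from \<open>x\<close> to \<open>x + v\<close> one
  coordinate at a time, each step is controlled by the mean value theorem.
\<close>

lemma smooth_on_has_derivative:
  fixes f :: "'a::euclidean_space \<Rightarrow> real"
  assumes "open U" "smooth_on U f" "x \<in> U"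
  shows "(f has_derivative (\<lambda>v. \<Sum>b\<in>Basis. (v \<bullet> b) * partial_deriv b f x)) (at x)"
  unfolding has_derivative_at_alt
proof (intro conjI allI impI)
  show "bounded_linear (\<lambda>v. \<Sum>b\<in>Basis. (v \<bullet> b) * partial_deriv b f x)"
    by (intro bounded_linear_sum bounded_linear_mult_const bounded_linear_inner_left)
  fix e :: real assume "e > 0"
  define e' where "e' = e / DIM('a)"
  have e': "e' > 0" using \<open>e > 0\<close> by (simp add: e'_def)
  have "\<forall>\<^sub>F y in nhds x. \<bar>partial_deriv b f y - partial_deriv b f x\<bar> \<le> e'" if "b \<in> Basis" for b
  proof -
    have "continuous_on U (partial_deriv b f)"
      using smooth_on_partial_deriv[OF assms(2) that] by (rule smooth_on_imp_continuous_on)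
    then have "isCont (partial_deriv b f) x"
      using assms continuous_on_eq_continuous_at by blast
    then have "(partial_deriv b f \<longlongrightarrow> partial_deriv b f x) (nhds x)"
      by (simp add: isCont_def tendsto_at_iff_tendsto_nhds)
    then have "\<forall>\<^sub>F y in nhds x. dist (partial_deriv b f y) (partial_deriv b f x) < e'"
      using e' by (rule tendstoD)
    then show ?thesis by eventually_elim (auto simp: dist_norm)
  qed
  then have "\<forall>\<^sub>F y in nhds x. \<forall>b\<in>Basis. \<bar>partial_deriv b f y - partial_deriv b f x\<bar> \<le> e'"
    by (intro eventually_ball_finite) auto
  moreover have "\<forall>\<^sub>F y in nhds x. y \<in> U" using assms eventually_nhds by blast
  ultimately have "\<forall>\<^sub>F y in nhds x. y \<in> U \<and> (\<forall>b\<in>Basis. \<bar>partial_deriv b f y - partial_deriv b f x\<bar> \<le> e')"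
    by eventually_elim auto
  then obtain d where d: "d > 0" "\<And>y. dist y x < d \<Longrightarrow> y \<in> U"
    "\<And>y b. dist y x < d \<Longrightarrow> b \<in> Basis \<Longrightarrow> \<bar>partial_deriv b f y - partial_deriv b f x\<bar> \<le> e'"
    unfolding eventually_nhds_metric by auto
  show "\<exists>d>0. \<forall>y. norm (y - x) < d \<longrightarrow>
      norm (f y - f x - (\<Sum>b\<in>Basis. ((y - x) \<bullet> b) * partial_deriv b f x)) \<le> e * norm (y - x)"
  proof (intro exI[of _ "d / DIM('a)"] conjI allI impI)
    show "d / DIM('a) > 0" using d by simp
    fix y assume "norm (y - x) < d / DIM('a)"
    define v where "v = y - x"
    have l1: "(\<Sum>b\<in>Basis. \<bar>v \<bullet> b\<bar>) < d"
    proof -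
      have "(\<Sum>b\<in>Basis. \<bar>v \<bullet> b\<bar>) \<le> (\<Sum>b\<in>(Basis::'a set). norm v)"
        by (intro sum_mono) (simp add: Basis_le_norm)
      also have "\<dots> = DIM('a) * norm v" by simp
      also have "\<dots> < d"
        using \<open>norm (y - x) < d / DIM('a)\<close> by (simp add: v_def field_simps)
      finally show ?thesis .
    qed
    have main: "\<bar>f (x + (\<Sum>b\<in>B. (v \<bullet> b) *\<^sub>R b)) - f x - (\<Sum>b\<in>B. (v \<bullet> b) * partial_deriv b f x)\<bar>
       \<le> card B * (e' * norm v)" if "B \<subseteq> Basis" for B
      using finite_subset[OF that finite_Basis] that
    proof (induction B rule: finite_induct)
      case (insert c B)
      define y0 where "y0 = x + (\<Sum>b\<in>B. (v \<bullet> b) *\<^sub>R b)"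
      define p where "p = v \<bullet> c"
      have c: "c \<in> Basis" using insert by auto
      have near: "dist (y0 + s *\<^sub>R c) x < d" if "s \<in> closed_segment 0 p" for s
      proof -
        have "\<bar>s\<bar> \<le> \<bar>p\<bar>" using that by (auto simp: closed_segment_eq_real_ivl split: if_splits)
        have "dist (y0 + s *\<^sub>R c) x = norm ((\<Sum>b\<in>B. (v \<bullet> b) *\<^sub>R b) + s *\<^sub>R c)"
          by (simp add: y0_def dist_norm algebra_simps)
        also have "\<dots> \<le> (\<Sum>b\<in>B. norm ((v \<bullet> b) *\<^sub>R b)) + \<bar>p\<bar>"
          using c \<open>\<bar>s\<bar> \<le> \<bar>p\<bar>\<close> by (intro order_trans[OF norm_triangle_ineq] add_mono norm_sum) simp
        also have "(\<Sum>b\<in>B. norm ((v \<bullet> b) *\<^sub>R b)) = (\<Sum>b\<in>B. \<bar>v \<bullet> b\<bar>)"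
          using insert by (intro sum.cong) auto
        also have "(\<Sum>b\<in>B. \<bar>v \<bullet> b\<bar>) + \<bar>p\<bar> = (\<Sum>b\<in>insert c B. \<bar>v \<bullet> b\<bar>)"
          using insert by (simp add: p_def)
        also have "\<dots> \<le> (\<Sum>b\<in>Basis. \<bar>v \<bullet> b\<bar>)"
          using insert by (intro sum_mono2) auto
        finally show ?thesis using l1 by simp
      qed
      define \<phi> where "\<phi> s = f (y0 + s *\<^sub>R c) - s * partial_deriv c f x" for s
      have "norm (\<phi> p - \<phi> 0) \<le> e' * norm (p - 0)"
      proof (rule field_differentiable_bound[where S = "closed_segment 0 p"
            and f' = "\<lambda>s. partial_deriv c f (y0 + s *\<^sub>R c) - partial_deriv c f x"])
        fix s assume s: "s \<in> closed_segment 0 p"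
        show "(\<phi> has_field_derivative (partial_deriv c f (y0 + s *\<^sub>R c) - partial_deriv c f x))
            (at s within closed_segment 0 p)"
        proof -
          have "((\<lambda>s. s * partial_deriv c f x) has_real_derivative partial_deriv c f x) (at s)"
            by (auto intro!: derivative_eq_intros)
          from DERIV_diff[OF smooth_on_line_derivative[OF assms(2) c d(2)[OF near[OF s]]] this]
          show ?thesis unfolding \<phi>_def by (rule has_field_derivative_at_within)
        qed
        show "norm (partial_deriv c f (y0 + s *\<^sub>R c) - partial_deriv c f x) \<le> e'"
          using d(3)[OF near[OF s] c] by simp
      qed auto
      also have "\<dots> \<le> e' * norm v"
        using e' c by (intro mult_left_mono) (auto simp: p_def Basis_le_norm)
      finally have "\<bar>f (y0 + p *\<^sub>R c) - f y0 - p * partial_deriv c f x\<bar> \<le> e' * norm v"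
        by (simp add: \<phi>_def algebra_simps)
      moreover have "\<bar>f y0 - f x - (\<Sum>b\<in>B. (v \<bullet> b) * partial_deriv b f x)\<bar> \<le> card B * (e' * norm v)"
        using insert by (simp add: y0_def)
      moreover have "x + (\<Sum>b\<in>insert c B. (v \<bullet> b) *\<^sub>R b) = y0 + p *\<^sub>R c"
        using insert by (simp add: y0_def p_def algebra_simps)
      moreover have "(\<Sum>b\<in>insert c B. (v \<bullet> b) * partial_deriv b f x)
          = p * partial_deriv c f x + (\<Sum>b\<in>B. (v \<bullet> b) * partial_deriv b f x)"
        using insert by (simp add: p_def)
      moreover have "card (insert c B) * (e' * norm v) = e' * norm v + card B * (e' * norm v)"
        using insert by (simp add: algebra_simps)
      ultimately show ?case by (smt (verit))
    qed auto
    have 1: "x + (\<Sum>b\<in>Basis. (v \<bullet> b) *\<^sub>R b) = y"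
      by (simp add: euclidean_representation v_def)
    have "real DIM('a) * e' = e" using DIM_positive[where 'a='a] unfolding e'_def by simp
    then have 2: "real DIM('a) * (e' * norm v) = e * norm v" by (simp only: mult.assoc[symmetric])
    have "norm (f y - f x - (\<Sum>b\<in>Basis. ((y - x) \<bullet> b) * partial_deriv b f x))
        = \<bar>f (x + (\<Sum>b\<in>Basis. (v \<bullet> b) *\<^sub>R b)) - f x - (\<Sum>b\<in>Basis. (v \<bullet> b) * partial_deriv b f x)\<bar>"
      by (subst 1) (simp add: v_def)
    also have "\<dots> \<le> real DIM('a) * (e' * norm v)"
      by (rule main) simp
    also have "\<dots> = e * norm (y - x)"
      by (subst 2) (simp add: v_def)
    finally show "norm (f y - f x - (\<Sum>b\<in>Basis. ((y - x) \<bullet> b) * partial_deriv b f x)) \<le> e * norm (y - x)" .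
  qed
qed

lemma smooth_on_mean_value:
  fixes f :: "'a::euclidean_space \<Rightarrow> real" and B :: real
  assumes "open U" "smooth_on U f" "closed_segment y z \<subseteq> U"
    and B: "\<And>x b. x \<in> closed_segment y z \<Longrightarrow> b \<in> Basis \<Longrightarrow> \<bar>partial_deriv b f x\<bar> \<le> B"
  shows "\<bar>f z - f y\<bar> \<le> DIM('a) * B * norm (z - y)"
proof -
  have "norm (f z - f y) \<le> (DIM('a) * B) * norm (z - y)"
  proof (rule differentiable_bound[of "closed_segment y z"])
    fix x assume x: "x \<in> closed_segment y z"
    show "(f has_derivative (\<lambda>v. \<Sum>b\<in>Basis. (v \<bullet> b) * partial_deriv b f x)) (at x within closed_segment y z)"
      using smooth_on_has_derivative[OF assms(1,2)] assms(3) x has_derivative_at_withinI by blast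
    show "onorm (\<lambda>v. \<Sum>b\<in>Basis. (v \<bullet> b) * partial_deriv b f x) \<le> DIM('a) * B"
    proof (rule onorm_le)
      fix v :: 'a
      have "norm (\<Sum>b\<in>Basis. (v \<bullet> b) * partial_deriv b f x) \<le> (\<Sum>b\<in>(Basis::'a set). norm v * B)"
        using B[OF x] by (intro sum_norm_le) (auto simp: abs_mult Basis_le_norm intro!: mult_mono)
      then show "norm (\<Sum>b\<in>Basis. (v \<bullet> b) * partial_deriv b f x) \<le> DIM('a) * B * norm v"
        by (simp add: algebra_simps)
    qed
  qed auto
  then show ?thesis by simp
qed

lemma smooth_on_chain_rule:
  fixes f :: "'a::euclidean_space \<Rightarrow> real" and g :: "real \<Rightarrow> 'a"
  assumes "open U" "smooth_on U f" "g t \<in> U"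
    and g: "\<And>b. b \<in> Basis \<Longrightarrow> ((\<lambda>t. g t \<bullet> b) has_real_derivative g' b) (at t)"
  shows "((\<lambda>t. f (g t)) has_real_derivative (\<Sum>b\<in>Basis. partial_deriv b f (g t) * g' b)) (at t)"
proof -
  have "(g has_derivative (\<lambda>s. \<Sum>b\<in>Basis. (s * g' b) *\<^sub>R b)) (at t)"
    using g by (subst has_derivative_componentwise_within)
      (auto simp: inner_sum_left inner_Basis has_field_derivative_def mult_commute_abs if_distrib cong: if_cong)
  from has_derivative_compose[OF this smooth_on_has_derivative[OF assms(1-3)]]
  have "((\<lambda>t. f (g t)) has_derivative
     (\<lambda>s. \<Sum>b\<in>Basis. ((\<Sum>b\<in>Basis. (s * g' b) *\<^sub>R b) \<bullet> b) * partial_deriv b f (g t))) (at t)" .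
  also have "(\<lambda>s. \<Sum>b\<in>Basis. ((\<Sum>b\<in>Basis. (s * g' b) *\<^sub>R b) \<bullet> b) * partial_deriv b f (g t))
      = (*) (\<Sum>b\<in>Basis. partial_deriv b f (g t) * g' b)"
    by (simp add: fun_eq_iff inner_sum_left_Basis sum_distrib_left mult_ac)
  finally show ?thesis by (simp add: has_field_derivative_def)
qed

lemma partial_deriv_real: "partial_deriv 1 f = (deriv f :: real \<Rightarrow> real)"
proof
  fix x :: real
  have "((\<lambda>s. f (x + s *\<^sub>R 1)) has_vector_derivative D) (at 0) \<longleftrightarrow> (f has_real_derivative D) (at x)" for D
    using DERIV_shift[of f D 0 x]
    by (simp only: has_real_derivative_iff_has_vector_derivative[symmetric] add_0
        real_scaleR_def mult_1_right add.commute[of x])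
  then show "partial_deriv 1 f x = deriv f x"
    unfolding partial_deriv_def vector_derivative_def deriv_def by simp
qed

section \<open>Moderate nets\<close>

lemma moderate_iff:
  "u \<in> moderate U \<longleftrightarrow> (\<forall>\<epsilon>\<in>{0<..1}. smooth_on U (u \<epsilon>)) \<and>
     (\<forall>K bs. K \<subset>\<subset> U \<longrightarrow> set bs \<subseteq> Basis \<longrightarrow> moderate_on K (\<lambda>\<epsilon>. partial_derivs bs (u \<epsilon>)))"
  by (simp add: moderate_def moderate_on_iff_sup_bigo)

lemma negligible_nets_iff:
  "u \<in> negligible_nets U \<longleftrightarrow> (\<forall>\<epsilon>\<in>{0<..1}. smooth_on U (u \<epsilon>)) \<and>
     (\<forall>K bs. K \<subset>\<subset> U \<longrightarrow> set bs \<subseteq> Basis \<longrightarrow> negligible_on K (\<lambda>\<epsilon>. partial_derivs bs (u \<epsilon>)))"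
  by (simp add: negligible_nets_def negligible_on_iff_sup_bigo)

lemma moderate_partial_deriv:
  "u \<in> moderate U \<Longrightarrow> b \<in> Basis \<Longrightarrow> (\<lambda>\<epsilon>. partial_deriv b (u \<epsilon>)) \<in> moderate U"
  unfolding moderate_iff
proof (intro conjI ballI allI impI; elim conjE)
  fix K and bs :: "'a list"
  assume "b \<in> Basis" "\<forall>K bs. K \<subset>\<subset> U \<longrightarrow> set bs \<subseteq> Basis \<longrightarrow> moderate_on K (\<lambda>\<epsilon>. partial_derivs bs (u \<epsilon>))"
    "K \<subset>\<subset> U" "set bs \<subseteq> Basis"
  then have "moderate_on K (\<lambda>\<epsilon>. partial_derivs (bs @ [b]) (u \<epsilon>))" by simp
  then show "moderate_on K (\<lambda>\<epsilon>. partial_derivs bs (partial_deriv b (u \<epsilon>)))"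
    by (simp add: partial_derivs_snoc)
qed (auto intro: smooth_on_partial_deriv)

lemma moderate_imp_moderate_on:
  assumes "u \<in> moderate U" "K \<subset>\<subset> U"
  shows "moderate_on K u"
proof -
  have "set [] \<subseteq> Basis" by simp
  then have "moderate_on K (\<lambda>\<epsilon>. partial_derivs [] (u \<epsilon>))"
    using assms unfolding moderate_iff by blast
  then show ?thesis by simp
qed

lemma moderate_imp_smooth_on: "u \<in> moderate U \<Longrightarrow> \<epsilon> \<in> {0<..1} \<Longrightarrow> smooth_on U (u \<epsilon>)"
  by (auto simp: moderate_iff)

text \<open>
  Smooth functions are the constant moderate nets; closure properties of smooth functions are
  in this way special cases of closure properties of moderate nets.
\<close>

lemma constant_net_moderate_iff: "(\<lambda>_. f) \<in> moderate U \<longleftrightarrow> smooth_on U f"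
proof
  assume "smooth_on U f"
  have "moderate_on K (\<lambda>_. partial_derivs bs f)" if K: "K \<subset>\<subset> U" "set bs \<subseteq> Basis" for K bs
  proof -
    have "continuous_on K (partial_derivs bs f)"
      using \<open>smooth_on U f\<close> K interior_subset unfolding smooth_on_def compactly_inside_def
      by (meson continuous_on_subset order_trans)
    then have "bounded (partial_derivs bs f ` K)"
      using K by (auto simp: compactly_inside_def intro: compact_imp_bounded compact_continuous_image)
    then obtain C where "\<forall>x\<in>K. norm (partial_derivs bs f x) \<le> C"
      unfolding bounded_iff by blast
    then show ?thesis by (intro moderate_on_bounded) auto
  qed
  with \<open>smooth_on U f\<close> show "(\<lambda>_. f) \<in> moderate U" by (simp add: moderate_iff)
next
  assume "(\<lambda>_. f) \<in> moderate U"
  then show "smooth_on U f" using moderate_imp_smooth_on[of "\<lambda>_. f" U 1] by simp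
qed

section \<open>Moderate nets on open subsets of the line\<close>

text \<open>
  Moderateness of the derivatives up to order \<open>k\<close>, with the derivative given by any net that serves as
  one. Closure under products, compositions and solving differential equations follows by induction on
  \<open>k\<close> from the formula for the first derivative, without formulas for higher derivatives.
\<close>

primrec moderate_upto :: "nat \<Rightarrow> real set \<Rightarrow> (real \<Rightarrow> real \<Rightarrow> real) \<Rightarrow> bool" where
  "moderate_upto 0 J f \<longleftrightarrow>
     (\<forall>\<epsilon>\<in>{0<..1}. continuous_on J (f \<epsilon>)) \<and> (\<forall>K. K \<subset>\<subset> J \<longrightarrow> moderate_on K f)"
| "moderate_upto (Suc k) J f \<longleftrightarrow>
     (\<forall>K. K \<subset>\<subset> J \<longrightarrow> moderate_on K f) \<and>
     (\<exists>f'. (\<forall>\<epsilon>\<in>{0<..1}. \<forall>t\<in>J. (f \<epsilon> has_real_derivative f' \<epsilon> t) (at t)) \<and> moderate_upto k J f')"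

declare moderate_upto.simps(2) [simp del]

lemma moderate_upto_SucI:
  assumes "\<And>K. K \<subset>\<subset> J \<Longrightarrow> moderate_on K f"
    and "\<And>\<epsilon> t. \<epsilon> \<in> {0<..1} \<Longrightarrow> t \<in> J \<Longrightarrow> (f \<epsilon> has_real_derivative f' \<epsilon> t) (at t)"
    and "moderate_upto k J f'"
  shows "moderate_upto (Suc k) J f"
  unfolding moderate_upto.simps(2) using assms by blast

lemma moderate_upto_SucE:
  assumes "moderate_upto (Suc k) J f"
  obtains f' where
    "\<And>\<epsilon> t. \<epsilon> \<in> {0<..1} \<Longrightarrow> t \<in> J \<Longrightarrow> (f \<epsilon> has_real_derivative f' \<epsilon> t) (at t)"
    "moderate_upto k J f'"
  using assms unfolding moderate_upto.simps(2) by blast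

lemma moderate_upto_imp_moderate_on: "moderate_upto k J f \<Longrightarrow> K \<subset>\<subset> J \<Longrightarrow> moderate_on K f"
  by (cases k) (auto simp: moderate_upto.simps(2))

lemma moderate_upto_imp_continuous_on:
  assumes "moderate_upto k J f" "\<epsilon> \<in> {0<..1}"
  shows "continuous_on J (f \<epsilon>)"
proof (cases k)
  case (Suc k')
  then obtain f' where "\<And>t. t \<in> J \<Longrightarrow> (f \<epsilon> has_real_derivative f' t) (at t)"
    using assms by (metis moderate_upto_SucE)
  then show ?thesis by (rule DERIV_continuous_on[OF has_field_derivative_at_within])
qed (use assms in simp)

lemma moderate_upto_SucD: "moderate_upto (Suc k) J f \<Longrightarrow> moderate_upto k J f"
proof (induction k arbitrary: f)
  case 0
  then show ?case
    using moderate_upto_imp_continuous_on[OF 0] moderate_upto_imp_moderate_on[OF 0] by simp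
next
  case (Suc k)
  obtain f' where f': "\<And>\<epsilon> t. \<epsilon> \<in> {0<..1} \<Longrightarrow> t \<in> J \<Longrightarrow> (f \<epsilon> has_real_derivative f' \<epsilon> t) (at t)"
    "moderate_upto (Suc k) J f'"
    using Suc.prems by (rule moderate_upto_SucE) blast
  show ?case
    using moderate_upto_SucI[OF moderate_upto_imp_moderate_on[OF Suc.prems] f'(1) Suc.IH[OF f'(2)]] .
qed

lemma moderate_upto_const:
  assumes "moderate_on UNIV (\<lambda>\<epsilon> t. c \<epsilon> :: real)"
  shows "moderate_upto k J (\<lambda>\<epsilon> t. c \<epsilon>)"
proof -
  have bound: "moderate_on K (\<lambda>\<epsilon> t. c \<epsilon>)" for K :: "real set"
    using assms by (simp add: moderate_on_def)
  have zero: "moderate_upto k J (\<lambda>\<epsilon> t. 0)" for k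
    by (induction k) (auto intro!: moderate_upto_SucI[where f' = "\<lambda>\<epsilon> t. 0"] moderate_on_bounded[of _ _ 0])
  show ?thesis
    using bound zero by (cases k) (auto intro!: moderate_upto_SucI[where f' = "\<lambda>\<epsilon> t. 0"])
qed

lemma moderate_upto_real: "moderate_upto k J (\<lambda>\<epsilon> t. c)"
  by (rule moderate_upto_const, rule moderate_on_bounded[of _ _ "norm c"]) simp

lemma moderate_upto_ident: "moderate_upto k J (\<lambda>\<epsilon> t. t)"
proof -
  have "moderate_on K (\<lambda>\<epsilon> t. t)" if K: "K \<subset>\<subset> J" for K
  proof -
    obtain C where "\<forall>t\<in>K. norm t \<le> C"
      using K compact_imp_bounded[of K] by (auto simp: compactly_inside_def bounded_iff)
    then show ?thesis by (intro moderate_on_bounded[of _ _ C]) auto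
  qed
  then show ?thesis
    using moderate_upto_real[of _ J 1] by (cases k) (auto intro!: moderate_upto_SucI[where f' = "\<lambda>\<epsilon> t. 1"])
qed

lemma moderate_upto_add:
  "moderate_upto k J f \<Longrightarrow> moderate_upto k J g \<Longrightarrow> moderate_upto k J (\<lambda>\<epsilon> t. f \<epsilon> t + g \<epsilon> t)"
proof (induction k arbitrary: f g)
  case (Suc k)
  obtain f' g' where
    "\<And>\<epsilon> t. \<epsilon> \<in> {0<..1} \<Longrightarrow> t \<in> J \<Longrightarrow> (f \<epsilon> has_real_derivative f' \<epsilon> t) (at t)" "moderate_upto k J f'"
    "\<And>\<epsilon> t. \<epsilon> \<in> {0<..1} \<Longrightarrow> t \<in> J \<Longrightarrow> (g \<epsilon> has_real_derivative g' \<epsilon> t) (at t)" "moderate_upto k J g'"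
    using Suc.prems by (elim moderate_upto_SucE) metis
  then show ?case
    using Suc.prems moderate_upto_imp_moderate_on
    by (intro moderate_upto_SucI[where f' = "\<lambda>\<epsilon> t. f' \<epsilon> t + g' \<epsilon> t"] Suc.IH DERIV_add moderate_on_add) blast+
qed (auto intro: continuous_on_add moderate_on_add)

lemma moderate_upto_mult:
  "moderate_upto k J f \<Longrightarrow> moderate_upto k J g \<Longrightarrow> moderate_upto k J (\<lambda>\<epsilon> t. f \<epsilon> t * g \<epsilon> t)"
proof (induction k arbitrary: f g)
  case (Suc k)
  obtain f' g' where *:
    "\<And>\<epsilon> t. \<epsilon> \<in> {0<..1} \<Longrightarrow> t \<in> J \<Longrightarrow> (f \<epsilon> has_real_derivative f' \<epsilon> t) (at t)" "moderate_upto k J f'"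
    "\<And>\<epsilon> t. \<epsilon> \<in> {0<..1} \<Longrightarrow> t \<in> J \<Longrightarrow> (g \<epsilon> has_real_derivative g' \<epsilon> t) (at t)" "moderate_upto k J g'"
    using Suc.prems by (elim moderate_upto_SucE) metis
  have "moderate_upto k J (\<lambda>\<epsilon> t. f' \<epsilon> t * g \<epsilon> t + g' \<epsilon> t * f \<epsilon> t)"
    using * Suc.prems by (intro moderate_upto_add Suc.IH) (auto dest: moderate_upto_SucD)
  moreover have "((\<lambda>t. f \<epsilon> t * g \<epsilon> t) has_real_derivative f' \<epsilon> t * g \<epsilon> t + g' \<epsilon> t * f \<epsilon> t) (at t)"
    if "\<epsilon> \<in> {0<..1}" "t \<in> J" for \<epsilon> t
    using DERIV_mult[OF *(1,3)[OF that]] .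
  moreover have "moderate_on K (\<lambda>\<epsilon> t. f \<epsilon> t * g \<epsilon> t)" if "K \<subset>\<subset> J" for K
    using Suc.prems that by (auto intro: moderate_on_mult moderate_upto_imp_moderate_on)
  ultimately show ?case by (intro moderate_upto_SucI)
qed (auto intro: continuous_on_mult moderate_on_mult)

lemma moderate_upto_diff:
  "moderate_upto k J f \<Longrightarrow> moderate_upto k J g \<Longrightarrow> moderate_upto k J (\<lambda>\<epsilon> t. f \<epsilon> t - g \<epsilon> t)"
  using moderate_upto_add[OF _ moderate_upto_mult[OF moderate_upto_real[of k J "-1"], of g], of f] by simp

lemma moderate_upto_sum:
  "(\<And>i. i \<in> A \<Longrightarrow> moderate_upto k J (f i)) \<Longrightarrow> moderate_upto k J (\<lambda>\<epsilon> t. \<Sum>i\<in>A. f i \<epsilon> t)"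
  by (induction A rule: infinite_finite_induct) (auto intro!: moderate_upto_add moderate_upto_real)

lemma has_real_derivative_imp_differentiable_line:
  fixes f :: "real \<Rightarrow> real"
  assumes "(f has_real_derivative D) (at t)"
  shows "(\<lambda>s. f (t + s *\<^sub>R 1)) differentiable at 0"
proof -
  have "((\<lambda>s. f (s + t)) has_real_derivative D) (at 0)"
    using DERIV_shift[of f D 0 t] assms by simp
  then have "((\<lambda>s. f (t + s *\<^sub>R 1)) has_real_derivative D) (at 0)"
    by (simp add: add.commute)
  then show ?thesis
    by (auto simp: has_field_derivative_def differentiable_def)
qed

text \<open>
  The list of directions is taken apart at its end, that is, at the innermost derivative, because this is
  the one that \<open>moderate_upto\<close> provides.
\<close>

lemma moderate_upto_derivatives:
  assumes "open J" "moderate_upto (Suc k) J f" "length bs \<le> k" "set bs \<subseteq> {1}"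
  shows "moderate_upto 1 J (\<lambda>\<epsilon>. partial_derivs bs (f \<epsilon>))"
  using assms(2-)
proof (induction bs arbitrary: k f rule: rev_induct)
  case Nil
  have "moderate_upto 1 J f" if "moderate_upto (Suc k) J f" for k
    using that by (induction k) (auto dest: moderate_upto_SucD)
  then show ?case using Nil by simp
next
  case (snoc b bs)
  obtain k' where k: "k = Suc k'" using snoc.prems(2) by (cases k) auto
  obtain f' where f': "\<And>\<epsilon> t. \<epsilon> \<in> {0<..1} \<Longrightarrow> t \<in> J \<Longrightarrow> (f \<epsilon> has_real_derivative f' \<epsilon> t) (at t)"
    "moderate_upto (Suc k') J f'"
    using snoc.prems(1) unfolding k by (rule moderate_upto_SucE) blast
  have eq: "partial_derivs (bs @ [b]) (f \<epsilon>) t = partial_derivs bs (f' \<epsilon>) t"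
    if "\<epsilon> \<in> {0<..1}" "t \<in> J" for \<epsilon> t
    unfolding partial_derivs_snoc
  proof (rule partial_derivs_cong_open[OF assms(1) _ that(2)])
    fix s assume "s \<in> J"
    then show "partial_deriv b (f \<epsilon>) s = f' \<epsilon> s"
      using f' that snoc.prems(3) by (auto simp: partial_deriv_real intro!: DERIV_imp_deriv)
  qed
  have "moderate_upto 1 J (\<lambda>\<epsilon>. partial_derivs bs (f' \<epsilon>))"
    using snoc f'(2) k by auto
  then obtain h where h: "\<forall>\<epsilon>\<in>{0<..1}. \<forall>t\<in>J. (partial_derivs bs (f' \<epsilon>) has_real_derivative h \<epsilon> t) (at t)"
    "moderate_upto 0 J h" and b: "\<forall>K. K \<subset>\<subset> J \<longrightarrow> moderate_on K (\<lambda>\<epsilon>. partial_derivs bs (f' \<epsilon>))"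
    unfolding One_nat_def moderate_upto.simps(2) by blast
  have "(partial_derivs (bs @ [b]) (f \<epsilon>) has_real_derivative h \<epsilon> t) (at t)" if "\<epsilon> \<in> {0<..1}" "t \<in> J" for \<epsilon> t
    using h(1) eq that
    by (auto intro: has_field_derivative_transform_within_open[OF _ assms(1), of "partial_derivs bs (f' \<epsilon>)"])
  moreover have "moderate_on K (\<lambda>\<epsilon>. partial_derivs (bs @ [b]) (f \<epsilon>))" if K: "K \<subset>\<subset> J" for K
  proof -
    have "K \<subseteq> J" using K assms(1) by (simp add: compactly_inside_open)
    have "\<forall>\<^sub>F \<epsilon> in at_right 0. \<forall>t\<in>K. partial_derivs (bs @ [b]) (f \<epsilon>) t = partial_derivs bs (f' \<epsilon>) t"
      using eventually_index by eventually_elim (use eq \<open>K \<subseteq> J\<close> in auto)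
    from moderate_on_cong[OF this] show ?thesis using b K by blast
  qed
  ultimately show ?case unfolding One_nat_def using h(2) by (intro moderate_upto_SucI)
qed

lemma moderate_iff_moderate_upto:
  assumes "open J"
  shows "f \<in> moderate J \<longleftrightarrow> (\<forall>k. moderate_upto k J f)"
proof
  assume "f \<in> moderate J"
  have "moderate_upto k J f" if "f \<in> moderate J" for k
    using that
  proof (induction k arbitrary: f)
    case 0
    then show ?case
      by (auto intro: moderate_imp_moderate_on smooth_on_imp_continuous_on moderate_imp_smooth_on)
  next
    case (Suc k)
    have "(f \<epsilon> has_real_derivative partial_deriv 1 (f \<epsilon>) t) (at t)" if "\<epsilon> \<in> {0<..1}" "t \<in> J" for \<epsilon> t
      using smooth_on_line_derivative[OF moderate_imp_smooth_on[OF Suc.prems that(1)], of 1 0 t] that by simp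
    then show ?case
      using Suc.IH[OF moderate_partial_deriv[OF Suc.prems, of 1]] moderate_imp_moderate_on[OF Suc.prems]
      by (intro moderate_upto_SucI) auto
  qed
  then show "\<forall>k. moderate_upto k J f" using \<open>f \<in> moderate J\<close> by blast
next
  assume all: "\<forall>k. moderate_upto k J f"
  have upto: "moderate_upto 1 J (\<lambda>\<epsilon>. partial_derivs bs (f \<epsilon>))" if "set bs \<subseteq> Basis" for bs
    using moderate_upto_derivatives[OF assms all[rule_format, of "Suc (length bs)"] order_refl] that by simp
  then have "moderate_on K (\<lambda>\<epsilon>. partial_derivs bs (f \<epsilon>))" if "set bs \<subseteq> Basis" "K \<subset>\<subset> J" for K bs
    using that moderate_upto_imp_moderate_on by blast
  moreover have "smooth_on J (f \<epsilon>)" if "\<epsilon> \<in> {0<..1}" for \<epsilon>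
    unfolding smooth_on_def
  proof (intro allI impI conjI ballI)
    fix bs :: "real list" assume bs: "set bs \<subseteq> Basis"
    show "continuous_on J (partial_derivs bs (f \<epsilon>))"
      using moderate_upto_imp_continuous_on[OF upto[OF bs] that] .
    fix t b :: real assume "t \<in> J" "b \<in> Basis"
    obtain h where "\<forall>\<epsilon>\<in>{0<..1}. \<forall>t\<in>J. (partial_derivs bs (f \<epsilon>) has_real_derivative h \<epsilon> t) (at t)"
      using upto[OF bs] unfolding One_nat_def moderate_upto.simps(2) by blast
    then show "(\<lambda>s. partial_derivs bs (f \<epsilon>) (t + s *\<^sub>R b)) differentiable at 0"
      using \<open>t \<in> J\<close> \<open>b \<in> Basis\<close> that has_real_derivative_imp_differentiable_line[of "partial_derivs bs (f \<epsilon>)" "h \<epsilon> t" t] by simp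
  qed
  ultimately show "f \<in> moderate J" by (auto simp: moderate_iff)
qed

lemma smooth_on_line_iff:
  assumes "open J"
  shows "smooth_on J f \<longleftrightarrow> (\<forall>k. moderate_upto k J (\<lambda>_. f))"
  using moderate_iff_moderate_upto[OF assms, of "\<lambda>_. f"] constant_net_moderate_iff[of f J] by simp

text \<open>
  The derivative of \<open>v \<circ> g\<close> is \<open>\<Sum>\<^sub>b (\<partial>\<^sub>b v \<circ> g) g\<^sub>b'\<close>, a sum of products of nets to which the
  same argument applies with one derivative less, as \<open>\<partial>\<^sub>b v\<close> is moderate again.
\<close>

lemma moderate_upto_comp_net:
  fixes g :: "real \<Rightarrow> real \<Rightarrow> 'b::euclidean_space"
  assumes "open J" "open V" "v \<in> moderate V"
    and "\<And>b. b \<in> Basis \<Longrightarrow> moderate_upto k J (\<lambda>\<epsilon> t. g \<epsilon> t \<bullet> b)"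
    and cb: "\<And>K. K \<subset>\<subset> J \<Longrightarrow> \<exists>L. L \<subset>\<subset> V \<and> (\<forall>\<^sub>F \<epsilon> in at_right 0. g \<epsilon> ` K \<subseteq> L)"
  shows "moderate_upto k J (comp_net J V v g)"
  using assms(3,4)
proof (induction k arbitrary: v)
  have bound: "moderate_on K (comp_net J V v g)" if K: "K \<subset>\<subset> J" and v: "v \<in> moderate V" for K v
  proof -
    obtain L where L: "L \<subset>\<subset> V" "\<forall>\<^sub>F \<epsilon> in at_right 0. g \<epsilon> ` K \<subseteq> L" using cb[OF K] by blast
    obtain N where "\<forall>\<^sub>F \<epsilon> in at_right 0. \<forall>x\<in>L. norm (v \<epsilon> x) \<le> inverse (\<epsilon> ^ N)"
      using moderate_imp_moderate_on[OF v L(1)] unfolding moderate_on_def by blast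
    then have "\<forall>\<^sub>F \<epsilon> in at_right 0. \<forall>x\<in>K. norm (comp_net J V v g \<epsilon> x) \<le> inverse (\<epsilon> ^ N)"
      using L(2) eventually_index
      by eventually_elim (auto simp: comp_net_def)
    then show ?thesis unfolding moderate_on_def by blast
  qed
  {
    case 0
    have "continuous_on J (comp_net J V v g \<epsilon>)" if "\<epsilon> \<in> {0<..1}" for \<epsilon>
    proof (cases "g \<epsilon> ` J \<subseteq> V")
      case True
      have "continuous_on J (\<lambda>t. g \<epsilon> t \<bullet> b)" if "b \<in> Basis" for b
        using moderate_upto_imp_continuous_on[OF 0(2)[OF that] \<open>\<epsilon> \<in> {0<..1}\<close>] .
      then have "continuous_on J (g \<epsilon>)"
        by (subst continuous_on_componentwise) auto
      moreover have "continuous_on V (v \<epsilon>)"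
        using smooth_on_imp_continuous_on[OF moderate_imp_smooth_on[OF 0(1) that]] .
      ultimately have "continuous_on J (\<lambda>t. v \<epsilon> (g \<epsilon> t))"
        using True by (auto intro: continuous_on_compose2)
      then show ?thesis using True by (simp add: comp_net_def)
    qed (simp add: comp_net_def)
    then show ?case using bound[OF _ 0(1)] by simp
  next
    case (Suc k)
    have "\<forall>b\<in>Basis. \<exists>g'. (\<forall>\<epsilon>\<in>{0<..1}. \<forall>t\<in>J. ((\<lambda>t. g \<epsilon> t \<bullet> b) has_real_derivative g' \<epsilon> t) (at t))
        \<and> moderate_upto k J g'"
      using Suc.prems(2) unfolding moderate_upto.simps(2) by blast
    then obtain g' where g': "\<And>b \<epsilon> t. b \<in> Basis \<Longrightarrow> \<epsilon> \<in> {0<..1} \<Longrightarrow> t \<in> J \<Longrightarrow>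
        ((\<lambda>t. g \<epsilon> t \<bullet> b) has_real_derivative g' b \<epsilon> t) (at t)"
      "\<And>b. b \<in> Basis \<Longrightarrow> moderate_upto k J (g' b)"
      by metis
    define h where "h \<epsilon> t = (\<Sum>b\<in>Basis. comp_net J V (\<lambda>\<epsilon>. partial_deriv b (v \<epsilon>)) g \<epsilon> t * g' b \<epsilon> t)"
      for \<epsilon> t
    have "moderate_upto k J h"
      unfolding h_def
      using moderate_partial_deriv[OF Suc.prems(1)] moderate_upto_SucD[OF Suc.prems(2)] g'(2)
      by (intro moderate_upto_sum moderate_upto_mult Suc.IH) auto
    moreover have "(comp_net J V v g \<epsilon> has_real_derivative h \<epsilon> t) (at t)"
      if "\<epsilon> \<in> {0<..1}" "t \<in> J" for \<epsilon> t
    proof (cases "g \<epsilon> ` J \<subseteq> V")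
      case True
      have "((\<lambda>t. v \<epsilon> (g \<epsilon> t)) has_real_derivative (\<Sum>b\<in>Basis. partial_deriv b (v \<epsilon>) (g \<epsilon> t) * g' b \<epsilon> t)) (at t)"
        using True that by (intro smooth_on_chain_rule[OF assms(2) moderate_imp_smooth_on[OF Suc.prems(1)]] g') auto
      then show ?thesis using True by (simp add: comp_net_def h_def)
    qed (simp add: comp_net_def h_def)
    ultimately show ?case using bound[OF _ Suc.prems(1)] by (intro moderate_upto_SucI)
  }
qed

lemma moderate_diff:
  assumes "open J" "f \<in> moderate J" "g \<in> moderate J"
  shows "(\<lambda>\<epsilon> t. f \<epsilon> t - g \<epsilon> t :: real) \<in> moderate (J :: real set)"
  using assms by (simp add: moderate_iff_moderate_upto moderate_upto_diff)

text \<open>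
  Smallness on slightly larger compact sets and a moderate second derivative make the first derivative
  small. If the second derivative is at most \<open>inverse (\<epsilon> ^ N)\<close>, the difference quotient with step
  \<open>\<epsilon> ^ (m + N + 1)\<close> approximates the derivative up to \<open>\<epsilon> ^ (m + 1)\<close>, and its numerator is as small as needed.
\<close>

lemma negligible_derivative:
  fixes J :: "real set"
  assumes "open J" "f \<in> moderate J" "\<And>K. K \<subset>\<subset> J \<Longrightarrow> negligible_on K f" "K \<subset>\<subset> J"
  shows "negligible_on K (\<lambda>\<epsilon>. partial_deriv 1 (f \<epsilon>))"
proof (rule negligible_onI)
  fix m
  obtain r K' where r: "r > 0" and K': "K' \<subset>\<subset> J" "\<And>x. x \<in> K \<Longrightarrow> cball x r \<subseteq> K'"
    using compactly_inside_enlarge[OF assms(4)] by metis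
  have f': "(\<lambda>\<epsilon>. partial_deriv 1 (f \<epsilon>)) \<in> moderate J"
    using moderate_partial_deriv[OF assms(2), of 1] by simp
  have f'': "(\<lambda>\<epsilon>. partial_deriv 1 (partial_deriv 1 (f \<epsilon>))) \<in> moderate J"
    using moderate_partial_deriv[OF f', of 1] by simp
  obtain N where N: "\<forall>\<^sub>F \<epsilon> in at_right 0. \<forall>x\<in>K'. norm (partial_deriv 1 (partial_deriv 1 (f \<epsilon>)) x) \<le> inverse (\<epsilon> ^ N)"
    using moderate_imp_moderate_on[OF f'' K'(1)] unfolding moderate_on_def by blast
  have F: "\<forall>\<^sub>F \<epsilon> in at_right 0. \<forall>x\<in>K'. norm (f \<epsilon> x) \<le> \<epsilon> ^ (m + (Suc m + N))"
    using assms(3)[OF K'(1)] unfolding negligible_on_def by blast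
  have "\<forall>\<^sub>F \<epsilon> in at_right 0. \<forall>x\<in>K. norm (partial_deriv 1 (f \<epsilon>) x) \<le> 3 * \<epsilon> ^ m"
    using N F eventually_index eventually_index_less[OF r]
  proof eventually_elim
    case (elim \<epsilon>)
    then have \<epsilon>: "\<epsilon> \<in> {0<..1}" by auto
    show ?case
    proof
      fix x assume "x \<in> K"
      define s where "s = \<epsilon> ^ (Suc m + N)"
      have "s \<le> \<epsilon> ^ 1" unfolding s_def using elim by (intro power_decreasing) auto
      moreover have "s > 0" using elim by (simp add: s_def)
      ultimately have s: "s > 0" "s \<le> \<epsilon>" "s \<le> r" using elim by auto
      have sub: "{x..x + s} \<subseteq> K'"
        using K'(2)[OF \<open>x \<in> K\<close>] s by (auto simp: subset_iff dist_real_def)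
      then have subJ: "{x..x + s} \<subseteq> J" using K'(1) assms(1) by (auto simp: compactly_inside_open)
      have d: "(f \<epsilon> has_real_derivative partial_deriv 1 (f \<epsilon>) y) (at y)" if "y \<in> J" for y
        using smooth_on_line_derivative[OF moderate_imp_smooth_on[OF assms(2) \<epsilon>], of 1 0 y] that by simp
      have d2: "(partial_deriv 1 (f \<epsilon>) has_real_derivative partial_deriv 1 (partial_deriv 1 (f \<epsilon>)) y) (at y)" if "y \<in> J" for y
        using smooth_on_line_derivative[OF moderate_imp_smooth_on[OF f' \<epsilon>], of 1 0 y] that by simp
      obtain z where z: "x < z" "z < x + s" "f \<epsilon> (x + s) - f \<epsilon> x = (x + s - x) * partial_deriv 1 (f \<epsilon>) z"
        using MVT2[of x "x + s" "f \<epsilon>" "partial_deriv 1 (f \<epsilon>)"] s d subJ by (auto simp: subset_iff)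
      obtain w where w: "x < w" "w < z"
        "partial_deriv 1 (f \<epsilon>) z - partial_deriv 1 (f \<epsilon>) x = (z - x) * partial_deriv 1 (partial_deriv 1 (f \<epsilon>)) w"
        using MVT2[of x z "partial_deriv 1 (f \<epsilon>)" "partial_deriv 1 (partial_deriv 1 (f \<epsilon>))"] z d2 subJ
        by (auto simp: subset_iff)
      have inK': "x \<in> K'" "x + s \<in> K'" "w \<in> K'"
        using s z w by (auto intro!: subsetD[OF sub])
      have "s * \<bar>partial_deriv 1 (f \<epsilon>) z\<bar> = \<bar>f \<epsilon> (x + s) - f \<epsilon> x\<bar>"
        using z(3) s by (simp add: abs_mult)
      also have "\<dots> \<le> \<bar>f \<epsilon> (x + s)\<bar> + \<bar>f \<epsilon> x\<bar>" by simp
      also have "\<dots> \<le> \<epsilon> ^ (m + (Suc m + N)) + \<epsilon> ^ (m + (Suc m + N))"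
        using elim(2) inK' unfolding real_norm_def by (intro add_mono) blast+
      also have "\<dots> = s * (2 * \<epsilon> ^ m)" by (simp add: s_def power_add)
      finally have 1: "\<bar>partial_deriv 1 (f \<epsilon>) z\<bar> \<le> 2 * \<epsilon> ^ m"
        using s by (metis mult_le_cancel_left_pos)
      have "\<bar>(z - x) * partial_deriv 1 (partial_deriv 1 (f \<epsilon>)) w\<bar> \<le> s * inverse (\<epsilon> ^ N)"
        unfolding abs_mult
        using z w s elim(1) inK' by (intro mult_mono) auto
      also have "\<dots> = \<epsilon> ^ Suc m" using elim by (simp add: s_def power_add field_simps)
      also have "\<dots> \<le> \<epsilon> ^ m" using \<epsilon> by (simp add: mult_left_le_one_le)
      finally show "norm (partial_deriv 1 (f \<epsilon>) x) \<le> 3 * \<epsilon> ^ m"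
        using 1 w(3) by (auto simp: abs_if split: if_splits)
    qed
  qed
  then show "\<exists>C. \<forall>\<^sub>F \<epsilon> in at_right 0. \<forall>x\<in>K. norm (partial_deriv 1 (f \<epsilon>) x) \<le> C * \<epsilon> ^ m" ..
qed

lemma negligible_netsI:
  fixes J :: "real set"
  assumes "open J" "f \<in> moderate J" "\<And>K. K \<subset>\<subset> J \<Longrightarrow> negligible_on K f"
  shows "f \<in> negligible_nets J"
proof -
  have "negligible_on K (\<lambda>\<epsilon>. partial_derivs bs (f \<epsilon>))" if "set bs \<subseteq> {1}" "K \<subset>\<subset> J" for K bs
    using assms(2,3) that
  proof (induction bs arbitrary: K f rule: rev_induct)
    case (snoc b bs)
    have "b = 1" "set bs \<subseteq> {1}" using snoc.prems by auto
    then show ?case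
      unfolding partial_derivs_snoc
      using negligible_derivative[OF assms(1) snoc.prems(1,2)] moderate_partial_deriv[OF snoc.prems(1), of 1] snoc.prems(4)
      by (intro snoc.IH) auto
  qed simp
  then show ?thesis
    using assms(2) by (auto simp: negligible_nets_iff moderate_iff)
qed

section \<open>Equality and composition of generalized functions\<close>

lemma ex_index_iff_eventually:
  "(\<exists>\<epsilon>\<^sub>0\<in>{0<..1}. \<forall>\<epsilon>\<in>{0<..\<epsilon>\<^sub>0}. P \<epsilon>) \<longleftrightarrow> (\<forall>\<^sub>F \<epsilon> in at_right (0::real). P \<epsilon>)"
proof
  assume "\<exists>\<epsilon>\<^sub>0\<in>{0<..1}. \<forall>\<epsilon>\<in>{0<..\<epsilon>\<^sub>0}. P \<epsilon>"
  then obtain e where "e > 0" "\<forall>\<epsilon>\<in>{0<..e}. P \<epsilon>" by auto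
  then show "\<forall>\<^sub>F \<epsilon> in at_right (0::real). P \<epsilon>"
    using eventually_index_less[of e] by (auto elim: eventually_mono)
next
  assume "\<forall>\<^sub>F \<epsilon> in at_right (0::real). P \<epsilon>"
  then obtain b where b: "b > 0" "\<And>y. 0 < y \<Longrightarrow> y < b \<Longrightarrow> P y"
    unfolding eventually_at_right_field by auto
  then have "min 1 (b / 2) \<in> {0<..1}" "\<forall>\<epsilon>\<in>{0<..min 1 (b / 2)}. P \<epsilon>" by auto
  then show "\<exists>\<epsilon>\<^sub>0\<in>{0<..1}. \<forall>\<epsilon>\<in>{0<..\<epsilon>\<^sub>0}. P \<epsilon>" by blast
qed

lemma c_bounded_iff:
  "c_bounded U V u \<longleftrightarrow> u \<in> moderate_vec U \<and> (\<forall>\<^sub>F \<epsilon> in at_right 0. u \<epsilon> ` U \<subseteq> V) \<and>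
     (\<forall>K. K \<subset>\<subset> U \<longrightarrow> (\<exists>L. L \<subset>\<subset> V \<and> (\<forall>\<^sub>F \<epsilon> in at_right 0. u \<epsilon> ` K \<subseteq> L)))"
  unfolding c_bounded_def ex_index_iff_eventually ..

lemma c_bounded_moderate_vec: "c_bounded U V u \<Longrightarrow> u \<in> moderate_vec U"
  by (simp add: c_bounded_iff)

lemma moderate_vecD: "u \<in> moderate_vec U \<Longrightarrow> j \<in> Basis \<Longrightarrow> (\<lambda>\<epsilon> x. u \<epsilon> x \<bullet> j) \<in> moderate U"
  by (simp add: moderate_vec_def)

lemma gf_rel_imp_negligible_on:
  assumes "(u, v) \<in> gf_rel U" "K \<subset>\<subset> U"
  shows "negligible_on K (\<lambda>\<epsilon> x. u \<epsilon> x - v \<epsilon> x)"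
proof -
  have "negligible_on K (\<lambda>\<epsilon>. partial_derivs [] (\<lambda>x. (u \<epsilon> x - v \<epsilon> x) \<bullet> j))" if "j \<in> Basis" for j
    using assms that unfolding gf_rel_def negligible_vec_def negligible_nets_iff
    by (auto simp del: partial_derivs_simps)
  then show ?thesis by (simp add: negligible_on_componentwise[of K "\<lambda>\<epsilon> x. u \<epsilon> x - v \<epsilon> x"])
qed

text \<open>
  For moderate nets on the line, negligible values imply negligible derivatives. All equalities of
  generalized functions below are therefore proved by estimating values only.
\<close>

lemma gf_rel_line_iff:
  fixes J :: "real set"
  assumes "open J"
  shows "(u, v) \<in> gf_rel J \<longleftrightarrow> u \<in> moderate_vec J \<and> v \<in> moderate_vec J \<and>
     (\<forall>K. K \<subset>\<subset> J \<longrightarrow> negligible_on K (\<lambda>\<epsilon> x. u \<epsilon> x - v \<epsilon> x))"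
proof safe
  assume u: "u \<in> moderate_vec J" and v: "v \<in> moderate_vec J"
    and K: "\<forall>K. K \<subset>\<subset> J \<longrightarrow> negligible_on K (\<lambda>\<epsilon> x. u \<epsilon> x - v \<epsilon> x)"
  have "(\<lambda>\<epsilon> x. (u \<epsilon> x - v \<epsilon> x) \<bullet> j) \<in> negligible_nets J" if j: "j \<in> Basis" for j
  proof (rule negligible_netsI[OF assms])
    show "(\<lambda>\<epsilon> x. (u \<epsilon> x - v \<epsilon> x) \<bullet> j) \<in> moderate J"
      using moderate_diff[OF assms moderate_vecD[OF u j] moderate_vecD[OF v j]]
      by (simp add: inner_diff_left)
    show "negligible_on K (\<lambda>\<epsilon> x. (u \<epsilon> x - v \<epsilon> x) \<bullet> j)" if "K \<subset>\<subset> J" for K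
      using K that j negligible_on_componentwise[of K "\<lambda>\<epsilon> x. u \<epsilon> x - v \<epsilon> x"] by blast
  qed
  with u v show "(u, v) \<in> gf_rel J" by (auto simp: gf_rel_def negligible_vec_def)
qed (auto simp: gf_rel_imp_negligible_on, auto simp: gf_rel_def)

lemma gf_rel_line_refl: "open J \<Longrightarrow> u \<in> moderate_vec J \<Longrightarrow> (u, u) \<in> gf_rel (J :: real set)"
  by (auto simp: gf_rel_line_iff negligible_on_def eventually_mono[OF eventually_index])

lemma gf_rel_line_sym: "open J \<Longrightarrow> (u, v) \<in> gf_rel J \<Longrightarrow> (v, u) \<in> gf_rel (J :: real set)"
  by (auto simp: gf_rel_line_iff negligible_on_minus_commute[of _ v u])

lemma gf_rel_line_trans:
  "open J \<Longrightarrow> (u, v) \<in> gf_rel J \<Longrightarrow> (v, w) \<in> gf_rel J \<Longrightarrow> (u, w) \<in> gf_rel (J :: real set)"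
  by (auto simp: gf_rel_line_iff intro: negligible_on_trans[of _ u v w])

lemma gf_class_eqI:
  assumes "open J" "(u, v) \<in> gf_rel J"
  shows "gf_class (J :: real set) u = gf_class J v"
  using assms gf_rel_line_sym[OF assms] gf_rel_line_trans[OF assms(1)] unfolding gf_class_def by blast

lemma colombeau_classE:
  assumes "open J" "X \<in> colombeau (J :: real set)" "u \<in> X"
  shows "X = gf_class J u" "u \<in> moderate_vec J"
proof -
  obtain w where w: "w \<in> moderate_vec J" "X = gf_class J w"
    using assms(2) unfolding colombeau_def quotient_def gf_class_def by blast
  then have "(w, u) \<in> gf_rel J" using assms(3) by (simp add: gf_class_def)
  then show "X = gf_class J u" "u \<in> moderate_vec J"
    using w gf_class_eqI[OF assms(1)] by (auto simp: gf_rel_def)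
qed

text \<open>
  The right hand side of the differential equation lives on an open set of higher dimension; only the
  values of its representatives are compared there.
\<close>

lemma colombeau_class_rel:
  assumes "X \<in> colombeau V" "v \<in> X" "v' \<in> X"
  shows "v \<in> moderate_vec V" "v' \<in> moderate_vec V"
    "K \<subset>\<subset> V \<Longrightarrow> negligible_on K (\<lambda>\<epsilon> x. v \<epsilon> x - v' \<epsilon> x)"
proof -
  obtain w where "X = gf_rel V `` {w}" using assms(1) unfolding colombeau_def quotient_def by blast
  then have w: "(w, v) \<in> gf_rel V" "(w, v') \<in> gf_rel V" using assms by auto
  then show "v \<in> moderate_vec V" "v' \<in> moderate_vec V" by (auto simp: gf_rel_def)
  show "negligible_on K (\<lambda>\<epsilon> x. v \<epsilon> x - v' \<epsilon> x)" if "K \<subset>\<subset> V"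
    by (rule negligible_on_trans[of _ _ w])
       (use gf_rel_imp_negligible_on[OF w(1) that] gf_rel_imp_negligible_on[OF w(2) that]
         negligible_on_minus_commute[of K v w] in auto)
qed

lemma gf_class_self: "open J \<Longrightarrow> u \<in> moderate_vec J \<Longrightarrow> u \<in> gf_class (J :: real set) u"
  by (simp add: gf_class_def gf_rel_line_refl)

lemma gf_class_colombeau: "u \<in> moderate_vec J \<Longrightarrow> gf_class J u \<in> colombeau J"
  by (auto simp: colombeau_def quotient_def gf_class_def)

lemma UN_gf_class:
  assumes "open J" "A \<noteq> {}" "\<And>w. w \<in> A \<Longrightarrow> (u, f w) \<in> gf_rel (J :: real set)"
  shows "(\<Union>w\<in>A. gf_class J (f w)) = gf_class J u"
  using assms(2) gf_class_eqI[OF assms(1) assms(3)] by auto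

text \<open>
  A moderate net has locally moderate Lipschitz constants, so it maps close points to close
  points. The compact set has to be enlarged in order to contain the segments between them.
\<close>

lemma negligible_on_moderate_diff:
  fixes v :: "real \<Rightarrow> 'b::euclidean_space \<Rightarrow> real" and g g' :: "real \<Rightarrow> 'c \<Rightarrow> 'b"
  assumes "open V" "v \<in> moderate V" "L \<subset>\<subset> V"
    and L: "\<forall>\<^sub>F \<epsilon> in at_right 0. \<forall>x\<in>K. g' \<epsilon> x \<in> L"
    and gg': "negligible_on K (\<lambda>\<epsilon> x. g \<epsilon> x - g' \<epsilon> x)"
  shows "negligible_on K (\<lambda>\<epsilon> x. v \<epsilon> (g \<epsilon> x) - v \<epsilon> (g' \<epsilon> x))"
proof (rule negligible_onI)
  fix m
  obtain r L' where r: "r > 0" and L': "L' \<subset>\<subset> V" "\<And>x. x \<in> L \<Longrightarrow> cball x r \<subseteq> L'"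
    using compactly_inside_enlarge[OF assms(3)] by metis
  have "\<exists>N. \<forall>\<^sub>F \<epsilon> in at_right 0. \<forall>b\<in>Basis. \<forall>x\<in>L'. \<bar>partial_deriv b (v \<epsilon>) x\<bar> \<le> inverse (\<epsilon> ^ N)"
  proof -
    have "\<forall>b\<in>Basis. \<exists>N. \<forall>\<^sub>F \<epsilon> in at_right 0. \<forall>x\<in>L'. \<bar>partial_deriv b (v \<epsilon>) x\<bar> \<le> inverse (\<epsilon> ^ N)"
      using moderate_imp_moderate_on[OF moderate_partial_deriv[OF assms(2)] L'(1)]
      unfolding moderate_on_def by simp
    then obtain N where N: "\<forall>b\<in>Basis.
        \<forall>\<^sub>F \<epsilon> in at_right 0. \<forall>x\<in>L'. \<bar>partial_deriv b (v \<epsilon>) x\<bar> \<le> inverse (\<epsilon> ^ N b)"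
      unfolding bchoice_iff by blast
    define M where "M = Max (N ` Basis)"
    have "\<forall>\<^sub>F \<epsilon> in at_right 0. \<forall>x\<in>L'. \<bar>partial_deriv b (v \<epsilon>) x\<bar> \<le> inverse (\<epsilon> ^ M)" if "b \<in> Basis" for b
      using N[rule_format, OF that] eventually_index
    proof eventually_elim
      case (elim \<epsilon>)
      have "N b \<le> M" using that by (auto simp: M_def)
      then have "inverse (\<epsilon> ^ N b) \<le> inverse (\<epsilon> ^ M)" using elim by (intro inverse_power_mono) auto
      then show ?case using elim(1) by (meson order_trans)
    qed
    then have "\<forall>\<^sub>F \<epsilon> in at_right 0. \<forall>b\<in>Basis. \<forall>x\<in>L'. \<bar>partial_deriv b (v \<epsilon>) x\<bar> \<le> inverse (\<epsilon> ^ M)"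
      by (intro eventually_ball_finite) auto
    then show ?thesis ..
  qed
  then obtain N where N: "\<forall>\<^sub>F \<epsilon> in at_right 0. \<forall>b\<in>Basis. \<forall>x\<in>L'. \<bar>partial_deriv b (v \<epsilon>) x\<bar> \<le> inverse (\<epsilon> ^ N)"
    by blast
  have "\<forall>\<^sub>F \<epsilon> in at_right 0. \<forall>x\<in>K. norm (g \<epsilon> x - g' \<epsilon> x) \<le> \<epsilon> ^ (N + Suc m)"
    using gg' unfolding negligible_on_def by blast
  with N L have "\<forall>\<^sub>F \<epsilon> in at_right 0. \<forall>x\<in>K. norm (v \<epsilon> (g \<epsilon> x) - v \<epsilon> (g' \<epsilon> x)) \<le> real DIM('b) * \<epsilon> ^ m"
    using eventually_index eventually_index_less[OF r]
  proof eventually_elim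
    case (elim \<epsilon>)
    show ?case
    proof
      fix x assume x: "x \<in> K"
      have "\<epsilon> ^ (N + Suc m) \<le> \<epsilon>"
        using power_decreasing[of 1 "N + Suc m" \<epsilon>] elim by simp
      moreover have n: "norm (g \<epsilon> x - g' \<epsilon> x) \<le> \<epsilon> ^ (N + Suc m)" using elim x by blast
      ultimately have "norm (g \<epsilon> x - g' \<epsilon> x) \<le> r" using elim by linarith
      then have "g \<epsilon> x \<in> cball (g' \<epsilon> x) r" "g' \<epsilon> x \<in> cball (g' \<epsilon> x) r"
        using r by (auto simp: dist_norm norm_minus_commute)
      then have seg: "closed_segment (g' \<epsilon> x) (g \<epsilon> x) \<subseteq> L'"
        using L'(2)[of "g' \<epsilon> x"] elim(2) x closed_segment_subset[OF _ _ convex_cball] by blast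
      have "L' \<subseteq> V" using L'(1) assms(1) by (simp add: compactly_inside_open)
      have "\<bar>v \<epsilon> (g \<epsilon> x) - v \<epsilon> (g' \<epsilon> x)\<bar> \<le> real DIM('b) * inverse (\<epsilon> ^ N) * norm (g \<epsilon> x - g' \<epsilon> x)"
      proof (rule smooth_on_mean_value[OF assms(1), where f = "v \<epsilon>"])
        show "smooth_on V (v \<epsilon>)" using moderate_imp_smooth_on[OF assms(2)] elim by simp
      qed (use seg \<open>L' \<subseteq> V\<close> elim in auto)
      also have "\<dots> \<le> real DIM('b) * inverse (\<epsilon> ^ N) * \<epsilon> ^ (N + m)"
      proof (intro mult_left_mono)
        have "\<epsilon> ^ (N + Suc m) \<le> \<epsilon> ^ (N + m)" using elim by (intro power_decreasing) auto
        then show "norm (g \<epsilon> x - g' \<epsilon> x) \<le> \<epsilon> ^ (N + m)" using n by linarith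
      qed (use elim in auto)
      also have "\<dots> = real DIM('b) * \<epsilon> ^ m" using elim by (simp add: power_add)
      finally show "norm (v \<epsilon> (g \<epsilon> x) - v \<epsilon> (g' \<epsilon> x)) \<le> real DIM('b) * \<epsilon> ^ m" by simp
    qed
  qed
  then show "\<exists>C. \<forall>\<^sub>F \<epsilon> in at_right 0. \<forall>x\<in>K. norm (v \<epsilon> (g \<epsilon> x) - v \<epsilon> (g' \<epsilon> x)) \<le> C * \<epsilon> ^ m" ..
qed

lemma comp_net_inner: "comp_net J V v g \<epsilon> x \<bullet> j = comp_net J V (\<lambda>\<epsilon> x. v \<epsilon> x \<bullet> j) g \<epsilon> x"
  by (simp add: comp_net_def)

lemma comp_net_moderate_vec:
  fixes g :: "real \<Rightarrow> real \<Rightarrow> 'b::euclidean_space" and v :: "real \<Rightarrow> 'b \<Rightarrow> 'c::euclidean_space"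
  assumes "open J" "open V" "v \<in> moderate_vec V" "c_bounded J V g"
  shows "comp_net J V v g \<in> moderate_vec J"
proof -
  have "moderate_upto k J (comp_net J V (\<lambda>\<epsilon> x. v \<epsilon> x \<bullet> j) g)" if j: "j \<in> Basis" for j :: 'c and k
    using assms(4) moderate_vecD[OF assms(3) j] moderate_vecD[OF c_bounded_moderate_vec[OF assms(4)]]
    by (intro moderate_upto_comp_net[OF assms(1,2)])
       (auto simp: c_bounded_iff moderate_iff_moderate_upto[OF assms(1)])
  moreover have "(\<lambda>\<epsilon> x. comp_net J V v g \<epsilon> x \<bullet> j) = comp_net J V (\<lambda>\<epsilon> x. v \<epsilon> x \<bullet> j) g" for j
    by (intro ext) (rule comp_net_inner)
  ultimately show ?thesis
    by (simp add: moderate_vec_def moderate_iff_moderate_upto[OF assms(1)])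
qed

text \<open>
  Composition does not depend on the representatives: \<open>v \<circ> g - v' \<circ> g'\<close> is the sum of
  \<open>v \<circ> g - v \<circ> g'\<close>, small because \<open>v\<close> maps close points to close points, and of \<open>(v - v') \<circ> g'\<close>,
  small because \<open>g'\<close> takes values in a compact set.
\<close>

lemma comp_net_cong:
  fixes g :: "real \<Rightarrow> real \<Rightarrow> 'b::euclidean_space" and v :: "real \<Rightarrow> 'b \<Rightarrow> 'c::euclidean_space"
  assumes "open J" "open V" "v \<in> moderate_vec V" "v' \<in> moderate_vec V"
    and vv': "\<And>K. K \<subset>\<subset> V \<Longrightarrow> negligible_on K (\<lambda>\<epsilon> x. v \<epsilon> x - v' \<epsilon> x)"
    and "c_bounded J V g" "c_bounded J V g'" "(g, g') \<in> gf_rel J"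
  shows "(comp_net J V v g, comp_net J V v' g') \<in> gf_rel J"
  unfolding gf_rel_line_iff[OF assms(1)]
proof (intro conjI allI impI)
  show "comp_net J V v g \<in> moderate_vec J" "comp_net J V v' g' \<in> moderate_vec J"
    using assms comp_net_moderate_vec by blast+
  fix K assume K: "K \<subset>\<subset> J"
  obtain L where L: "L \<subset>\<subset> V" "\<forall>\<^sub>F \<epsilon> in at_right 0. g' \<epsilon> ` K \<subseteq> L"
    using assms(7) K unfolding c_bounded_iff by blast
  have "negligible_on K (\<lambda>\<epsilon> x. (v \<epsilon> (g \<epsilon> x) - v \<epsilon> (g' \<epsilon> x)) \<bullet> j)" if "j \<in> Basis" for j
    unfolding inner_diff_left
    using L(2) gf_rel_imp_negligible_on[OF assms(8) K]
    by (intro negligible_on_moderate_diff[OF assms(2) moderate_vecD[OF assms(3) that] L(1)])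
       (auto elim!: eventually_mono)
  then have 1: "negligible_on K (\<lambda>\<epsilon> x. v \<epsilon> (g \<epsilon> x) - v \<epsilon> (g' \<epsilon> x))"
    by (subst negligible_on_componentwise) blast
  have 2: "negligible_on K (\<lambda>\<epsilon> x. v \<epsilon> (g' \<epsilon> x) - v' \<epsilon> (g' \<epsilon> x))"
    unfolding negligible_on_def
  proof
    fix m
    have "\<forall>\<^sub>F \<epsilon> in at_right 0. \<forall>x\<in>L. norm (v \<epsilon> x - v' \<epsilon> x) \<le> \<epsilon> ^ m"
      using vv'[OF L(1)] unfolding negligible_on_def by blast
    then show "\<forall>\<^sub>F \<epsilon> in at_right 0. \<forall>x\<in>K. norm (v \<epsilon> (g' \<epsilon> x) - v' \<epsilon> (g' \<epsilon> x)) \<le> \<epsilon> ^ m"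
      using L(2) by eventually_elim auto
  qed
  have "\<forall>\<^sub>F \<epsilon> in at_right 0. g \<epsilon> ` J \<subseteq> V" "\<forall>\<^sub>F \<epsilon> in at_right 0. g' \<epsilon> ` J \<subseteq> V"
    using assms(6,7) unfolding c_bounded_iff by blast+
  then have "\<forall>\<^sub>F \<epsilon> in at_right 0. \<forall>x\<in>K. norm (comp_net J V v g \<epsilon> x - comp_net J V v' g' \<epsilon> x)
      \<le> norm (v \<epsilon> (g \<epsilon> x) - v' \<epsilon> (g' \<epsilon> x))"
    by eventually_elim (auto simp: comp_net_def)
  then show "negligible_on K (\<lambda>\<epsilon> x. comp_net J V v g \<epsilon> x - comp_net J V v' g' \<epsilon> x)"
    by (rule negligible_on_le[OF negligible_on_trans[OF 1 2]])
qed

section \<open>Generalized points\<close>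

lemma gp_equiv_iff: "gp_equiv x y \<longleftrightarrow> negligible_on UNIV (\<lambda>\<epsilon> (_::unit). x \<epsilon> - y \<epsilon>)"
proof
  assume *: "gp_equiv x y"
  show "negligible_on UNIV (\<lambda>\<epsilon> (_::unit). x \<epsilon> - y \<epsilon>)"
  proof (rule negligible_onI)
    fix m
    have "(\<lambda>\<epsilon>. norm (x \<epsilon> - y \<epsilon>)) \<in> O[at_right 0](\<lambda>\<epsilon>. \<epsilon> ^ m)" using * by (simp add: gp_equiv_def)
    then obtain c where "\<forall>\<^sub>F \<epsilon> in at_right 0. norm (norm (x \<epsilon> - y \<epsilon>)) \<le> c * norm (\<epsilon> ^ m)"
      by (rule landau_o.bigE)
    then have "\<forall>\<^sub>F \<epsilon> in at_right 0. \<forall>t\<in>(UNIV::unit set). norm (x \<epsilon> - y \<epsilon>) \<le> c * \<epsilon> ^ m"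
      using eventually_index by eventually_elim auto
    then show "\<exists>C. \<forall>\<^sub>F \<epsilon> in at_right 0. \<forall>t\<in>(UNIV::unit set). norm (x \<epsilon> - y \<epsilon>) \<le> C * \<epsilon> ^ m" ..
  qed
next
  assume *: "negligible_on UNIV (\<lambda>\<epsilon> (_::unit). x \<epsilon> - y \<epsilon>)"
  show "gp_equiv x y"
    unfolding gp_equiv_def
  proof
    fix m
    have "\<forall>\<^sub>F \<epsilon> in at_right 0. norm (x \<epsilon> - y \<epsilon>) \<le> \<epsilon> ^ m"
      using * unfolding negligible_on_def by simp
    then have "\<forall>\<^sub>F \<epsilon> in at_right 0. norm (norm (x \<epsilon> - y \<epsilon>)) \<le> 1 * norm (\<epsilon> ^ m)"
      using eventually_index by eventually_elim auto
    then show "(\<lambda>\<epsilon>. norm (x \<epsilon> - y \<epsilon>)) \<in> O[at_right 0](\<lambda>\<epsilon>. \<epsilon> ^ m)"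
      by (rule landau_o.bigI[rotated]) simp
  qed
qed

lemma gp_equiv_refl: "gp_equiv x x"
  by (auto simp: gp_equiv_iff negligible_on_def eventually_mono[OF eventually_index])

lemma gp_equiv_sym: "gp_equiv x y \<Longrightarrow> gp_equiv y x"
  by (simp add: gp_equiv_def norm_minus_commute)

lemma gp_equiv_trans: "gp_equiv x y \<Longrightarrow> gp_equiv y z \<Longrightarrow> gp_equiv x z"
  unfolding gp_equiv_iff by (rule negligible_on_trans)

lemma gp_equiv_eventually: "gp_equiv x y \<Longrightarrow> \<forall>\<^sub>F \<epsilon> in at_right 0. norm (x \<epsilon> - y \<epsilon>) \<le> \<epsilon> ^ m"
  by (auto simp: gp_equiv_iff negligible_on_def)

lemma gp_equiv_cong:
  assumes "\<forall>\<^sub>F \<epsilon> in at_right 0. x \<epsilon> = y \<epsilon>"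
  shows "gp_equiv x y"
  unfolding gp_equiv_iff negligible_on_def
proof
  fix m
  show "\<forall>\<^sub>F \<epsilon> in at_right 0. \<forall>t\<in>(UNIV::unit set). norm (x \<epsilon> - y \<epsilon>) \<le> \<epsilon> ^ m"
    using assms eventually_index by eventually_elim simp
qed

lemma gen_points_classE:
  assumes "X \<in> gen_points U" "x \<in> X"
  shows "X = {y \<in> gp_nets U. gp_equiv x y}" "x \<in> gp_nets U"
proof -
  obtain w where w: "w \<in> gp_nets U" "X = gp_rel U `` {w}"
    using assms(1) unfolding gen_points_def quotient_def by blast
  then show "X = {y \<in> gp_nets U. gp_equiv x y}" "x \<in> gp_nets U"
    using assms(2) by (auto simp: gp_rel_def intro: gp_equiv_trans gp_equiv_sym)
qed

lemma gp_equiv_tendsto: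
  assumes "gp_equiv x y" "(x \<longlongrightarrow> p) (at_right 0)"
  shows "(y \<longlongrightarrow> p) (at_right 0)"
proof -
  have "\<forall>\<^sub>F \<epsilon> in at_right 0. norm (y \<epsilon> - x \<epsilon>) \<le> \<epsilon>"
    using gp_equiv_eventually[OF gp_equiv_sym[OF assms(1)], of 1] by simp
  moreover have "((\<lambda>\<epsilon>::real. \<epsilon>) \<longlongrightarrow> 0) (at_right 0)" by (rule tendsto_ident_at)
  ultimately have "((\<lambda>\<epsilon>. y \<epsilon> - x \<epsilon>) \<longlongrightarrow> 0) (at_right 0)" by (rule Lim_null_comparison)
  from tendsto_add[OF this assms(2)] show ?thesis by simp
qed

section \<open>Smooth functions of one variable and cutoff functions\<close>

lemma continuous_on_imp_moderate_upto_0: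
  assumes "open J" "continuous_on J f"
  shows "moderate_upto 0 J (\<lambda>_. f)"
proof -
  have "moderate_on K (\<lambda>_. f)" if "K \<subset>\<subset> J" for K
  proof -
    have K: "compact K" "K \<subseteq> J" using that assms(1) by (auto simp: compactly_inside_open)
    obtain C where "\<forall>x\<in>K. norm (f x) \<le> C"
      using compact_imp_bounded[OF compact_continuous_image[OF continuous_on_subset[OF assms(2) K(2)] K(1)]]
      by (auto simp: bounded_iff)
    then show ?thesis by (intro moderate_on_bounded[of _ _ C]) auto
  qed
  then show ?thesis using assms(2) by simp
qed

lemma moderate_upto_line_SucI:
  assumes "open J" "\<And>t. t \<in> J \<Longrightarrow> (f has_real_derivative f' t) (at t)" "moderate_upto k J (\<lambda>_. f')"
  shows "moderate_upto (Suc k) J (\<lambda>_. f)"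
proof (rule moderate_upto_SucI[where f' = "\<lambda>_. f'"])
  have "continuous_on J f" by (rule DERIV_continuous_on) (rule has_field_derivative_at_within[OF assms(2)])
  from continuous_on_imp_moderate_upto_0[OF assms(1) this]
  show "moderate_on K (\<lambda>_. f)" if "K \<subset>\<subset> J" for K
    using that by (rule moderate_upto_imp_moderate_on)
qed (use assms in auto)

lemma smooth_on_line_add:
  "open J \<Longrightarrow> smooth_on J f \<Longrightarrow> smooth_on J g \<Longrightarrow> smooth_on (J :: real set) (\<lambda>t. f t + g t)"
  by (auto simp: smooth_on_line_iff intro: moderate_upto_add)

lemma smooth_on_line_diff:
  "open J \<Longrightarrow> smooth_on J f \<Longrightarrow> smooth_on J g \<Longrightarrow> smooth_on (J :: real set) (\<lambda>t. f t - g t)"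
  by (auto simp: smooth_on_line_iff intro: moderate_upto_diff)

lemma smooth_on_line_mult:
  "open J \<Longrightarrow> smooth_on J f \<Longrightarrow> smooth_on J g \<Longrightarrow> smooth_on (J :: real set) (\<lambda>t. f t * g t)"
  by (auto simp: smooth_on_line_iff intro: moderate_upto_mult)

lemma smooth_on_line_const: "open J \<Longrightarrow> smooth_on (J :: real set) (\<lambda>t. c)"
  by (auto simp: smooth_on_line_iff intro: moderate_upto_real)

lemma smooth_on_line_ident: "open J \<Longrightarrow> smooth_on (J :: real set) (\<lambda>t. t)"
  by (auto simp: smooth_on_line_iff intro: moderate_upto_ident)

lemma smooth_on_line_inverse:
  assumes "open J" "smooth_on (J :: real set) f" "\<And>t. t \<in> J \<Longrightarrow> f t \<noteq> 0"
  shows "smooth_on J (\<lambda>t. inverse (f t))"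
proof -
  have "moderate_upto k J (\<lambda>_ t. inverse (f t))" for k
  proof (induction k)
    case 0
    have "continuous_on J (\<lambda>t. inverse (f t))"
      using assms smooth_on_imp_continuous_on by (intro continuous_on_inverse) auto
    then show ?case by (rule continuous_on_imp_moderate_upto_0[OF assms(1)])
  next
    case (Suc k)
    have f': "moderate_upto k J (\<lambda>_. partial_deriv 1 f)"
      using smooth_on_partial_deriv[OF assms(2), of 1] assms(1) by (simp add: smooth_on_line_iff)
    have "(f has_real_derivative partial_deriv 1 f t) (at t)" if "t \<in> J" for t
      using smooth_on_line_derivative[OF assms(2), of 1 0 t] that by simp
    then have d: "((\<lambda>t. inverse (f t)) has_real_derivative
        0 - partial_deriv 1 f t * (inverse (f t) * inverse (f t))) (at t)" if "t \<in> J" for t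
      using that assms(3) by (auto intro!: derivative_eq_intros simp: power2_eq_square)
    show ?case
      by (rule moderate_upto_line_SucI[OF assms(1) d], assumption)
         (intro moderate_upto_diff moderate_upto_real moderate_upto_mult f' Suc.IH)
  qed
  then show ?thesis by (simp add: smooth_on_line_iff[OF assms(1)])
qed

lemma moderate_upto_compose:
  fixes g :: "real \<Rightarrow> 'b::euclidean_space"
  assumes "open J" "open V" "smooth_on V f"
    and g: "\<And>b. b \<in> Basis \<Longrightarrow> moderate_upto k J (\<lambda>_ t. g t \<bullet> b)" and "g ` J \<subseteq> V"
  shows "moderate_upto k J (\<lambda>_ t. f (g t))"
proof -
  have "continuous_on J (\<lambda>t. g t \<bullet> b)" if "b \<in> Basis" for b
    using moderate_upto_imp_continuous_on[OF g[OF that], of 1] by simp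
  then have cont: "continuous_on J g"
    by (subst continuous_on_componentwise) auto
  have "moderate_upto k J (comp_net J V (\<lambda>_. f) (\<lambda>_. g))"
  proof (rule moderate_upto_comp_net[OF assms(1,2)])
    show "(\<lambda>_. f) \<in> moderate V" using assms(3) by (simp add: constant_net_moderate_iff)
    show "moderate_upto k J (\<lambda>\<epsilon> t. g t \<bullet> b)" if "b \<in> Basis" for b using g[OF that] .
    fix K assume K: "K \<subset>\<subset> J"
    then have "g ` K \<subset>\<subset> V"
      using assms(1,2,5) compact_continuous_image[OF continuous_on_subset[OF cont]]
      by (auto simp: compactly_inside_open)
    then show "\<exists>L. L \<subset>\<subset> V \<and> (\<forall>\<^sub>F \<epsilon>::real in at_right 0. g ` K \<subseteq> L)" by auto
  qed
  moreover have "comp_net J V (\<lambda>_. f) (\<lambda>_. g) = (\<lambda>_ t. f (g t))"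
    using assms(5) by (auto simp: comp_net_def fun_eq_iff)
  ultimately show ?thesis by simp
qed

lemma smooth_on_line_compose:
  fixes f g :: "real \<Rightarrow> real"
  assumes "smooth_on UNIV f" "smooth_on UNIV g"
  shows "smooth_on UNIV (\<lambda>t. f (g t))"
  using assms moderate_upto_compose[of UNIV UNIV f _ g] by (auto simp: smooth_on_line_iff)

text \<open>
  For \<open>k = 0\<close> this is the classical function that is flat at \<open>0\<close>; the factors \<open>x\<^sup>-\<^sup>k\<close>
  make the family closed under derivatives up to linear combinations.
\<close>

definition flat_exp :: "nat \<Rightarrow> real \<Rightarrow> real" where
  "flat_exp k x = (if x > 0 then inverse x ^ k * exp (- inverse x) else 0)"

lemma flat_exp_tendsto_0: "(flat_exp k \<longlongrightarrow> 0) (at_right 0)"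
proof -
  have "((\<lambda>x::real. inverse x ^ k / exp (inverse x)) \<longlongrightarrow> 0) (at_right 0)"
    using filterlim_compose[OF tendsto_power_div_exp_0 filterlim_inverse_at_top_right] .
  moreover have "\<forall>\<^sub>F x in at_right 0. inverse x ^ k / exp (inverse x) = flat_exp k x"
    using eventually_index by eventually_elim (simp add: flat_exp_def exp_minus field_simps)
  ultimately show ?thesis by (rule Lim_transform_eventually)
qed

lemma flat_exp_derivative:
  "(flat_exp k has_real_derivative flat_exp (k + 2) x - real k * flat_exp (k + 1) x) (at x)"
proof -
  consider "x > 0" | "x < 0" | "x = 0" by linarith
  then show ?thesis
  proof cases
    case 1
    have "((\<lambda>x. inverse x ^ k * exp (- inverse x)) has_real_derivative
        flat_exp (k + 2) x - real k * flat_exp (k + 1) x) (at x)"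
    proof (cases k)
      case 0
      then show ?thesis using 1
        by (auto intro!: derivative_eq_intros simp: flat_exp_def power2_eq_square)
    next
      case (Suc n)
      have "n = 0 \<or> inverse x * inverse x ^ (n - Suc 0) = inverse x ^ n" by (cases n) auto
      then show ?thesis using 1 Suc
        by (auto intro!: derivative_eq_intros simp: flat_exp_def power2_eq_square algebra_simps)
    qed
    then show ?thesis
      by (rule has_field_derivative_transform_within_open[of _ _ _ "{0<..}"])
         (use 1 in \<open>auto simp: flat_exp_def\<close>)
  next
    case 2
    have "((\<lambda>x. 0) has_real_derivative 0) (at x)" by simp
    then have "(flat_exp k has_real_derivative 0) (at x)"
      by (rule has_field_derivative_transform_within_open[of _ _ _ "{..<0}"])
         (use 2 in \<open>auto simp: flat_exp_def\<close>)
    then show ?thesis using 2 by (simp add: flat_exp_def)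
  next
    case 3
    have "\<forall>\<^sub>F h in at_right 0. flat_exp (k + 1) h = (flat_exp k (0 + h) - flat_exp k 0) / h"
      using eventually_index by eventually_elim (simp add: flat_exp_def field_simps)
    then have r: "((\<lambda>h. (flat_exp k (0 + h) - flat_exp k 0) / h) \<longlongrightarrow> 0) (at_right 0)"
      by (rule Lim_transform_eventually[OF flat_exp_tendsto_0])
    have "\<forall>\<^sub>F h in at_left (0::real). h < 0" by (simp add: eventually_at_filter)
    then have "\<forall>\<^sub>F h in at_left 0. 0 = (flat_exp k (0 + h) - flat_exp k 0) / h"
      by eventually_elim (simp add: flat_exp_def)
    then have l: "((\<lambda>h. (flat_exp k (0 + h) - flat_exp k 0) / h) \<longlongrightarrow> 0) (at_left 0)"
      by (rule Lim_transform_eventually[OF tendsto_const])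
    have "((\<lambda>h. (flat_exp k (0 + h) - flat_exp k 0) / h) \<longlongrightarrow> 0) (at 0)"
      using filterlim_split_at[OF l r] .
    then show ?thesis using 3 by (simp add: DERIV_def flat_exp_def)
  qed
qed

lemma smooth_flat_exp: "smooth_on UNIV (flat_exp k)"
proof -
  have "moderate_upto n UNIV (\<lambda>_. flat_exp k)" for n k
  proof (induction n arbitrary: k)
    case 0
    have "continuous_on UNIV (flat_exp k)"
      by (rule DERIV_continuous_on) (rule has_field_derivative_at_within[OF flat_exp_derivative])
    then show ?case by (rule continuous_on_imp_moderate_upto_0[OF open_UNIV])
  next
    case (Suc n)
    show ?case
      by (rule moderate_upto_line_SucI[OF open_UNIV, where f = "flat_exp k", OF flat_exp_derivative])
         (intro moderate_upto_diff moderate_upto_mult moderate_upto_real Suc.IH)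
  qed
  then show ?thesis by (simp add: smooth_on_line_iff)
qed

definition smooth_step :: "real \<Rightarrow> real" where
  "smooth_step x = flat_exp 0 x * inverse (flat_exp 0 x + flat_exp 0 (1 - x))"

lemma smooth_step_denominator: "flat_exp 0 x + flat_exp 0 (1 - x) > 0"
  by (auto simp: flat_exp_def intro: add_pos_pos)

lemma smooth_step:
  "smooth_on UNIV smooth_step" "0 \<le> smooth_step x" "smooth_step x \<le> 1"
  "x \<le> 0 \<Longrightarrow> smooth_step x = 0" "x \<ge> 1 \<Longrightarrow> smooth_step x = 1"
proof -
  have "smooth_on UNIV (\<lambda>x. flat_exp 0 (1 - x))"
    by (intro smooth_on_line_compose[OF smooth_flat_exp] smooth_on_line_diff smooth_on_line_const
        smooth_on_line_ident open_UNIV)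
  then have "smooth_on UNIV (\<lambda>x. flat_exp 0 x * inverse (flat_exp 0 x + flat_exp 0 (1 - x)))"
    using smooth_step_denominator[THEN less_imp_neq]
    by (intro smooth_on_line_mult smooth_on_line_inverse smooth_on_line_add smooth_flat_exp open_UNIV) auto
  then show "smooth_on UNIV smooth_step" unfolding smooth_step_def[abs_def] .
  have nonneg: "flat_exp 0 y \<ge> 0" for y by (simp add: flat_exp_def)
  show "0 \<le> smooth_step x" "smooth_step x \<le> 1"
    using smooth_step_denominator[of x] nonneg[of x] nonneg[of "1 - x"]
    by (auto simp: smooth_step_def field_simps)
  show "x \<le> 0 \<Longrightarrow> smooth_step x = 0" by (simp add: smooth_step_def flat_exp_def)
  show "x \<ge> 1 \<Longrightarrow> smooth_step x = 1" by (simp add: smooth_step_def flat_exp_def)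
qed

lemma smooth_cutoff:
  fixes l r \<delta> :: real
  assumes "\<delta> > 0"
  obtains \<theta> where "smooth_on UNIV \<theta>" "\<And>t. 0 \<le> \<theta> t \<and> \<theta> t \<le> 1"
    "\<And>t. t \<notin> {l + 3 / 2 * \<delta>..r - 3 / 2 * \<delta>} \<Longrightarrow> \<theta> t = 0"
    "\<And>t. t \<in> {l + 2 * \<delta>..r - 2 * \<delta>} \<Longrightarrow> \<theta> t = 1"
proof
  \<comment> \<open>\<open>3 / 2\<close> lies strictly between \<open>1\<close> and \<open>2\<close>: \<open>\<theta>\<close> vanishes in a neighbourhood of \<open>l + \<delta>\<close> and of \<open>r - \<delta>\<close>\<close>
  define \<theta> where "\<theta> t = smooth_step (2 / \<delta> * (t - l) - 3) * smooth_step (2 / \<delta> * (r - t) - 3)" for t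
  show "smooth_on UNIV \<theta>"
    unfolding \<theta>_def[abs_def]
    by (intro smooth_on_line_mult smooth_on_line_compose[OF smooth_step(1)] smooth_on_line_diff
        smooth_on_line_const smooth_on_line_ident open_UNIV)
  show "0 \<le> \<theta> t \<and> \<theta> t \<le> 1" for t
    using smooth_step by (auto simp: \<theta>_def intro: mult_le_one)
  show "\<theta> t = 0" if "t \<notin> {l + 3 / 2 * \<delta>..r - 3 / 2 * \<delta>}" for t
  proof -
    have "2 / \<delta> * (t - l) - 3 \<le> 0 \<or> 2 / \<delta> * (r - t) - 3 \<le> 0"
      using that assms by (auto simp: field_simps)
    then show ?thesis using smooth_step(4) by (auto simp: \<theta>_def)
  qed
  show "\<theta> t = 1" if "t \<in> {l + 2 * \<delta>..r - 2 * \<delta>}" for t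
  proof -
    have "2 / \<delta> * (t - l) - 3 \<ge> 1" "2 / \<delta> * (r - t) - 3 \<ge> 1"
      using that assms by (auto simp: field_simps)
    then show ?thesis using smooth_step(5) by (simp add: \<theta>_def)
  qed
qed

text \<open>
  The convex combination \<open>c + \<theta> (v - c)\<close> stays in every ball around \<open>c\<close> that contains the value of \<open>v\<close>, and
  is constant near the ends of the interval on which \<open>v\<close> is smooth, so that it extends smoothly to the line.
\<close>

lemma smooth_cutoff_extension:
  fixes v :: "real \<Rightarrow> 'b::euclidean_space" and l r \<delta> :: real
  assumes "\<delta> > 0" and v: "\<And>j. j \<in> Basis \<Longrightarrow> smooth_on {l + \<delta><..<r - \<delta>} (\<lambda>t. v t \<bullet> j)"
  obtains w where "\<And>j. j \<in> Basis \<Longrightarrow> smooth_on UNIV (\<lambda>t. w t \<bullet> j)"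
    "\<And>t. t \<in> {l + 2 * \<delta>..r - 2 * \<delta>} \<Longrightarrow> w t = v t"
    "\<And>t. t \<in> {l + \<delta><..<r - \<delta>} \<Longrightarrow> norm (w t - c) \<le> norm (v t - c)"
    "\<And>t. t \<notin> {l + \<delta><..<r - \<delta>} \<Longrightarrow> w t = c"
proof -
  obtain \<theta> where \<theta>: "smooth_on UNIV \<theta>" "\<And>t. 0 \<le> \<theta> t \<and> \<theta> t \<le> 1"
    "\<And>t. t \<notin> {l + 3 / 2 * \<delta>..r - 3 / 2 * \<delta>} \<Longrightarrow> \<theta> t = 0"
    "\<And>t. t \<in> {l + 2 * \<delta>..r - 2 * \<delta>} \<Longrightarrow> \<theta> t = 1"
    using smooth_cutoff[OF assms(1), of l r] by metis
  define w where "w t = c + \<theta> t *\<^sub>R (v t - c)" for t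
  define S T where "S = {l + \<delta><..<r - \<delta>}" and "T = - {l + 3 / 2 * \<delta>..r - 3 / 2 * \<delta>}"
  have op: "open S" "open T" by (auto simp: S_def T_def)
  show thesis
  proof
    fix j :: 'b assume j: "j \<in> Basis"
    have "smooth_on S (\<lambda>t. c \<bullet> j + \<theta> t * (v t \<bullet> j - c \<bullet> j))"
      using v[OF j] smooth_on_subset[OF \<theta>(1)] unfolding S_def[symmetric]
      by (intro smooth_on_line_add smooth_on_line_mult smooth_on_line_diff smooth_on_line_const op) auto
    then have 1: "smooth_on S (\<lambda>t. w t \<bullet> j)" by (simp add: w_def inner_add_left inner_diff_left)
    have 2: "smooth_on T (\<lambda>t. w t \<bullet> j)"
      by (rule smooth_on_cong[OF op(2) smooth_on_line_const[OF op(2), of "c \<bullet> j"]])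
         (use \<theta>(3) in \<open>auto simp: w_def T_def\<close>)
    have "S \<union> T = UNIV" using assms(1) by (auto simp: S_def T_def)
    then show "smooth_on UNIV (\<lambda>t. w t \<bullet> j)" using smooth_on_Un[OF op 1 2] by simp
  next
    show "w t = v t" if "t \<in> {l + 2 * \<delta>..r - 2 * \<delta>}" for t using \<theta>(4)[OF that] by (simp add: w_def)
    show "norm (w t - c) \<le> norm (v t - c)" for t
      using \<theta>(2)[of t] by (simp add: w_def mult_left_le_one_le)
    show "w t = c" if "t \<notin> {l + \<delta><..<r - \<delta>}" for t
      using that assms(1) \<theta>(3)[of t] by (auto simp: w_def)
  qed
qed

section \<open>Ordinary differential equations\<close>

lemma has_vector_derivative_componentwise:
  fixes f :: "real \<Rightarrow> 'b::euclidean_space"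
  shows "(f has_vector_derivative D) (at t) \<longleftrightarrow>
    (\<forall>j\<in>Basis. ((\<lambda>t. f t \<bullet> j) has_real_derivative D \<bullet> j) (at t))"
  unfolding has_vector_derivative_def has_field_derivative_def
  by (subst has_derivative_componentwise_within) (simp add: mult_commute_abs)

lemma primitive_exists:
  fixes f :: "real \<Rightarrow> 'a::banach"
  assumes "continuous_on UNIV f"
  shows "\<exists>P. P \<tau> = 0 \<and> (\<forall>t. (P has_vector_derivative f t) (at t))"
proof -
  define P where "P t = integral {\<tau>..t} f - integral {t..\<tau>} f" for t
  have int: "f integrable_on {x..y}" for x y
    by (rule integrable_continuous_real[OF continuous_on_subset[OF assms]]) simp
  have "(P has_vector_derivative f t) (at t)" for t
  proof -
    define A B where "A = min \<tau> t - 1" and "B = max \<tau> t + 1"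
    have eq: "integral {A..s} f - integral {A..\<tau>} f = P s" if "s \<in> {A<..<B}" for s
    proof (cases "\<tau> \<le> s")
      case True
      have "integral {s..\<tau>} f = 0"
      proof (cases "s = \<tau>")
        case False
        then have "{s..\<tau>} = {}" using True by auto
        then show ?thesis by simp
      qed simp
      then show ?thesis
        using Henstock_Kurzweil_Integration.integral_combine[OF _ True int, of A] by (simp add: P_def A_def algebra_simps)
    next
      case False
      then show ?thesis
        using Henstock_Kurzweil_Integration.integral_combine[OF _ _ int, of A s \<tau>] that by (simp add: P_def algebra_simps)
    qed
    have "((\<lambda>s. integral {A..s} f) has_vector_derivative f t) (at t within {A..B})"
      by (rule integral_has_vector_derivative[OF continuous_on_subset[OF assms]]) (auto simp: A_def B_def)
    moreover have "at t within {A..B} = at t"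
      by (rule at_within_Icc_at) (auto simp: A_def B_def)
    ultimately have "((\<lambda>s. integral {A..s} f - integral {A..\<tau>} f) has_vector_derivative f t - 0) (at t)"
      by (intro has_vector_derivative_diff) auto
    then show ?thesis
      unfolding diff_0_right
      by (rule has_vector_derivative_transform_within_open[of _ _ _ "{A<..<B}"])
         (use eq in \<open>auto simp: A_def B_def\<close>)
  qed
  moreover have "P \<tau> = 0" by (simp add: P_def)
  ultimately show ?thesis by blast
qed

lemma exponential_growth_bound:
  fixes D :: "real \<Rightarrow> 'a::real_normed_vector"
  assumes D: "\<And>s. (D has_vector_derivative d s) (at s)" "D \<tau> = 0"
    and d: "\<And>s. norm (d s) \<le> K * exp (\<kappa> * \<bar>s - \<tau>\<bar>)" and "\<kappa> > 0"
  shows "norm (D t) \<le> K / \<kappa> * exp (\<kappa> * \<bar>t - \<tau>\<bar>)"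
proof -
  have K: "K \<ge> 0" using d[of \<tau>] by (metis abs_zero diff_self exp_zero mult.right_neutral mult_zero_right norm_ge_zero order_trans)
  have forward: "norm (E (\<tau> + y)) \<le> K / \<kappa> * exp (\<kappa> * y)"
    if E: "\<And>s. (E has_vector_derivative e s) (at s)" "E \<tau> = 0" "\<And>s. norm (e s) \<le> K * exp (\<kappa> * \<bar>s - \<tau>\<bar>)"
      and y: "y \<ge> 0" for E :: "real \<Rightarrow> 'a" and e y
  proof (cases "y = 0")
    case True
    then show ?thesis using E(2) K \<open>\<kappa> > 0\<close> by simp
  next
    case False
    have "norm (E (\<tau> + y) - E \<tau>) \<le> K / \<kappa> * exp (\<kappa> * (\<tau> + y - \<tau>)) - K / \<kappa> * exp (\<kappa> * (\<tau> - \<tau>))"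
    proof (rule differentiable_bound_general[where f' = e and \<phi>' = "\<lambda>s. K * exp (\<kappa> * (s - \<tau>))"])
      show "\<tau> < \<tau> + y" using False y by simp
      show "continuous_on {\<tau>..\<tau> + y} E"
        using E(1) by (meson continuous_at_imp_continuous_on has_vector_derivative_continuous)
      show "continuous_on {\<tau>..\<tau> + y} (\<lambda>s. K / \<kappa> * exp (\<kappa> * (s - \<tau>)))" by (intro continuous_intros)
      show "((\<lambda>s. K / \<kappa> * exp (\<kappa> * (s - \<tau>))) has_vector_derivative K * exp (\<kappa> * (x - \<tau>))) (at x)" for x
        unfolding has_real_derivative_iff_has_vector_derivative[symmetric]
        using \<open>\<kappa> > 0\<close> by (auto intro!: derivative_eq_intros)
      show "norm (e x) \<le> K * exp (\<kappa> * (x - \<tau>))" if "\<tau> < x" for x using E(3)[of x] that by simp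
    qed (use E in auto)
    moreover have "K / \<kappa> \<ge> 0" using K \<open>\<kappa> > 0\<close> by simp
    ultimately show ?thesis using E(2) by simp
  qed
  show ?thesis
  proof (cases "t \<ge> \<tau>")
    case True
    then show ?thesis using forward[of D d "t - \<tau>"] D d by simp
  next
    case False
    have "((\<lambda>s. D (2 * \<tau> - s)) has_vector_derivative (-1) *\<^sub>R d (2 * \<tau> - s)) (at s)" for s
    proof -
      have "((\<lambda>s. 2 * \<tau> - s) has_vector_derivative -1) (at s)"
        unfolding has_real_derivative_iff_has_vector_derivative[symmetric]
        by (auto intro!: derivative_eq_intros)
      from vector_diff_chain_at[OF this D(1)] show ?thesis by (simp add: o_def)
    qed
    from forward[of "\<lambda>s. D (2 * \<tau> - s)", OF this _ _, of "\<tau> - t"]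
    show ?thesis using False D(2) d[of "2 * \<tau> - _"] by (auto simp: abs_minus_commute)
  qed
qed

text \<open>
  In the norm weighted by \<open>exp (- \<kappa> \<bar>t - \<tau>\<bar>)\<close> with \<open>\<kappa>\<close> large compared with the Lipschitz constant, the
  integral operator is a contraction on the whole line, which gives a global solution at once.
\<close>

lemma global_ode_solution_exists:
  fixes G :: "real \<Rightarrow> 'a::euclidean_space \<Rightarrow> 'a"
  assumes cont: "continuous_on UNIV (\<lambda>(t, x). G t x)" and bound: "\<And>t x. norm (G t x) \<le> a"
    and lip: "\<And>t x y. norm (G t x - G t y) \<le> \<Lambda> * norm (x - y)" and "\<Lambda> \<ge> 0"
  shows "\<exists>u. u \<tau> = x\<^sub>0 \<and> (\<forall>t. (u has_vector_derivative G t (u t)) (at t))"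
proof -
  have "\<exists>P. \<forall>f::real \<Rightarrow> 'a. continuous_on UNIV f \<longrightarrow> P f \<tau> = 0 \<and> (\<forall>t. (P f has_vector_derivative f t) (at t))"
    using primitive_exists[of _ \<tau>] by (intro choice) auto
  then obtain P where P: "\<And>f::real \<Rightarrow> 'a. continuous_on UNIV f \<Longrightarrow> P f \<tau> = 0"
    "\<And>f t. continuous_on UNIV f \<Longrightarrow> (P f has_vector_derivative f t) (at t)"
    by blast
  \<comment> \<open>the contraction constant will be \<open>\<Lambda> / \<kappa> \<le> 1 / 2\<close>\<close>
  define \<kappa> where "\<kappa> = 2 * \<Lambda> + 1"
  have \<kappa>: "\<kappa> > 0" "\<Lambda> / \<kappa> \<le> 1 / 2" using \<open>\<Lambda> \<ge> 0\<close> by (auto simp: \<kappa>_def field_simps)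
  define W where "W t = exp (\<kappa> * \<bar>t - \<tau>\<bar>)" for t
  have W: "W t > 0" "W t \<ge> 1" "continuous_on S W" for t S
    using \<kappa> by (auto simp: W_def[abs_def] intro!: continuous_intros)
  define rhs where "rhs w s = G s (W s *\<^sub>R w s)" for w :: "real \<Rightarrow> 'a" and s
  have cont_rhs: "continuous_on UNIV (rhs w)" if "continuous_on UNIV w" for w
  proof -
    have "continuous_on UNIV (\<lambda>s. (s, W s *\<^sub>R w s))" using that W by (intro continuous_intros)
    from continuous_on_compose2[OF cont this] show ?thesis by (simp add: rhs_def[abs_def])
  qed
  define op where "op w t = inverse (W t) *\<^sub>R (x\<^sub>0 + P (rhs w) t)" for w t
  have op: "op w \<in> bcontfun" if w: "continuous_on UNIV w" for w
  proof (rule bcontfun_normI)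
    have "continuous_on UNIV (P (rhs w))"
      using P(2)[OF cont_rhs[OF w]] by (meson continuous_at_imp_continuous_on has_vector_derivative_continuous)
    then show "continuous_on UNIV (op w)"
      unfolding op_def[abs_def] using W by (intro continuous_intros) (auto simp: less_imp_neq[symmetric])
    fix t
    have "norm (P (rhs w) t) \<le> a / \<kappa> * exp (\<kappa> * \<bar>t - \<tau>\<bar>)"
    proof (rule exponential_growth_bound[OF P(2)[OF cont_rhs[OF w]] P(1)[OF cont_rhs[OF w]] _ \<kappa>(1)])
      fix s
      have "a \<ge> 0" using bound[of 0 0] norm_ge_zero order_trans by blast
      then show "norm (rhs w s) \<le> a * exp (\<kappa> * \<bar>s - \<tau>\<bar>)"
        using bound[of s "W s *\<^sub>R w s"] mult_left_mono[of 1 "exp (\<kappa> * \<bar>s - \<tau>\<bar>)" a] \<kappa>(1)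
        by (auto simp: rhs_def)
    qed
    then have "inverse (W t) * norm (x\<^sub>0 + P (rhs w) t) \<le> inverse (W t) * (norm x\<^sub>0 + a / \<kappa> * W t)"
      using W(1)[of t] by (intro mult_left_mono order_trans[OF norm_triangle_ineq]) (auto simp: W_def)
    also have "\<dots> = inverse (W t) * norm x\<^sub>0 + a / \<kappa>" using W(1)[of t] by (simp add: algebra_simps)
    also have "\<dots> \<le> 1 * norm x\<^sub>0 + a / \<kappa>"
      using W(2)[of t] by (intro add_mono mult_right_mono) (auto intro: inverse_le_1_iff[THEN iffD2])
    finally show "norm (op w t) \<le> norm x\<^sub>0 + a / \<kappa>" using W(1)[of t] by (simp add: op_def)
  qed
  define T where "T w = Bcontfun (op (apply_bcontfun w))" for w :: "real \<Rightarrow>\<^sub>C 'a"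
  have T: "apply_bcontfun (T w) = op (apply_bcontfun w)" for w
    unfolding T_def by (intro Bcontfun_inverse op) (use apply_bcontfun[of w] in \<open>auto simp: bcontfun_def\<close>)
  have contr: "dist (T w) (T w') \<le> 1 / 2 * dist w w'" for w w'
  proof (rule dist_bound)
    fix t
    have cw: "continuous_on UNIV (apply_bcontfun w)" for w :: "real \<Rightarrow>\<^sub>C 'a"
      using apply_bcontfun[of w] by (auto simp: bcontfun_def)
    have "norm (P (rhs w) t - P (rhs w') t) \<le> (\<Lambda> * dist w w') / \<kappa> * exp (\<kappa> * \<bar>t - \<tau>\<bar>)"
    proof (rule exponential_growth_bound[where D = "\<lambda>t. P (rhs w) t - P (rhs w') t" and d = "\<lambda>t. rhs w t - rhs w' t"])
      show "((\<lambda>t. P (rhs w) t - P (rhs w') t) has_vector_derivative rhs w s - rhs w' s) (at s)" for s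
        by (intro has_vector_derivative_diff P(2) cont_rhs cw)
      show "P (rhs w) \<tau> - P (rhs w') \<tau> = 0" using P(1) cont_rhs cw by simp
      fix s
      have "norm (rhs w s - rhs w' s) \<le> \<Lambda> * norm (W s *\<^sub>R w s - W s *\<^sub>R w' s)"
        unfolding rhs_def by (rule lip)
      also have "\<dots> = \<Lambda> * (W s * dist (w s) (w' s))"
        using W(1)[of s] by (simp add: dist_norm flip: scaleR_diff_right)
      also have "\<dots> \<le> \<Lambda> * (W s * dist w w')"
        using W(1)[of s] \<open>\<Lambda> \<ge> 0\<close> dist_bounded[of w s w'] by (intro mult_left_mono) auto
      finally show "norm (rhs w s - rhs w' s) \<le> \<Lambda> * dist w w' * exp (\<kappa> * \<bar>s - \<tau>\<bar>)"
        by (simp add: W_def algebra_simps)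
    qed (rule \<kappa>)
    then have "inverse (W t) * norm (P (rhs w) t - P (rhs w') t) \<le> inverse (W t) * ((\<Lambda> * dist w w') / \<kappa> * W t)"
      using W(1)[of t] by (intro mult_left_mono) (auto simp: W_def)
    also have "\<dots> = \<Lambda> / \<kappa> * dist w w'" using W(1)[of t] by simp
    also have "\<dots> \<le> 1 / 2 * dist w w'" using \<kappa>(2) by (intro mult_right_mono) auto
    finally show "dist (T w t) (T w' t) \<le> 1 / 2 * dist w w'"
      using W(1)[of t] by (simp add: T op_def dist_norm flip: scaleR_diff_right)
  qed
  have "\<exists>!w. T w = w"
    using contr by (intro banach_fix_type[of "1 / 2"]) auto
  then obtain w where w: "T w = w" by blast
  define u where "u t = W t *\<^sub>R w t" for t
  have cw: "continuous_on UNIV (apply_bcontfun w)"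
    using apply_bcontfun[of w] by (auto simp: bcontfun_def)
  have u: "u t = x\<^sub>0 + P (rhs w) t" for t
  proof -
    have "w t = op w t" using fun_cong[OF T[of w], of t] by (simp add: w)
    then show ?thesis using W(1)[of t] by (simp add: u_def op_def)
  qed
  have "(u has_vector_derivative 0 + rhs w t) (at t)" for t
    unfolding u[abs_def] by (intro has_vector_derivative_add has_vector_derivative_const P(2) cont_rhs cw)
  moreover have "rhs w t = G t (u t)" for t by (simp add: rhs_def u_def)
  moreover have "u \<tau> = x\<^sub>0" using u[of \<tau>] P(1)[OF cont_rhs[OF cw]] by simp
  ultimately show ?thesis by auto
qed

lemma linear_growth_bound:
  fixes D :: "real \<Rightarrow> 'a::real_normed_vector"
  assumes "\<And>s. s \<in> closed_segment \<tau> t \<Longrightarrow> (D has_vector_derivative d s) (at s)"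
    and "\<And>s. s \<in> closed_segment \<tau> t \<Longrightarrow> norm (d s) \<le> a"
  shows "norm (D t - D \<tau>) \<le> a * \<bar>t - \<tau>\<bar>"
proof -
  have "norm (D t - D \<tau>) \<le> a * norm (t - \<tau>)"
  proof (rule differentiable_bound[of "closed_segment \<tau> t" D "\<lambda>s h. h *\<^sub>R d s"])
    fix s assume s: "s \<in> closed_segment \<tau> t"
    show "(D has_derivative (\<lambda>h. h *\<^sub>R d s)) (at s within closed_segment \<tau> t)"
      using assms(1)[OF s] unfolding has_vector_derivative_def by (rule has_derivative_at_withinI)
    show "onorm (\<lambda>h. h *\<^sub>R d s) \<le> a"
    proof (rule onorm_le)
      show "norm (h *\<^sub>R d s) \<le> a * norm h" for h :: real
        using mult_right_mono[OF assms(2)[OF s], of "norm h"] by (simp add: mult.commute)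
    qed
  qed auto
  then show ?thesis by simp
qed

text \<open>
  Composing the right hand side with the nearest point projections onto the time interval and
  onto the ball keeps its bound and its Lipschitz constant, and makes it globally defined. The
  bound keeps the solution inside the ball, where nothing was changed, for \<open>a * \<bar>t - \<tau>\<bar> \<le> \<beta>\<close>.
\<close>

lemma local_ode_solution_exists:
  fixes F :: "real \<times> 'a::euclidean_space \<Rightarrow> 'a"
  assumes "c \<le> d" "\<beta> \<ge> 0" "\<Lambda> \<ge> 0" and cont: "continuous_on ({c..d} \<times> cball x\<^sub>0 \<beta>) F"
    and bound: "\<And>t x. t \<in> {c..d} \<Longrightarrow> x \<in> cball x\<^sub>0 \<beta> \<Longrightarrow> norm (F (t, x)) \<le> a"
    and lip: "\<And>t x y. t \<in> {c..d} \<Longrightarrow> x \<in> cball x\<^sub>0 \<beta> \<Longrightarrow> y \<in> cball x\<^sub>0 \<beta> \<Longrightarrow>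
      norm (F (t, x) - F (t, y)) \<le> \<Lambda> * norm (x - y)"
  obtains u where "u \<tau> = x\<^sub>0" "\<And>t. norm (u t - x\<^sub>0) \<le> a * \<bar>t - \<tau>\<bar>"
    "\<And>t. t \<in> {c..d} \<Longrightarrow> a * \<bar>t - \<tau>\<bar> \<le> \<beta> \<Longrightarrow> (u has_vector_derivative F (t, u t)) (at t)"
proof -
  define \<pi> where "\<pi> = closest_point (cball x\<^sub>0 \<beta>)"
  define \<sigma> where "\<sigma> t = max c (min d t)" for t
  define G where "G t x = F (\<sigma> t, \<pi> x)" for t x
  have ne: "cball x\<^sub>0 \<beta> \<noteq> {}" using assms by simp
  have \<pi>: "\<pi> x \<in> cball x\<^sub>0 \<beta>" for x
    unfolding \<pi>_def by (rule closest_point_in_set[OF closed_cball ne])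
  have \<sigma>: "\<sigma> t \<in> {c..d}" for t using assms(1) by (auto simp: \<sigma>_def)
  have "continuous_on UNIV \<pi>" unfolding \<pi>_def by (intro continuous_on_closest_point closed_cball convex_cball ne)
  from continuous_on_compose2[OF this continuous_on_snd[OF continuous_on_id]]
  have "continuous_on UNIV (\<lambda>p :: real \<times> 'a. \<pi> (snd p))" by simp
  then have "continuous_on UNIV (\<lambda>p. (\<sigma> (fst p), \<pi> (snd p)))"
    unfolding \<sigma>_def by (intro continuous_on_Pair continuous_on_max continuous_on_min continuous_on_const
      continuous_on_fst continuous_on_id)
  moreover have "range (\<lambda>p. (\<sigma> (fst p), \<pi> (snd p))) \<subseteq> {c..d} \<times> cball x\<^sub>0 \<beta>"
    using \<pi> \<sigma> by blast
  ultimately have "continuous_on UNIV (\<lambda>p. F (\<sigma> (fst p), \<pi> (snd p)))"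
    by (rule continuous_on_compose2[OF cont])
  then have "continuous_on UNIV (\<lambda>(t, x). G t x)"
    by (simp add: G_def case_prod_beta)
  moreover have "norm (G t x) \<le> a" for t x unfolding G_def using \<pi> \<sigma> by (rule bound[rotated])
  moreover have "norm (G t x - G t y) \<le> \<Lambda> * norm (x - y)" for t x y
  proof -
    have "norm (\<pi> x - \<pi> y) \<le> norm (x - y)"
      using closest_point_lipschitz[OF convex_cball closed_cball ne, of x y] by (simp add: \<pi>_def dist_norm)
    then show ?thesis
      using lip[OF \<sigma> \<pi> \<pi>, of t x y] mult_left_mono[OF _ assms(3)] unfolding G_def by (meson order_trans)
  qed
  ultimately obtain u where u: "u \<tau> = x\<^sub>0" "\<And>t. (u has_vector_derivative G t (u t)) (at t)"
    using global_ode_solution_exists[of G a \<Lambda> \<tau> x\<^sub>0] assms(3) by blast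
  have 1: "norm (u t - x\<^sub>0) \<le> a * \<bar>t - \<tau>\<bar>" for t
    using linear_growth_bound[of \<tau> t u "\<lambda>t. G t (u t)" a] u \<open>\<And>t x. norm (G t x) \<le> a\<close> by simp
  show thesis
  proof (rule that[OF u(1) 1])
    fix t assume t: "t \<in> {c..d}" "a * \<bar>t - \<tau>\<bar> \<le> \<beta>"
    then have "u t \<in> cball x\<^sub>0 \<beta>" using 1[of t] by (simp add: dist_norm norm_minus_commute)
    then have "\<pi> (u t) = u t" unfolding \<pi>_def by (rule closest_point_self)
    moreover have "\<sigma> t = t" using t by (auto simp: \<sigma>_def)
    ultimately show "(u has_vector_derivative F (t, u t)) (at t)" using u(2)[of t] by (simp add: G_def)
  qed
qed

lemma Basis_prod_real_cases:
  assumes "b \<in> (Basis :: (real \<times> 'a::euclidean_space) set)"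
  obtains "b = (1, 0)" | j where "j \<in> Basis" "b = (0, j)"
  using assms by (auto simp: Basis_prod_def)

lemma ode_solution_smooth:
  fixes F :: "real \<times> 'a::euclidean_space \<Rightarrow> 'a"
  assumes "open S" "open V" and F: "\<And>j. j \<in> Basis \<Longrightarrow> smooth_on V (\<lambda>p. F p \<bullet> j)"
    and u: "\<And>t. t \<in> S \<Longrightarrow> (t, u t) \<in> V" "\<And>t. t \<in> S \<Longrightarrow> (u has_vector_derivative F (t, u t)) (at t)"
    and j: "j \<in> Basis"
  shows "smooth_on S (\<lambda>t. u t \<bullet> j)"
proof -
  have d: "((\<lambda>t. u t \<bullet> j) has_real_derivative F (t, u t) \<bullet> j) (at t)" if "t \<in> S" "j \<in> Basis" for t j
    using u(2)[OF that(1)] that(2) by (simp add: has_vector_derivative_componentwise)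
  have "\<forall>j\<in>Basis. moderate_upto k S (\<lambda>_ t. u t \<bullet> j)" for k
  proof (induction k)
    case 0
    have "continuous_on S (\<lambda>t. u t \<bullet> j)" if "j \<in> Basis" for j
      by (rule DERIV_continuous_on) (rule has_field_derivative_at_within[OF d[OF _ that]])
    then show ?case using continuous_on_imp_moderate_upto_0[OF assms(1)] by blast
  next
    case (Suc k)
    show ?case
    proof
      fix j :: 'a assume j: "j \<in> Basis"
      have "moderate_upto k S (\<lambda>_ t. F (t, u t) \<bullet> j)"
      proof (rule moderate_upto_compose[OF assms(1,2) F[OF j]])
        fix b :: "real \<times> 'a" assume "b \<in> Basis"
        then show "moderate_upto k S (\<lambda>_ t. (t, u t) \<bullet> b)"
          by (cases rule: Basis_prod_real_cases) (use Suc.IH in \<open>auto simp: moderate_upto_ident\<close>)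
      qed (use u(1) in auto)
      then show "moderate_upto (Suc k) S (\<lambda>_ t. u t \<bullet> j)"
        using d[OF _ j]
        by (intro moderate_upto_line_SucI[OF assms(1), where f' = "\<lambda>t. F (t, u t) \<bullet> j"]) auto
    qed
  qed
  then show ?thesis using j by (simp add: smooth_on_line_iff[OF assms(1)])
qed

section \<open>Solutions for fixed index\<close>

lemma smooth_on_vector_derivative:
  fixes w :: "real \<Rightarrow> 'b::euclidean_space"
  assumes "\<And>j. j \<in> Basis \<Longrightarrow> smooth_on J (\<lambda>t. w t \<bullet> j)" "t \<in> J"
  shows "(w has_vector_derivative partial_deriv 1 w t) (at t)"
    and "j \<in> Basis \<Longrightarrow> partial_deriv 1 w t \<bullet> j = partial_deriv 1 (\<lambda>t. w t \<bullet> j) t"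
proof -
  have d: "((\<lambda>t. w t \<bullet> j) has_real_derivative partial_deriv 1 (\<lambda>t. w t \<bullet> j) t) (at t)" if "j \<in> Basis" for j
    using smooth_on_line_derivative[OF assms(1)[OF that], of 1 0 t] assms(2) by simp
  define D where "D = (\<Sum>j\<in>Basis. partial_deriv 1 (\<lambda>t. w t \<bullet> j) t *\<^sub>R j)"
  have Dj: "D \<bullet> j = partial_deriv 1 (\<lambda>t. w t \<bullet> j) t" if "j \<in> Basis" for j
    using that by (simp add: D_def)
  have D: "(w has_vector_derivative D) (at t)"
    unfolding has_vector_derivative_componentwise using d Dj by simp
  have "((\<lambda>s. w (t + s *\<^sub>R 1)) has_vector_derivative 1 *\<^sub>R D) (at 0)"
  proof -
    have "((\<lambda>s. t + s) has_vector_derivative 1) (at 0)"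
      unfolding has_real_derivative_iff_has_vector_derivative[symmetric]
      by (auto intro!: derivative_eq_intros)
    from vector_diff_chain_at[OF this, of w D] D show ?thesis by (simp add: o_def)
  qed
  then have "partial_deriv 1 w t = D"
    unfolding partial_deriv_def by (simp add: vector_derivative_at)
  then show "(w has_vector_derivative partial_deriv 1 w t) (at t)"
    "j \<in> Basis \<Longrightarrow> partial_deriv 1 w t \<bullet> j = partial_deriv 1 (\<lambda>t. w t \<bullet> j) t"
    using D Dj by simp_all
qed

text \<open>
  The ball is convex, so a bound for the partial derivatives on the compact set \<open>[c, d] \<times> cball x\<^sub>0 \<beta>\<close> is a
  Lipschitz constant in the second variable.
\<close>

lemma smooth_solution_exists:
  fixes f :: "real \<times> 'b::euclidean_space \<Rightarrow> 'b"
  assumes "open I" "open U" and f: "\<And>j. j \<in> Basis \<Longrightarrow> smooth_on (I \<times> U) (\<lambda>p. f p \<bullet> j)"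
    and "c \<le> d" "{c..d} \<subseteq> I" "\<beta> > 0" "cball x\<^sub>0 \<beta> \<subseteq> U"
    and bound: "\<And>t x. t \<in> {c..d} \<Longrightarrow> x \<in> cball x\<^sub>0 \<beta> \<Longrightarrow> norm (f (t, x)) \<le> a"
  obtains u where "u \<tau> = x\<^sub>0" "\<And>t. norm (u t - x\<^sub>0) \<le> a * \<bar>t - \<tau>\<bar>"
    "\<And>t. t \<in> {c<..<d} \<Longrightarrow> a * \<bar>t - \<tau>\<bar> < \<beta> \<Longrightarrow> (u has_vector_derivative f (t, u t)) (at t)"
    "\<And>j. j \<in> Basis \<Longrightarrow> smooth_on {t \<in> {c<..<d}. a * \<bar>t - \<tau>\<bar> < \<beta>} (\<lambda>t. u t \<bullet> j)"
proof -
  define Q where "Q = {c..d} \<times> cball x\<^sub>0 \<beta>"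
  have Q: "compact Q" "Q \<subseteq> I \<times> U" using assms by (auto simp: Q_def intro!: compact_Times)
  have V: "open (I \<times> U)" using assms by (simp add: open_Times)
  define H where "H p = (\<Sum>j\<in>Basis. \<Sum>b\<in>Basis. \<bar>partial_deriv b (\<lambda>p. f p \<bullet> j) p\<bar>)" for p
  have "continuous_on Q H"
    unfolding H_def
    using smooth_on_imp_continuous_on[OF smooth_on_partial_deriv[OF f]] Q(2)
    by (intro continuous_intros) (auto intro: continuous_on_subset)
  then have "bounded (H ` Q)" by (rule compact_imp_bounded[OF compact_continuous_image[OF _ Q(1)]])
  then obtain B where B: "\<And>p. p \<in> Q \<Longrightarrow> norm (H p) \<le> B"
    unfolding bounded_iff by blast
  have partial: "\<bar>partial_deriv b (\<lambda>p. f p \<bullet> j) p\<bar> \<le> \<bar>B\<bar>" if "p \<in> Q" "j \<in> Basis" "b \<in> Basis" for p b j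
  proof -
    have "\<bar>partial_deriv b (\<lambda>p. f p \<bullet> j) p\<bar> \<le> (\<Sum>b\<in>Basis. \<bar>partial_deriv b (\<lambda>p. f p \<bullet> j) p\<bar>)"
      using that(3) by (rule member_le_sum) auto
    also have "\<dots> \<le> H p"
      unfolding H_def using that(2) by (rule member_le_sum) (auto intro: sum_nonneg)
    finally show ?thesis using B[OF that(1)] by simp
  qed
  define \<Lambda> where "\<Lambda> = real DIM('b) * (real DIM(real \<times> 'b) * \<bar>B\<bar>)"
  have lip: "norm (f (t, x) - f (t, y)) \<le> \<Lambda> * norm (x - y)"
    if t: "t \<in> {c..d}" and x: "x \<in> cball x\<^sub>0 \<beta>" and y: "y \<in> cball x\<^sub>0 \<beta>" for t x y
  proof -
    have "convex Q" unfolding Q_def by (intro convex_Times convex_cball) simp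
    then have seg: "closed_segment (t, y) (t, x) \<subseteq> Q"
      using t x y by (intro closed_segment_subset) (auto simp: Q_def)
    have "\<bar>(f (t, x) - f (t, y)) \<bullet> j\<bar> \<le> (real DIM(real \<times> 'b) * \<bar>B\<bar>) * norm (x - y)" if "j \<in> Basis" for j
    proof -
      have "\<bar>f (t, x) \<bullet> j - f (t, y) \<bullet> j\<bar> \<le> real DIM(real \<times> 'b) * \<bar>B\<bar> * norm ((t, x) - (t, y))"
        by (rule smooth_on_mean_value[OF V f[OF that]]) (use seg Q(2) partial that in auto)
      then show ?thesis by (simp add: inner_diff_left norm_prod_def)
    qed
    then have "(\<Sum>j\<in>Basis. \<bar>(f (t, x) - f (t, y)) \<bullet> j\<bar>)
        \<le> (\<Sum>j\<in>(Basis::'b set). (real DIM(real \<times> 'b) * \<bar>B\<bar>) * norm (x - y))"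
      by (rule sum_mono)
    then show ?thesis
      using norm_le_l1[of "f (t, x) - f (t, y)"] by (simp add: \<Lambda>_def algebra_simps)
  qed
  have contf: "continuous_on Q f"
  proof (subst continuous_on_componentwise, intro ballI)
    fix j :: 'b assume "j \<in> Basis"
    then show "continuous_on Q (\<lambda>p. f p \<bullet> j)"
      using smooth_on_imp_continuous_on[OF f] Q(2) continuous_on_subset by blast
  qed
  have "\<Lambda> \<ge> 0" by (simp add: \<Lambda>_def)
  obtain u where u: "u \<tau> = x\<^sub>0" "\<And>t. norm (u t - x\<^sub>0) \<le> a * \<bar>t - \<tau>\<bar>"
    "\<And>t. t \<in> {c..d} \<Longrightarrow> a * \<bar>t - \<tau>\<bar> \<le> \<beta> \<Longrightarrow> (u has_vector_derivative f (t, u t)) (at t)"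
    using local_ode_solution_exists[OF assms(4) less_imp_le[OF assms(6)] \<open>\<Lambda> \<ge> 0\<close> contf[unfolded Q_def] bound lip, of \<tau>]
    by blast
  define S where "S = {t \<in> {c<..<d}. a * \<bar>t - \<tau>\<bar> < \<beta>}"
  have "open {t. a * \<bar>t - \<tau>\<bar> < \<beta>}" by (intro open_Collect_less continuous_intros)
  moreover have "S = {c<..<d} \<inter> {t. a * \<bar>t - \<tau>\<bar> < \<beta>}" by (auto simp: S_def)
  ultimately have "open S" by auto
  have "smooth_on S (\<lambda>t. u t \<bullet> j)" if "j \<in> Basis" for j
  proof (rule ode_solution_smooth[OF \<open>open S\<close> V f _ _ that])
    fix t assume t: "t \<in> S"
    then have "u t \<in> cball x\<^sub>0 \<beta>" using u(2)[of t] by (auto simp: S_def dist_norm norm_minus_commute)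
    then show "(t, u t) \<in> I \<times> U" using t assms(5,7) by (auto simp: S_def)
    show "(u has_vector_derivative f (t, u t)) (at t)" using u(3)[of t] t by (auto simp: S_def)
  qed
  then show thesis using that[of u] u unfolding S_def by auto
qed

section \<open>Cutting off nets near the ends of the interval\<close>

lemma eventually_eq_imp_moderate:
  fixes J :: "real set"
  assumes "open J" "\<And>\<epsilon>. \<epsilon> \<in> {0<..1} \<Longrightarrow> smooth_on J (w \<epsilon>)" "v \<in> moderate J"
    and eq: "\<And>K. K \<subset>\<subset> J \<Longrightarrow> \<forall>\<^sub>F \<epsilon> in at_right 0. \<forall>t\<in>K. w \<epsilon> t = v \<epsilon> t"
  shows "w \<in> moderate J"
  unfolding moderate_iff
proof (intro conjI ballI allI impI)
  fix K and bs :: "real list" assume K: "K \<subset>\<subset> J" and bs: "set bs \<subseteq> Basis"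
  obtain K' where K': "K' \<subset>\<subset> J" "K \<subseteq> interior K'" using compactly_inside_enlarge[OF K] by metis
  have "\<forall>\<^sub>F \<epsilon> in at_right 0. \<forall>t\<in>K. partial_derivs bs (w \<epsilon>) t = partial_derivs bs (v \<epsilon>) t"
    using eq[OF K'(1)]
  proof eventually_elim
    case (elim \<epsilon>)
    have "partial_derivs bs (w \<epsilon>) t = partial_derivs bs (v \<epsilon>) t" if "t \<in> interior K'" for t
      by (rule partial_derivs_cong_open[OF open_interior _ that]) (use elim interior_subset in blast)
    then show ?case using K'(2) by blast
  qed
  from moderate_on_cong[OF this] show "moderate_on K (\<lambda>\<epsilon>. partial_derivs bs (w \<epsilon>))"
    using assms(3) K bs by (simp add: moderate_iff)
qed (use assms(2) in auto)

text \<open>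
  The function \<open>w \<epsilon>\<close> is defined on the whole interval even if \<open>v \<epsilon>\<close> is smooth on a smaller one only, and is
  nowhere farther from \<open>c \<epsilon>\<close> than \<open>v \<epsilon>\<close>. As \<open>\<delta>\<close> tends to \<open>0\<close>, it agrees with \<open>v \<epsilon>\<close> on each compact subset for
  small indices, so that \<open>v\<close> and \<open>w\<close> represent the same generalized function if \<open>v\<close> is moderate.
\<close>

lemma cutoff_net:
  fixes v :: "real \<Rightarrow> real \<Rightarrow> 'b::euclidean_space" and l r :: real and \<delta> :: "real \<Rightarrow> real"
  assumes \<delta>: "\<And>\<epsilon>. \<epsilon> \<in> {0<..1} \<Longrightarrow> \<delta> \<epsilon> > 0" "(\<delta> \<longlongrightarrow> 0) (at_right 0)"
    and v: "\<And>\<epsilon> j. \<epsilon> \<in> {0<..1} \<Longrightarrow> j \<in> Basis \<Longrightarrow> smooth_on {l + \<delta> \<epsilon><..<r - \<delta> \<epsilon>} (\<lambda>t. v \<epsilon> t \<bullet> j)"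
  obtains w where "\<And>\<epsilon> j. \<epsilon> \<in> {0<..1} \<Longrightarrow> j \<in> Basis \<Longrightarrow> smooth_on {l<..<r} (\<lambda>t. w \<epsilon> t \<bullet> j)"
    "\<And>K. K \<subset>\<subset> {l<..<r} \<Longrightarrow> \<forall>\<^sub>F \<epsilon> in at_right 0. \<forall>t\<in>K. w \<epsilon> t = v \<epsilon> t"
    "\<And>\<epsilon> t. \<epsilon> \<in> {0<..1} \<Longrightarrow> t \<in> {l + \<delta> \<epsilon><..<r - \<delta> \<epsilon>} \<Longrightarrow> norm (w \<epsilon> t - c \<epsilon>) \<le> norm (v \<epsilon> t - c \<epsilon>)"
    "\<And>\<epsilon> t. \<epsilon> \<in> {0<..1} \<Longrightarrow> t \<notin> {l + \<delta> \<epsilon><..<r - \<delta> \<epsilon>} \<Longrightarrow> w \<epsilon> t = c \<epsilon>"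
proof -
  have "\<forall>\<epsilon>\<in>{0<..1}. \<exists>w. (\<forall>j\<in>Basis. smooth_on UNIV (\<lambda>t. w t \<bullet> j)) \<and>
      (\<forall>t\<in>{l + 2 * \<delta> \<epsilon>..r - 2 * \<delta> \<epsilon>}. w t = v \<epsilon> t) \<and>
      (\<forall>t\<in>{l + \<delta> \<epsilon><..<r - \<delta> \<epsilon>}. norm (w t - c \<epsilon>) \<le> norm (v \<epsilon> t - c \<epsilon>)) \<and>
      (\<forall>t. t \<notin> {l + \<delta> \<epsilon><..<r - \<delta> \<epsilon>} \<longrightarrow> w t = c \<epsilon>)"
  proof
    fix \<epsilon> :: real assume \<epsilon>: "\<epsilon> \<in> {0<..1}"
    obtain w where "\<And>j. j \<in> Basis \<Longrightarrow> smooth_on UNIV (\<lambda>t. w t \<bullet> j)"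
      "\<And>t. t \<in> {l + 2 * \<delta> \<epsilon>..r - 2 * \<delta> \<epsilon>} \<Longrightarrow> w t = v \<epsilon> t"
      "\<And>t. t \<in> {l + \<delta> \<epsilon><..<r - \<delta> \<epsilon>} \<Longrightarrow> norm (w t - c \<epsilon>) \<le> norm (v \<epsilon> t - c \<epsilon>)"
      "\<And>t. t \<notin> {l + \<delta> \<epsilon><..<r - \<delta> \<epsilon>} \<Longrightarrow> w t = c \<epsilon>"
      by (rule smooth_cutoff_extension[of "\<delta> \<epsilon>" l r "v \<epsilon>" "c \<epsilon>", OF \<delta>(1)[OF \<epsilon>] v[OF \<epsilon>]]) blast+
    then show "\<exists>w. (\<forall>j\<in>Basis. smooth_on UNIV (\<lambda>t. w t \<bullet> j)) \<and>
        (\<forall>t\<in>{l + 2 * \<delta> \<epsilon>..r - 2 * \<delta> \<epsilon>}. w t = v \<epsilon> t) \<and>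
        (\<forall>t\<in>{l + \<delta> \<epsilon><..<r - \<delta> \<epsilon>}. norm (w t - c \<epsilon>) \<le> norm (v \<epsilon> t - c \<epsilon>)) \<and>
        (\<forall>t. t \<notin> {l + \<delta> \<epsilon><..<r - \<delta> \<epsilon>} \<longrightarrow> w t = c \<epsilon>)"
      by blast
  qed
  then obtain w where w: "\<forall>\<epsilon>\<in>{0<..1}. (\<forall>j\<in>Basis. smooth_on UNIV (\<lambda>t. w \<epsilon> t \<bullet> j)) \<and>
      (\<forall>t\<in>{l + 2 * \<delta> \<epsilon>..r - 2 * \<delta> \<epsilon>}. w \<epsilon> t = v \<epsilon> t) \<and>
      (\<forall>t\<in>{l + \<delta> \<epsilon><..<r - \<delta> \<epsilon>}. norm (w \<epsilon> t - c \<epsilon>) \<le> norm (v \<epsilon> t - c \<epsilon>)) \<and>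
      (\<forall>t. t \<notin> {l + \<delta> \<epsilon><..<r - \<delta> \<epsilon>} \<longrightarrow> w \<epsilon> t = c \<epsilon>)"
    unfolding bchoice_iff by blast
  show thesis
  proof
    show "smooth_on {l<..<r} (\<lambda>t. w \<epsilon> t \<bullet> j)" if "\<epsilon> \<in> {0<..1}" "j \<in> Basis" for \<epsilon> j
      using w that smooth_on_subset by blast
    fix K assume "K \<subset>\<subset> {l<..<r}"
    then obtain \<eta> where \<eta>: "\<eta> > 0" "K \<subseteq> {l + \<eta>..r - \<eta>}" by (rule compactly_inside_interval)
    have "\<forall>\<^sub>F \<epsilon> in at_right 0. \<delta> \<epsilon> < \<eta> / 2" using \<delta>(2) \<eta>(1) by (intro order_tendstoD) auto
    then show "\<forall>\<^sub>F \<epsilon> in at_right 0. \<forall>t\<in>K. w \<epsilon> t = v \<epsilon> t"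
      using eventually_index
    proof eventually_elim
      case (elim \<epsilon>)
      have "K \<subseteq> {l + 2 * \<delta> \<epsilon>..r - 2 * \<delta> \<epsilon>}" using \<eta>(2) elim(1) by fastforce
      then show ?case using w elim(2) by auto
    qed
  qed (use w in blast)+
qed

section \<open>Moderateness of solutions\<close>

lemma graph_moderate_upto:
  assumes "\<And>j. j \<in> Basis \<Longrightarrow> moderate_upto k J (\<lambda>\<epsilon> t. w \<epsilon> t \<bullet> j)"
    and "b \<in> (Basis :: (real \<times> 'b::euclidean_space) set)"
  shows "moderate_upto k J (\<lambda>\<epsilon> t. (t, w \<epsilon> t) \<bullet> b)"
  using assms(2) by (cases rule: Basis_prod_real_cases) (use assms(1) in \<open>auto simp: moderate_upto_ident\<close>)

lemma graph_compactly_inside: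
  assumes "open J" "open I" "J \<subseteq> I" "open U" "K \<subset>\<subset> J" "L \<subset>\<subset> U"
  shows "K \<times> L \<subset>\<subset> I \<times> U"
  using assms by (auto simp: compactly_inside_open open_Times intro!: compact_Times)

text \<open>
  Bootstrapping: if the derivatives of \<open>w\<close> up to order \<open>k\<close> are moderate, then so are those of
  \<open>F \<circ> (id, w)\<close>, hence of \<open>w'\<close>, as \<open>w'\<close> and \<open>F \<circ> (id, w)\<close> agree on compact sets for small indices.
\<close>

lemma ode_solution_moderate:
  fixes w :: "real \<Rightarrow> real \<Rightarrow> 'b::euclidean_space" and F :: "real \<Rightarrow> real \<times> 'b \<Rightarrow> 'b"
  assumes op: "open J" "open I" "J \<subseteq> I" "open U" and F: "F \<in> moderate_vec (I \<times> U)"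
    and smooth: "\<And>\<epsilon> j. \<epsilon> \<in> {0<..1} \<Longrightarrow> j \<in> Basis \<Longrightarrow> smooth_on J (\<lambda>t. w \<epsilon> t \<bullet> j)"
    and range: "\<forall>\<^sub>F \<epsilon> in at_right 0. w \<epsilon> ` J \<subseteq> U"
    and cb: "\<And>K. K \<subset>\<subset> J \<Longrightarrow> \<exists>L. L \<subset>\<subset> U \<and> (\<forall>\<^sub>F \<epsilon> in at_right 0. w \<epsilon> ` K \<subseteq> L)"
    and ode: "\<And>K. K \<subset>\<subset> J \<Longrightarrow> \<forall>\<^sub>F \<epsilon> in at_right 0. \<forall>t\<in>K. (w \<epsilon> has_vector_derivative F \<epsilon> (t, w \<epsilon> t)) (at t)"
  shows "w \<in> moderate_vec J"
proof -
  have V: "open (I \<times> U)" using op by (simp add: open_Times)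
  define g where "g \<epsilon> t = (t, w \<epsilon> t)" for \<epsilon> t
  define f where "f j = comp_net J (I \<times> U) (\<lambda>\<epsilon> p. F \<epsilon> p \<bullet> j) g" for j
  define r where "r j \<epsilon> t = partial_deriv 1 (\<lambda>t. w \<epsilon> t \<bullet> j) t - f j \<epsilon> t" for j \<epsilon> t
  have d: "((\<lambda>t. w \<epsilon> t \<bullet> j) has_real_derivative f j \<epsilon> t + r j \<epsilon> t) (at t)"
    if "\<epsilon> \<in> {0<..1}" "t \<in> J" "j \<in> Basis" for \<epsilon> t j
    using smooth_on_line_derivative[OF smooth[OF that(1,3)], of 1 0 t] that(2) by (simp add: r_def)
  have r: "r j \<in> moderate J" if j: "j \<in> Basis" for j
  proof (rule eventually_eq_imp_moderate[OF op(1)])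
    fix \<epsilon> :: real assume \<epsilon>: "\<epsilon> \<in> {0<..1}"
    have "smooth_on J (f j \<epsilon>)"
    proof (cases "g \<epsilon> ` J \<subseteq> I \<times> U")
      case True
      have "moderate_upto k J (\<lambda>_ t. F \<epsilon> (g \<epsilon> t) \<bullet> j)" for k
      proof (rule moderate_upto_compose[OF op(1) V])
        show "smooth_on (I \<times> U) (\<lambda>p. F \<epsilon> p \<bullet> j)"
          using moderate_imp_smooth_on[OF moderate_vecD[OF F j] \<epsilon>] .
        show "moderate_upto k J (\<lambda>_ t. g \<epsilon> t \<bullet> b)" if "b \<in> Basis" for b
          unfolding g_def using smooth[OF \<epsilon>] smooth_on_line_iff[OF op(1)] that
          by (intro graph_moderate_upto[where w = "\<lambda>_. w \<epsilon>"]) auto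
      qed (rule True)
      then have "smooth_on J (\<lambda>t. F \<epsilon> (g \<epsilon> t) \<bullet> j)" by (simp add: smooth_on_line_iff[OF op(1)])
      then show ?thesis using True by (simp add: f_def comp_net_def)
    next
      case False
      then have "f j \<epsilon> = (\<lambda>t. 0)" by (auto simp: f_def comp_net_def)
      then show ?thesis using smooth_on_line_const[OF op(1), of 0] by simp
    qed
    then show "smooth_on J (r j \<epsilon>)"
      unfolding r_def using smooth_on_partial_deriv[OF smooth[OF \<epsilon> j], of 1]
      by (intro smooth_on_line_diff[OF op(1)]) auto
  next
    show "(\<lambda>_ _. 0) \<in> moderate J"
      by (simp add: moderate_iff_moderate_upto[OF op(1)] moderate_upto_real)
    fix K assume K: "K \<subset>\<subset> J"
    then have "K \<subseteq> J" using op(1) by (simp add: compactly_inside_open)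
    show "\<forall>\<^sub>F \<epsilon> in at_right 0. \<forall>t\<in>K. r j \<epsilon> t = 0"
      using ode[OF K] range eventually_index
    proof eventually_elim
      case (elim \<epsilon>)
      show ?case
      proof
        fix t assume t: "t \<in> K"
        have "((\<lambda>t. w \<epsilon> t \<bullet> j) has_real_derivative F \<epsilon> (t, w \<epsilon> t) \<bullet> j) (at t)"
          using elim(1) t j by (simp add: has_vector_derivative_componentwise)
        moreover have "((\<lambda>t. w \<epsilon> t \<bullet> j) has_real_derivative f j \<epsilon> t + r j \<epsilon> t) (at t)"
          using d[of \<epsilon> t j] elim(3) t \<open>K \<subseteq> J\<close> j by auto
        ultimately have "F \<epsilon> (t, w \<epsilon> t) \<bullet> j = f j \<epsilon> t + r j \<epsilon> t" by (rule DERIV_unique)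
        moreover have "f j \<epsilon> t = F \<epsilon> (t, w \<epsilon> t) \<bullet> j"
          using elim(2) op(3) by (auto simp: f_def comp_net_def g_def)
        ultimately show "r j \<epsilon> t = 0" by simp
      qed
    qed
  qed
  have bound: "moderate_on K (\<lambda>\<epsilon> t. w \<epsilon> t \<bullet> j)" if K: "K \<subset>\<subset> J" and j: "j \<in> Basis" for K j
  proof -
    obtain L where L: "L \<subset>\<subset> U" "\<forall>\<^sub>F \<epsilon> in at_right 0. w \<epsilon> ` K \<subseteq> L" using cb[OF K] by blast
    obtain C where C: "\<forall>x\<in>L. norm x \<le> C"
      using compact_imp_bounded[of L] L(1) by (auto simp: compactly_inside_def bounded_iff)
    have "\<forall>\<^sub>F \<epsilon> in at_right 0. \<forall>t\<in>K. norm (w \<epsilon> t \<bullet> j) \<le> C"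
      using L(2)
    proof eventually_elim
      case (elim \<epsilon>)
      then show ?case using C Basis_le_norm[OF j] unfolding real_norm_def
        by (meson image_subset_iff order_trans)
    qed
    then show ?thesis by (rule moderate_on_bounded)
  qed
  have "\<forall>j\<in>Basis. moderate_upto k J (\<lambda>\<epsilon> t. w \<epsilon> t \<bullet> j)" for k
  proof (induction k)
    case 0
    then show ?case using bound smooth_on_imp_continuous_on[OF smooth] by auto
  next
    case (Suc k)
    show ?case
    proof
      fix j :: 'b assume j: "j \<in> Basis"
      have "moderate_upto k J (f j)"
        unfolding f_def
      proof (rule moderate_upto_comp_net[OF op(1) V moderate_vecD[OF F j]])
        show "moderate_upto k J (\<lambda>\<epsilon> t. g \<epsilon> t \<bullet> b)" if "b \<in> Basis" for b
          unfolding g_def using Suc.IH that by (intro graph_moderate_upto) auto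
        fix K assume K: "K \<subset>\<subset> J"
        obtain L where L: "L \<subset>\<subset> U" "\<forall>\<^sub>F \<epsilon> in at_right 0. w \<epsilon> ` K \<subseteq> L" using cb[OF K] by blast
        have "\<forall>\<^sub>F \<epsilon> in at_right 0. g \<epsilon> ` K \<subseteq> K \<times> L"
          using L(2) by eventually_elim (auto simp: g_def)
        then show "\<exists>L. L \<subset>\<subset> I \<times> U \<and> (\<forall>\<^sub>F \<epsilon> in at_right 0. g \<epsilon> ` K \<subseteq> L)"
          using graph_compactly_inside[OF op K L(1)] by blast
      qed
      then have "moderate_upto k J (\<lambda>\<epsilon> t. f j \<epsilon> t + r j \<epsilon> t)"
        using r[OF j] op(1) by (intro moderate_upto_add) (auto simp: moderate_iff_moderate_upto)
      then show "moderate_upto (Suc k) J (\<lambda>\<epsilon> t. w \<epsilon> t \<bullet> j)"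
        using d bound j by (intro moderate_upto_SucI[where f' = "\<lambda>\<epsilon> t. f j \<epsilon> t + r j \<epsilon> t"]) auto
    qed
  qed
  then show ?thesis by (simp add: moderate_vec_def moderate_iff_moderate_upto[OF op(1)])
qed

section \<open>The initial value problem in terms of representatives\<close>

lemma negligible_on_cong:
  assumes "\<forall>\<^sub>F \<epsilon> in at_right 0. \<forall>x\<in>K. f \<epsilon> x = g \<epsilon> x"
  shows "negligible_on K f \<longleftrightarrow> negligible_on K g"
  using assms by (auto intro: negligible_on_le elim!: eventually_mono)

lemma moderate_cong:
  fixes J :: "real set"
  assumes "open J" "f \<in> moderate J" "\<And>\<epsilon> t. \<epsilon> \<in> {0<..1} \<Longrightarrow> t \<in> J \<Longrightarrow> g \<epsilon> t = f \<epsilon> t"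
  shows "g \<in> moderate J"
proof (rule eventually_eq_imp_moderate[OF assms(1) _ assms(2)])
  show "smooth_on J (g \<epsilon>)" if "\<epsilon> \<in> {0<..1}" for \<epsilon>
    by (rule smooth_on_cong[OF assms(1) moderate_imp_smooth_on[OF assms(2) that]]) (use assms(3) that in auto)
  fix K assume "K \<subset>\<subset> J"
  then have "K \<subseteq> J" using assms(1) by (simp add: compactly_inside_open)
  then show "\<forall>\<^sub>F \<epsilon> in at_right 0. \<forall>t\<in>K. g \<epsilon> t = f \<epsilon> t"
    using eventually_index by (auto elim!: eventually_mono intro!: assms(3))
qed

lemma moderate_vec_derivative:
  fixes w :: "real \<Rightarrow> real \<Rightarrow> 'b::euclidean_space"
  assumes "w \<in> moderate_vec J" "\<epsilon> \<in> {0<..1}" "t \<in> J"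
  shows "(w \<epsilon> has_vector_derivative partial_deriv 1 (w \<epsilon>) t) (at t)"
    and "j \<in> Basis \<Longrightarrow> partial_deriv 1 (w \<epsilon>) t \<bullet> j = partial_deriv 1 (\<lambda>t. w \<epsilon> t \<bullet> j) t"
  using smooth_on_vector_derivative[of J "w \<epsilon>" t] moderate_imp_smooth_on[OF moderate_vecD[OF assms(1)] assms(2)] assms(3)
  by blast+

lemma partial_deriv_moderate_vec:
  fixes w :: "real \<Rightarrow> real \<Rightarrow> 'b::euclidean_space"
  assumes "open J" "w \<in> moderate_vec J"
  shows "(\<lambda>\<epsilon>. partial_deriv 1 (w \<epsilon>)) \<in> moderate_vec J"
  unfolding moderate_vec_def
proof safe
  fix j :: 'b assume j: "j \<in> Basis"
  show "(\<lambda>\<epsilon> t. partial_deriv 1 (w \<epsilon>) t \<bullet> j) \<in> moderate J"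
    by (rule moderate_cong[OF assms(1) moderate_partial_deriv[OF moderate_vecD[OF assms(2) j], of 1]])
       (use moderate_vec_derivative(2)[OF assms(2)] j in auto)
qed

lemma partial_deriv_gf_rel:
  fixes w z :: "real \<Rightarrow> real \<Rightarrow> 'b::euclidean_space"
  assumes "open J" "(w, z) \<in> gf_rel J"
  shows "((\<lambda>\<epsilon>. partial_deriv 1 (w \<epsilon>)), (\<lambda>\<epsilon>. partial_deriv 1 (z \<epsilon>))) \<in> gf_rel J"
proof -
  have wz: "w \<in> moderate_vec J" "z \<in> moderate_vec J"
    "\<And>K. K \<subset>\<subset> J \<Longrightarrow> negligible_on K (\<lambda>\<epsilon> t. w \<epsilon> t - z \<epsilon> t)"
    using assms by (auto simp: gf_rel_line_iff)
  have "negligible_on K (\<lambda>\<epsilon> t. (partial_deriv 1 (w \<epsilon>) t - partial_deriv 1 (z \<epsilon>) t) \<bullet> j)"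
    if K: "K \<subset>\<subset> J" and j: "j \<in> Basis" for K j
  proof -
    define f where "f \<epsilon> t = (w \<epsilon> t - z \<epsilon> t) \<bullet> j" for \<epsilon> t
    have "f \<in> moderate J"
      using moderate_diff[OF assms(1) moderate_vecD[OF wz(1) j] moderate_vecD[OF wz(2) j]]
      by (simp add: f_def[abs_def] inner_diff_left)
    moreover have "negligible_on K' f" if "K' \<subset>\<subset> J" for K'
      using wz(3)[OF that] j negligible_on_componentwise[of K' "\<lambda>\<epsilon> t. w \<epsilon> t - z \<epsilon> t"] unfolding f_def by blast
    ultimately have neg: "negligible_on K (\<lambda>\<epsilon>. partial_deriv 1 (f \<epsilon>))"
      using negligible_derivative[OF assms(1) _ _ K] by blast
    have "partial_deriv 1 (f \<epsilon>) t = (partial_deriv 1 (w \<epsilon>) t - partial_deriv 1 (z \<epsilon>) t) \<bullet> j"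
      if "\<epsilon> \<in> {0<..1}" "t \<in> J" for \<epsilon> t
    proof -
      have "((\<lambda>t. w \<epsilon> t - z \<epsilon> t) has_vector_derivative partial_deriv 1 (w \<epsilon>) t - partial_deriv 1 (z \<epsilon>) t) (at t)"
        by (intro has_vector_derivative_diff moderate_vec_derivative[OF wz(1) that] moderate_vec_derivative[OF wz(2) that])
      then have "(f \<epsilon> has_real_derivative (partial_deriv 1 (w \<epsilon>) t - partial_deriv 1 (z \<epsilon>) t) \<bullet> j) (at t)"
        using j unfolding has_vector_derivative_componentwise f_def by blast
      then show ?thesis by (simp add: partial_deriv_real DERIV_imp_deriv)
    qed
    moreover have "K \<subseteq> J" using K assms(1) by (simp add: compactly_inside_open)
    ultimately have "\<forall>\<^sub>F \<epsilon> in at_right 0. \<forall>t\<in>K. norm ((partial_deriv 1 (w \<epsilon>) t - partial_deriv 1 (z \<epsilon>) t) \<bullet> j)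
        \<le> norm (partial_deriv 1 (f \<epsilon>) t)"
      using eventually_index by (auto elim!: eventually_mono)
    then show ?thesis by (rule negligible_on_le[OF neg])
  qed
  then show ?thesis
    unfolding gf_rel_line_iff[OF assms(1)]
    using partial_deriv_moderate_vec[OF assms(1)] wz
      negligible_on_componentwise[of _ "\<lambda>\<epsilon> t. partial_deriv 1 (w \<epsilon>) t - partial_deriv 1 (z \<epsilon>) t"]
    by blast
qed

lemma graph_moderate_vec:
  fixes w :: "real \<Rightarrow> real \<Rightarrow> 'b::euclidean_space"
  assumes "open J" "w \<in> moderate_vec J"
  shows "(\<lambda>\<epsilon> t. (t, w \<epsilon> t)) \<in> moderate_vec J"
  using assms graph_moderate_upto[of _ J w]
  by (simp add: moderate_vec_def moderate_iff_moderate_upto)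

lemma graph_gf_rel:
  fixes w z :: "real \<Rightarrow> real \<Rightarrow> 'b::euclidean_space"
  assumes "open J" "(w, z) \<in> gf_rel J"
  shows "((\<lambda>\<epsilon> t. (t, w \<epsilon> t)), (\<lambda>\<epsilon> t. (t, z \<epsilon> t))) \<in> gf_rel J"
proof -
  have "negligible_on K (\<lambda>\<epsilon> t. (t, w \<epsilon> t) - (t, z \<epsilon> t))" if "K \<subset>\<subset> J" for K
    using gf_rel_imp_negligible_on[OF assms(2) that] by (simp add: negligible_on_def norm_prod_def)
  then show ?thesis using assms graph_moderate_vec[OF assms(1)] by (auto simp: gf_rel_line_iff)
qed

lemma graph_c_bounded:
  fixes w :: "real \<Rightarrow> real \<Rightarrow> 'b::euclidean_space"
  assumes "open J" "open I" "J \<subseteq> I" "open U" "c_bounded J U w"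
  shows "c_bounded J (I \<times> U) (\<lambda>\<epsilon> t. (t, w \<epsilon> t))"
  unfolding c_bounded_iff
proof (intro conjI allI impI)
  show "(\<lambda>\<epsilon> t. (t, w \<epsilon> t)) \<in> moderate_vec J"
    using assms by (intro graph_moderate_vec) (auto simp: c_bounded_iff)
  have "\<forall>\<^sub>F \<epsilon> in at_right 0. w \<epsilon> ` J \<subseteq> U" using assms(5) by (simp add: c_bounded_iff)
  then show "\<forall>\<^sub>F \<epsilon> in at_right 0. (\<lambda>t. (t, w \<epsilon> t)) ` J \<subseteq> I \<times> U"
    by eventually_elim (use assms(3) in auto)
  fix K assume K: "K \<subset>\<subset> J"
  obtain L where L: "L \<subset>\<subset> U" "\<forall>\<^sub>F \<epsilon> in at_right 0. w \<epsilon> ` K \<subseteq> L"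
    using assms(5) K unfolding c_bounded_iff by blast
  have "\<forall>\<^sub>F \<epsilon> in at_right 0. (\<lambda>t. (t, w \<epsilon> t)) ` K \<subseteq> K \<times> L"
    using L(2) by eventually_elim auto
  then show "\<exists>L. L \<subset>\<subset> I \<times> U \<and> (\<forall>\<^sub>F \<epsilon> in at_right 0. (\<lambda>t. (t, w \<epsilon> t)) ` K \<subseteq> L)"
    using graph_compactly_inside[OF assms(1-4) K L(1)] by blast
qed

text \<open>
  Both sides of the differential equation are unions over representatives. All of these give the same
  class, so the equation can be tested with a single representative.
\<close>

lemma differential_equation_iff:
  fixes w :: "real \<Rightarrow> real \<Rightarrow> 'b::euclidean_space"
  assumes op: "open J" "open I" "J \<subseteq> I" "open U" and F: "F \<in> colombeau (I \<times> U)" "F' \<in> F"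
    and X: "X \<in> colombeau J" "w \<in> X" "c_bounded J U w"
  shows "gf_partial 1 J X = gf_comp J (I \<times> U) F (gf_graph J X) \<longleftrightarrow>
    (\<forall>K. K \<subset>\<subset> J \<longrightarrow> negligible_on K (\<lambda>\<epsilon> t. partial_deriv 1 (w \<epsilon>) t - F' \<epsilon> (t, w \<epsilon> t)))"
proof -
  have V: "open (I \<times> U)" using op by (simp add: open_Times)
  define g where "g = (\<lambda>\<epsilon> t. (t, w \<epsilon> t))"
  define dw where "dw = (\<lambda>\<epsilon>. partial_deriv 1 (w \<epsilon>))"
  have w: "w \<in> moderate_vec J" and Xw: "X = gf_class J w"
    using colombeau_classE[OF op(1) X(1,2)] by auto
  have rel: "(w, z) \<in> gf_rel J" if "z \<in> X" for z using that Xw by (auto simp: gf_class_def)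
  have g: "c_bounded J (I \<times> U) g" unfolding g_def by (rule graph_c_bounded[OF op X(3)])
  have graph: "gf_graph J X = gf_class J g"
    unfolding gf_graph_def g_def using X(2) rel graph_gf_rel[OF op(1)]
    by (intro UN_gf_class[OF op(1)]) auto
  have partial: "gf_partial 1 J X = gf_class J dw"
    unfolding gf_partial_def dw_def using X(2) rel partial_deriv_gf_rel[OF op(1)]
    by (intro UN_gf_class[OF op(1)]) auto
  have F': "F' \<in> moderate_vec (I \<times> U)" by (rule colombeau_class_rel[OF F F(2)])
  define A where "A = {g' \<in> gf_class J g. c_bounded J (I \<times> U) g'}"
  have "g \<in> A" using gf_class_self[OF op(1) c_bounded_moderate_vec[OF g]] g by (simp add: A_def)
  have eq: "gf_class J (comp_net J (I \<times> U) v g') = gf_class J (comp_net J (I \<times> U) F' g)"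
    if v: "v \<in> F" and g': "g' \<in> A" for v g'
  proof (rule gf_class_eqI[OF op(1) gf_rel_line_sym[OF op(1)]])
    have "(g, g') \<in> gf_rel J" "c_bounded J (I \<times> U) g'" using g' by (auto simp: A_def gf_class_def)
    then show "(comp_net J (I \<times> U) F' g, comp_net J (I \<times> U) v g') \<in> gf_rel J"
      using colombeau_class_rel[OF F(1) F(2) v] g by (intro comp_net_cong[OF op(1) V]) auto
  qed
  have comp: "gf_comp J (I \<times> U) F (gf_graph J X) = gf_class J (comp_net J (I \<times> U) F' g)"
    unfolding gf_comp_def graph A_def[symmetric] using eq F(2) \<open>g \<in> A\<close> by blast
  have mod: "dw \<in> moderate_vec J" "comp_net J (I \<times> U) F' g \<in> moderate_vec J"
    using partial_deriv_moderate_vec[OF op(1) w] comp_net_moderate_vec[OF op(1) V F' g] by (auto simp: dw_def)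
  have "gf_partial 1 J X = gf_comp J (I \<times> U) F (gf_graph J X) \<longleftrightarrow> (dw, comp_net J (I \<times> U) F' g) \<in> gf_rel J"
    unfolding partial comp using gf_class_eqI[OF op(1)] gf_class_self[OF op(1) mod(2)] by (auto simp: gf_class_def)
  also have "\<dots> \<longleftrightarrow> (\<forall>K. K \<subset>\<subset> J \<longrightarrow> negligible_on K (\<lambda>\<epsilon> t. dw \<epsilon> t - comp_net J (I \<times> U) F' g \<epsilon> t))"
    using mod by (simp add: gf_rel_line_iff[OF op(1)])
  also have "\<dots> \<longleftrightarrow> (\<forall>K. K \<subset>\<subset> J \<longrightarrow> negligible_on K (\<lambda>\<epsilon> t. partial_deriv 1 (w \<epsilon>) t - F' \<epsilon> (t, w \<epsilon> t)))"
  proof -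
    have "\<forall>\<^sub>F \<epsilon> in at_right 0. g \<epsilon> ` J \<subseteq> I \<times> U" using g by (simp add: c_bounded_iff)
    then have ev: "\<forall>\<^sub>F \<epsilon> in at_right 0. \<forall>t\<in>K.
        dw \<epsilon> t - comp_net J (I \<times> U) F' g \<epsilon> t = partial_deriv 1 (w \<epsilon>) t - F' \<epsilon> (t, w \<epsilon> t)" for K
      by eventually_elim (auto simp: comp_net_def dw_def g_def)
    have "negligible_on K (\<lambda>\<epsilon> t. dw \<epsilon> t - comp_net J (I \<times> U) F' g \<epsilon> t) \<longleftrightarrow>
        negligible_on K (\<lambda>\<epsilon> t. partial_deriv 1 (w \<epsilon>) t - F' \<epsilon> (t, w \<epsilon> t))" for K
      by (rule negligible_on_cong[OF ev])
    then show ?thesis by simp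
  qed
  finally show ?thesis .
qed

lemma gp_netsI:
  assumes "\<And>\<epsilon>. \<epsilon> \<in> {0<..1} \<Longrightarrow> x \<epsilon> \<in> U" "\<forall>\<^sub>F \<epsilon> in at_right 0. norm (x \<epsilon>) \<le> C"
  shows "x \<in> gp_nets U"
proof -
  have "(\<lambda>\<epsilon>. norm (x \<epsilon>)) \<in> O[at_right 0](\<lambda>\<epsilon>. inverse (\<epsilon> ^ 0))"
    by (rule landau_o.bigI[of "max C 1"]) (use assms(2) in \<open>auto elim!: eventually_mono\<close>)
  then show ?thesis using assms(1) unfolding gp_nets_def by blast
qed

lemma near_standard_gp_in:
  assumes "near_standard I X p" "s \<in> gp_in J X"
  shows "(s \<longlongrightarrow> p) (at_right 0)" and "s' \<in> gp_in J X \<Longrightarrow> gp_equiv s s'"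
proof -
  have X: "X \<in> gen_points I" using assms(1) by (simp add: near_standard_def gen_points_c_def)
  obtain x where x: "x \<in> X" "(x \<longlongrightarrow> p) (at_right 0)" using assms(1) by (auto simp: near_standard_def)
  have equiv: "gp_equiv x s" if s: "s \<in> gp_in J X" for s
  proof -
    obtain x' where "x' \<in> X" "gp_equiv x' s" using s by (auto simp: gp_in_def)
    moreover have "gp_equiv x x'" using gen_points_classE(1)[OF X x(1)] \<open>x' \<in> X\<close> by blast
    ultimately show ?thesis by (blast intro: gp_equiv_trans)
  qed
  show "(s \<longlongrightarrow> p) (at_right 0)" using gp_equiv_tendsto[OF equiv[OF assms(2)] x(2)] .
  show "gp_equiv s s'" if "s' \<in> gp_in J X"
    using equiv[OF assms(2)] equiv[OF that] by (blast intro: gp_equiv_trans gp_equiv_sym)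
qed

lemma gp_in_nonempty:
  assumes "near_standard I X p" "open J" "p \<in> J"
  obtains s where "s \<in> gp_in J X"
proof -
  obtain x where x: "x \<in> X" "(x \<longlongrightarrow> p) (at_right 0)" using assms(1) by (auto simp: near_standard_def)
  define s where "s \<epsilon> = (if x \<epsilon> \<in> J then x \<epsilon> else p)" for \<epsilon>
  have "\<forall>\<^sub>F \<epsilon> in at_right 0. x \<epsilon> \<in> J" using topological_tendstoD[OF x(2) assms(2,3)] .
  then have equiv: "gp_equiv x s" by (intro gp_equiv_cong) (auto elim!: eventually_mono simp: s_def)
  have "\<forall>\<^sub>F \<epsilon> in at_right 0. norm (s \<epsilon>) < norm p + 1"
    by (rule order_tendstoD(2)[OF tendsto_norm[OF gp_equiv_tendsto[OF equiv x(2)]]]) simp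
  then have "s \<in> gp_nets J"
    using assms(3) by (intro gp_netsI[of s J "norm p + 1"]) (auto elim!: eventually_mono simp: s_def)
  then show thesis using that equiv x(1) by (auto simp: gp_in_def)
qed

text \<open>
  Point values depend neither on the representative of the function nor on that of the point, since the
  latter stays in a compact neighbourhood of \<open>p\<close> for small indices.
\<close>

lemma initial_condition_iff:
  fixes w :: "real \<Rightarrow> real \<Rightarrow> 'b::euclidean_space"
  assumes J: "open J" "p \<in> J" and X: "X \<in> colombeau J" "w \<in> X" "c_bounded J U w"
    and "near_standard I T p" "\<tau> \<in> gp_in J T" and Y: "Y \<in> gen_points U" "y \<in> Y"
  shows "gp_in U (point_value X (gp_in J T)) = Y \<longleftrightarrow> gp_equiv (\<lambda>\<epsilon>. w \<epsilon> (\<tau> \<epsilon>)) y"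
proof -
  obtain \<rho> where \<rho>: "\<rho> > 0" "cball p \<rho> \<subseteq> J" using J open_contains_cball by blast
  define K where "K = cball p \<rho>"
  have K: "K \<subset>\<subset> J" using \<rho> J by (simp add: K_def compactly_inside_open)
  have inK: "\<forall>\<^sub>F \<epsilon> in at_right 0. s \<epsilon> \<in> K" if "s \<in> gp_in J T" for s
  proof -
    have "\<forall>\<^sub>F \<epsilon> in at_right 0. s \<epsilon> \<in> ball p \<rho>"
      using topological_tendstoD[OF near_standard_gp_in(1)[OF assms(6) that] open_ball] \<rho>(1) by simp
    then show ?thesis by (auto elim!: eventually_mono simp: K_def)
  qed
  have w: "w \<in> moderate_vec J" and Xw: "X = gf_class J w"
    using colombeau_classE[OF J(1) X(1,2)] by auto
  have val: "gp_equiv (\<lambda>\<epsilon>. w \<epsilon> (\<tau> \<epsilon>)) (\<lambda>\<epsilon>. z \<epsilon> (s \<epsilon>))" if z: "z \<in> X" and s: "s \<in> gp_in J T" for z s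
  proof (rule gp_equiv_trans)
    have "negligible_on UNIV (\<lambda>\<epsilon> (_::unit). w \<epsilon> (\<tau> \<epsilon>) \<bullet> j - w \<epsilon> (s \<epsilon>) \<bullet> j)" if j: "j \<in> Basis" for j
    proof (rule negligible_on_moderate_diff[OF J(1) moderate_vecD[OF w j] K])
      show "\<forall>\<^sub>F \<epsilon> in at_right 0. \<forall>_\<in>(UNIV::unit set). s \<epsilon> \<in> K" using inK[OF s] by simp
      show "negligible_on UNIV (\<lambda>\<epsilon> (_::unit). \<tau> \<epsilon> - s \<epsilon>)"
        using near_standard_gp_in(2)[OF assms(6,7) s] by (simp add: gp_equiv_iff)
    qed
    then show "gp_equiv (\<lambda>\<epsilon>. w \<epsilon> (\<tau> \<epsilon>)) (\<lambda>\<epsilon>. w \<epsilon> (s \<epsilon>))"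
      unfolding gp_equiv_iff negligible_on_componentwise[of UNIV "\<lambda>\<epsilon> (_::unit). w \<epsilon> (\<tau> \<epsilon>) - w \<epsilon> (s \<epsilon>)"]
      by (simp add: inner_diff_left)
    have "negligible_on K (\<lambda>\<epsilon> t. w \<epsilon> t - z \<epsilon> t)"
      using z Xw gf_rel_imp_negligible_on[OF _ K] by (auto simp: gf_class_def)
    then show "gp_equiv (\<lambda>\<epsilon>. w \<epsilon> (s \<epsilon>)) (\<lambda>\<epsilon>. z \<epsilon> (s \<epsilon>))"
      unfolding gp_equiv_iff negligible_on_def
      using inK[OF s] by (auto elim: eventually_elim2)
  qed
  obtain L where L: "L \<subset>\<subset> U" "\<forall>\<^sub>F \<epsilon> in at_right 0. w \<epsilon> ` K \<subseteq> L" using X(3) K unfolding c_bounded_iff by blast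
  obtain C where C: "\<forall>x\<in>L. norm x \<le> C"
    using compact_imp_bounded[of L] L(1) by (auto simp: compactly_inside_def bounded_iff)
  have "\<forall>\<^sub>F \<epsilon> in at_right 0. norm (w \<epsilon> (\<tau> \<epsilon>)) \<le> C"
    using L(2) inK[OF assms(7)] by eventually_elim (use C in blast)
  then have "(\<lambda>\<epsilon>. w \<epsilon> (\<tau> \<epsilon>)) \<in> gp_nets UNIV" by (intro gp_netsI) auto
  then have mem: "(\<lambda>\<epsilon>. w \<epsilon> (\<tau> \<epsilon>)) \<in> point_value X (gp_in J T)"
    using X(2) assms(7) gp_equiv_refl unfolding point_value_def gp_class_def gp_rel_def by blast
  have "gp_equiv (\<lambda>\<epsilon>. w \<epsilon> (\<tau> \<epsilon>)) x" if "x \<in> point_value X (gp_in J T)" for x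
    using that val unfolding point_value_def gp_class_def gp_rel_def by (blast intro: gp_equiv_trans)
  with mem have eq: "gp_in U (point_value X (gp_in J T)) = {x \<in> gp_nets U. gp_equiv (\<lambda>\<epsilon>. w \<epsilon> (\<tau> \<epsilon>)) x}"
    unfolding gp_in_def by (blast intro: gp_equiv_trans)
  show ?thesis
    unfolding eq using gen_points_classE[OF Y] by (blast intro: gp_equiv_trans gp_equiv_sym gp_equiv_refl)
qed

section \<open>A priori estimates\<close>

lemma closed_segment_real_dist:
  fixes s \<tau> t :: real
  shows "s \<in> closed_segment \<tau> t \<Longrightarrow> \<bar>s - \<tau>\<bar> \<le> \<bar>t - \<tau>\<bar>"
    "s \<in> closed_segment \<tau> t \<Longrightarrow> closed_segment \<tau> s \<subseteq> closed_segment \<tau> t"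
    "s \<in> closed_segment \<tau> t \<Longrightarrow> \<bar>s - \<tau>\<bar> = \<bar>t - \<tau>\<bar> \<Longrightarrow> s = t"
  by (auto simp: closed_segment_eq_real_ivl split: if_splits)

text \<open>
  The bound on the velocity is available only inside the ball. At a time \<open>s\<close> closest to \<open>\<tau>\<close> at which
  the curve meets the sphere it has been inside the ball all the time, too short to reach the sphere.
\<close>

lemma exit_time_bound:
  fixes u :: "real \<Rightarrow> 'b::euclidean_space"
  assumes u: "\<And>s. s \<in> closed_segment \<tau> t \<Longrightarrow> (u has_vector_derivative du s) (at s)"
    and du: "\<And>s. s \<in> closed_segment \<tau> t \<Longrightarrow> norm (u s - x) \<le> \<beta> \<Longrightarrow> norm (du s) \<le> A"
    and init: "norm (u \<tau> - x) \<le> n" and "n + A * \<bar>t - \<tau>\<bar> < \<beta>" and "A \<ge> 0"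
  shows "norm (u t - x) \<le> n + A * \<bar>t - \<tau>\<bar>"
proof -
  define f where "f s = norm (u s - x)" for s
  have "continuous_on (closed_segment \<tau> t) u"
    by (rule continuous_at_imp_continuous_on) (use u has_vector_derivative_continuous in blast)
  then have cont: "continuous_on (closed_segment \<tau> t) f" unfolding f_def by (intro continuous_intros)
  have growth: "f s \<le> n + A * \<bar>s - \<tau>\<bar>"
    if s: "s \<in> closed_segment \<tau> t" and ball: "\<And>r. r \<in> closed_segment \<tau> s \<Longrightarrow> f r \<le> \<beta>" for s
  proof -
    have "norm (u s - u \<tau>) \<le> A * \<bar>s - \<tau>\<bar>"
      using closed_segment_real_dist(2)[OF s] u du ball
      by (intro linear_growth_bound[where d = du]) (auto simp: f_def)
    then show ?thesis
      using norm_triangle_ineq[of "u s - u \<tau>" "u \<tau> - x"] init by (simp add: f_def)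
  qed
  have less: "n + A * \<bar>s - \<tau>\<bar> < \<beta>" if "s \<in> closed_segment \<tau> t" for s
    using mult_left_mono[OF closed_segment_real_dist(1)[OF that] assms(5)] assms(4) by linarith
  have start: "f \<tau> < \<beta>" using init less[of \<tau>] by (simp add: f_def)
  have ivt: "\<exists>r\<in>closed_segment \<tau> s. f r = \<beta>" if s: "s \<in> closed_segment \<tau> t" "f s \<ge> \<beta>" for s
  proof -
    have "connected (f ` closed_segment \<tau> s)"
      using continuous_on_subset[OF cont closed_segment_real_dist(2)[OF s(1)]]
      by (intro connected_continuous_image connected_segment)
    then have "\<beta> \<in> f ` closed_segment \<tau> s"
      by (rule connectedD_interval[of _ "f \<tau>" "f s"]) (use start s(2) in auto)
    then show ?thesis by auto
  qed
  have "f s < \<beta>" if "s \<in> closed_segment \<tau> t" for s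
  proof (rule ccontr)
    assume "\<not> f s < \<beta>"
    define Z where "Z = {r \<in> closed_segment \<tau> t. f r = \<beta>}"
    have "Z \<noteq> {}" using ivt[OF that] \<open>\<not> f s < \<beta>\<close> closed_segment_real_dist(2)[OF that] by (auto simp: Z_def)
    moreover have "compact Z"
    proof -
      have "closed (closed_segment \<tau> t \<inter> f -` {\<beta>})"
        by (rule continuous_closed_preimage[OF cont]) auto
      moreover have "Z = closed_segment \<tau> t \<inter> (closed_segment \<tau> t \<inter> f -` {\<beta>})" by (auto simp: Z_def)
      ultimately show ?thesis by (metis compact_Int_closed compact_segment)
    qed
    moreover have "continuous_on Z (\<lambda>r. \<bar>r - \<tau>\<bar>)" by (intro continuous_intros)
    ultimately obtain r where r: "r \<in> Z" "\<And>q. q \<in> Z \<Longrightarrow> \<bar>r - \<tau>\<bar> \<le> \<bar>q - \<tau>\<bar>"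
      using continuous_attains_inf[of Z "\<lambda>r. \<bar>r - \<tau>\<bar>"] by blast
    have rt: "r \<in> closed_segment \<tau> t" "f r = \<beta>" using r(1) by (auto simp: Z_def)
    have "f q \<le> \<beta>" if q: "q \<in> closed_segment \<tau> r" for q
    proof (rule ccontr)
      assume "\<not> f q \<le> \<beta>"
      have qt: "q \<in> closed_segment \<tau> t" using q closed_segment_real_dist(2)[OF rt(1)] by blast
      obtain p where p: "p \<in> closed_segment \<tau> q" "f p = \<beta>" using ivt[OF qt] \<open>\<not> f q \<le> \<beta>\<close> by auto
      then have "p \<in> Z" using closed_segment_real_dist(2)[OF qt] by (auto simp: Z_def)
      then have "\<bar>p - \<tau>\<bar> = \<bar>q - \<tau>\<bar>"
        using r(2)[of p] closed_segment_real_dist(1)[OF p(1)] closed_segment_real_dist(1)[OF q] by linarith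
      then show False using closed_segment_real_dist(3)[OF p(1)] p(2) \<open>\<not> f q \<le> \<beta>\<close> by simp
    qed
    then show False using growth[OF rt(1)] less[OF rt(1)] rt(2) by force
  qed
  then show ?thesis using growth[of t] by (force simp: f_def)
qed

lemma exponential_comparison:
  fixes Y :: "real \<Rightarrow> real"
  assumes d: "\<And>s. s \<in> closed_segment \<tau> t \<Longrightarrow> (Y has_real_derivative dY s) (at s)"
    and bound: "\<And>s. s \<in> closed_segment \<tau> t \<Longrightarrow> \<bar>dY s\<bar> \<le> M * Y s"
  shows "Y t \<le> Y \<tau> * exp (M * \<bar>t - \<tau>\<bar>)"
proof (cases "\<tau> \<le> t")
  case True
  have "Y t * exp (- (M * (t - \<tau>))) \<le> Y \<tau> * exp (- (M * (\<tau> - \<tau>)))"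
  proof (rule DERIV_nonpos_imp_nonincreasing[OF True, where f = "\<lambda>s. Y s * exp (- (M * (s - \<tau>)))"])
    fix s assume "\<tau> \<le> s" "s \<le> t"
    then have s: "s \<in> closed_segment \<tau> t" using True by (simp add: closed_segment_eq_real_ivl)
    have "((\<lambda>s. Y s * exp (- (M * (s - \<tau>)))) has_real_derivative (dY s - M * Y s) * exp (- (M * (s - \<tau>)))) (at s)"
      using d[OF s] by (auto intro!: derivative_eq_intros simp: algebra_simps)
    moreover have "(dY s - M * Y s) * exp (- (M * (s - \<tau>))) \<le> 0"
      using bound[OF s] by (intro mult_nonpos_nonneg) auto
    ultimately show "\<exists>y. ((\<lambda>s. Y s * exp (- (M * (s - \<tau>)))) has_real_derivative y) (at s) \<and> y \<le> 0" by blast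
  qed
  moreover have "exp (- (M * (t - \<tau>))) * exp (M * \<bar>t - \<tau>\<bar>) = 1"
    using True by (simp flip: exp_add)
  ultimately show ?thesis
    using mult_right_mono[of "Y t * exp (- (M * (t - \<tau>)))" "Y \<tau>" "exp (M * \<bar>t - \<tau>\<bar>)"] by (simp add: mult.assoc)
next
  case False
  have "Y t * exp (M * (t - \<tau>)) \<le> Y \<tau> * exp (M * (\<tau> - \<tau>))"
  proof (rule DERIV_nonneg_imp_nondecreasing[where f = "\<lambda>s. Y s * exp (M * (s - \<tau>))"])
    show "t \<le> \<tau>" using False by simp
    fix s assume "t \<le> s" "s \<le> \<tau>"
    then have s: "s \<in> closed_segment \<tau> t" using False by (simp add: closed_segment_eq_real_ivl)
    have "((\<lambda>s. Y s * exp (M * (s - \<tau>))) has_real_derivative (dY s + M * Y s) * exp (M * (s - \<tau>))) (at s)"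
      using d[OF s] by (auto intro!: derivative_eq_intros simp: algebra_simps)
    moreover have "(dY s + M * Y s) * exp (M * (s - \<tau>)) \<ge> 0"
      using bound[OF s] by (intro mult_nonneg_nonneg) auto
    ultimately show "\<exists>y. ((\<lambda>s. Y s * exp (M * (s - \<tau>))) has_real_derivative y) (at s) \<and> 0 \<le> y" by blast
  qed
  moreover have "exp (M * (t - \<tau>)) * exp (M * \<bar>t - \<tau>\<bar>) = 1"
    using False by (simp flip: exp_add add: algebra_simps)
  ultimately show ?thesis
    using mult_right_mono[of "Y t * exp (M * (t - \<tau>))" "Y \<tau>" "exp (M * \<bar>t - \<tau>\<bar>)"] by (simp add: mult.assoc)
qed

text \<open>
  Gronwall's inequality, for the square of the norm because that is differentiable: its derivative
  \<open>2 (d \<bullet> d')\<close> is bounded by \<open>2 \<bar>d\<bar> (\<Lambda> \<bar>d\<bar> + n) \<le> (2 \<Lambda> + 1) (\<bar>d\<bar>\<^sup>2 + n\<^sup>2)\<close>.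
\<close>

lemma gronwall_bound:
  fixes d :: "real \<Rightarrow> 'b::euclidean_space"
  assumes d: "\<And>s. s \<in> closed_segment \<tau> t \<Longrightarrow> (d has_vector_derivative d' s) (at s)"
    and bound: "\<And>s. s \<in> closed_segment \<tau> t \<Longrightarrow> norm (d' s) \<le> \<Lambda> * norm (d s) + n" and "\<Lambda> \<ge> 0"
  shows "(norm (d t))\<^sup>2 \<le> ((norm (d \<tau>))\<^sup>2 + n\<^sup>2) * exp ((2 * \<Lambda> + 1) * \<bar>t - \<tau>\<bar>)"
proof -
  define Y where "Y s = d s \<bullet> d s + n\<^sup>2" for s
  have "Y t \<le> Y \<tau> * exp ((2 * \<Lambda> + 1) * \<bar>t - \<tau>\<bar>)"
  proof (rule exponential_comparison[where dY = "\<lambda>s. 2 * (d s \<bullet> d' s)"])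
    fix s assume s: "s \<in> closed_segment \<tau> t"
    have "((\<lambda>s. d s \<bullet> d s) has_derivative (\<lambda>h. d s \<bullet> (h *\<^sub>R d' s) + (h *\<^sub>R d' s) \<bullet> d s)) (at s)"
      using d[OF s] unfolding has_vector_derivative_def by (intro has_derivative_inner)
    then have "((\<lambda>s. d s \<bullet> d s) has_real_derivative 2 * (d s \<bullet> d' s)) (at s)"
      unfolding has_field_derivative_def
      by (rule has_derivative_eq_rhs) (auto simp: fun_eq_iff inner_commute algebra_simps)
    then show "(Y has_real_derivative 2 * (d s \<bullet> d' s)) (at s)"
      unfolding Y_def using DERIV_add[OF _ DERIV_const] by fastforce
    define x where "x = norm (d s)"
    have "\<bar>2 * (d s \<bullet> d' s)\<bar> \<le> 2 * (x * norm (d' s))"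
      using Cauchy_Schwarz_ineq2[of "d s" "d' s"] by (simp add: x_def abs_mult)
    also have "\<dots> \<le> 2 * (x * (\<Lambda> * x + n))"
      using bound[OF s] by (intro mult_left_mono) (auto simp: x_def)
    also have "\<dots> \<le> (2 * \<Lambda> + 1) * (x\<^sup>2 + n\<^sup>2)"
    proof -
      have "2 * x * n \<le> x\<^sup>2 + n\<^sup>2" using sum_squares_bound[of x n] .
      moreover have "0 \<le> 2 * \<Lambda> * n\<^sup>2" using \<open>\<Lambda> \<ge> 0\<close> by simp
      ultimately show ?thesis by (simp add: algebra_simps power2_eq_square)
    qed
    finally show "\<bar>2 * (d s \<bullet> d' s)\<bar> \<le> (2 * \<Lambda> + 1) * Y s"
      by (simp add: Y_def x_def power2_norm_eq_inner)
  qed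
  then show ?thesis by (simp add: Y_def power2_norm_eq_inner) (metis add_increasing2 le_add_same_cancel1 order_trans zero_le_power2 add.commute)
qed

section \<open>Existence, localization and uniqueness\<close>

text \<open>
  The values \<open>y \<epsilon>\<close> of the initial condition range over \<open>L\<close>, and a solution moves in the ball of radius \<open>\<beta>\<close>
  around \<open>y \<epsilon>\<close>. Assumptions on \<open>L + closure (ball 0 \<beta>)\<close> are therefore stated for the balls around the points of
  \<open>L\<close>, which in contrast to that sum are convex.
\<close>

locale ivp_setting =
  fixes I J :: "real set" and U L W :: "'b::euclidean_space set"
    and F :: "(real \<Rightarrow> real \<times> 'b \<Rightarrow> 'b) set" and F' :: "real \<Rightarrow> real \<times> 'b \<Rightarrow> 'b"
    and T :: "(real \<Rightarrow> real) set" and t\<^sub>0 :: real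
    and Y :: "(real \<Rightarrow> 'b) set" and y :: "real \<Rightarrow> 'b"
    and \<alpha> \<beta> a h \<epsilon>\<^sub>0 :: real
  assumes open_I: "open I" and open_U: "open U"
    and T: "near_standard I T t\<^sub>0"
    and Y: "Y \<in> gen_points U" "y \<in> Y"
    and F: "F \<in> colombeau (I \<times> U)" "F' \<in> F"
    and \<alpha>: "\<alpha> > 0" "{t\<^sub>0 - \<alpha>..t\<^sub>0 + \<alpha>} \<subseteq> I"
    and L: "compact L" "\<And>x. x \<in> L \<Longrightarrow> cball x \<beta> \<subseteq> U"
    and \<epsilon>\<^sub>0: "\<epsilon>\<^sub>0 \<in> {0<..1}" "\<And>\<epsilon>. \<epsilon> \<in> {0<..\<epsilon>\<^sub>0} \<Longrightarrow> y \<epsilon> \<in> L"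
    and \<beta>: "\<beta> > 0" and a: "a > 0"
    and bound: "\<And>\<epsilon> t x z. \<epsilon> \<in> {0<..\<epsilon>\<^sub>0} \<Longrightarrow> t \<in> {t\<^sub>0 - \<alpha>..t\<^sub>0 + \<alpha>} \<Longrightarrow> x \<in> L \<Longrightarrow> z \<in> cball x \<beta> \<Longrightarrow>
      norm (F' \<epsilon> (t, z)) \<le> a"
    and h_def: "h = min \<alpha> (\<beta> / a)"
    and J_def: "J = {t\<^sub>0 - h<..<t\<^sub>0 + h}" and W_def: "W = L + ball 0 \<beta>"
begin

lemma h_bounds: "h > 0" "h \<le> \<alpha>" "a * h \<le> \<beta>"
  using \<alpha> \<beta> a by (auto simp: h_def min_def field_simps)

lemma J_facts: "open J" "J \<subseteq> I" "t\<^sub>0 \<in> J" "J \<subseteq> {t\<^sub>0 - \<alpha>..t\<^sub>0 + \<alpha>}"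
proof -
  show "J \<subseteq> {t\<^sub>0 - \<alpha>..t\<^sub>0 + \<alpha>}" using h_bounds by (auto simp: J_def)
  then show "J \<subseteq> I" using \<alpha>(2) by blast
qed (use h_bounds in \<open>auto simp: J_def\<close>)

lemma F'_moderate: "F' \<in> moderate_vec (I \<times> U)"
  by (rule colombeau_class_rel(1)[OF F F(2)])

lemma W_iff: "z \<in> W \<longleftrightarrow> (\<exists>x\<in>L. norm (z - x) < \<beta>)"
proof
  assume "\<exists>x\<in>L. norm (z - x) < \<beta>"
  then obtain x where x: "x \<in> L" "norm (z - x) < \<beta>" by blast
  then have "z = x + (z - x)" "z - x \<in> ball 0 \<beta>" by auto
  then show "z \<in> W" unfolding W_def set_plus_def using x(1) by blast
next
  assume "z \<in> W"
  then obtain x b where "x \<in> L" "b \<in> ball 0 \<beta>" "z = x + b" by (auto simp: W_def set_plus_def)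
  then show "\<exists>x\<in>L. norm (z - x) < \<beta>" by (intro bexI[of _ x]) auto
qed

lemma W_facts: "open W" "W \<subseteq> U"
proof -
  have "W = (\<Union>x\<in>L. ball x \<beta>)" by (auto simp: W_iff dist_norm norm_minus_commute)
  then show "open W" by auto
  show "W \<subseteq> U" using L(2) by (force simp: W_iff dist_norm norm_minus_commute)
qed

lemma eventually_\<epsilon>\<^sub>0: "\<forall>\<^sub>F \<epsilon> in at_right 0. \<epsilon> \<in> {0<..\<epsilon>\<^sub>0}"
  using eventually_index_less[of \<epsilon>\<^sub>0] \<epsilon>\<^sub>0(1) by (auto elim!: eventually_mono)

lemma compact_in_J:
  assumes "K \<subset>\<subset> J"
  obtains \<eta> where "0 < \<eta>" "\<eta> < h" "K \<subseteq> {t\<^sub>0 - h + \<eta>..t\<^sub>0 + h - \<eta>}"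
proof -
  obtain \<eta> where \<eta>: "\<eta> > 0" "K \<subseteq> {t\<^sub>0 - h + \<eta>..t\<^sub>0 + h - \<eta>}"
    using compactly_inside_interval assms unfolding J_def by metis
  have "{t\<^sub>0 - h + \<eta>..t\<^sub>0 + h - \<eta>} \<subseteq> {t\<^sub>0 - h + min \<eta> (h / 2)..t\<^sub>0 + h - min \<eta> (h / 2)}" by auto
  from order_trans[OF \<eta>(2) this] show thesis
    by (rule that[rotated 2]) (use \<eta>(1) h_bounds(1) in \<open>auto simp: min_less_iff_disj\<close>)
qed

lemma interval_compactly_inside: "0 < \<eta> \<Longrightarrow> {t\<^sub>0 - h + \<eta>..t\<^sub>0 + h - \<eta>} \<subset>\<subset> J"
  using J_facts(1) by (simp add: compactly_inside_open) (auto simp: J_def)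

text \<open>
  Being within \<open>\<rho> < \<beta>\<close> of \<open>y \<epsilon>\<close> means to lie in \<open>L + cball 0 \<rho>\<close>, a compact subset of \<open>W\<close>.
\<close>

lemma c_bounded_WI:
  assumes w: "w \<in> moderate_vec J"
    and J': "\<forall>\<^sub>F \<epsilon> in at_right 0. \<forall>t\<in>J. norm (w \<epsilon> t - y \<epsilon>) < \<beta>"
    and K': "\<And>\<eta>. 0 < \<eta> \<Longrightarrow> \<eta> < h \<Longrightarrow> \<exists>\<rho><\<beta>. \<forall>\<^sub>F \<epsilon> in at_right 0.
      \<forall>t\<in>{t\<^sub>0 - h + \<eta>..t\<^sub>0 + h - \<eta>}. norm (w \<epsilon> t - y \<epsilon>) \<le> \<rho>"
  shows "c_bounded J W w"
  unfolding c_bounded_iff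
proof (intro conjI allI impI w)
  show "\<forall>\<^sub>F \<epsilon> in at_right 0. w \<epsilon> ` J \<subseteq> W"
    using J' eventually_\<epsilon>\<^sub>0 by eventually_elim (use \<epsilon>\<^sub>0(2) W_iff in blast)
  fix K assume "K \<subset>\<subset> J"
  then obtain \<eta> where \<eta>: "0 < \<eta>" "\<eta> < h" "K \<subseteq> {t\<^sub>0 - h + \<eta>..t\<^sub>0 + h - \<eta>}" by (rule compact_in_J)
  obtain \<rho> where \<rho>: "\<rho> < \<beta>" "\<forall>\<^sub>F \<epsilon> in at_right 0. \<forall>t\<in>{t\<^sub>0 - h + \<eta>..t\<^sub>0 + h - \<eta>}. norm (w \<epsilon> t - y \<epsilon>) \<le> \<rho>"
    using K'[OF \<eta>(1,2)] by blast
  define L' where "L' = {x + z | x z. x \<in> L \<and> z \<in> cball 0 \<rho>}"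
  have "compact L'" unfolding L'_def by (intro compact_sums L compact_cball)
  moreover have "L' \<subseteq> W" using \<rho>(1) by (force simp: L'_def W_iff)
  ultimately have "L' \<subset>\<subset> W" using W_facts(1) by (simp add: compactly_inside_open)
  moreover have "\<forall>\<^sub>F \<epsilon> in at_right 0. w \<epsilon> ` K \<subseteq> L'"
    using \<rho>(2) eventually_\<epsilon>\<^sub>0
  proof eventually_elim
    case (elim \<epsilon>)
    have "w \<epsilon> t \<in> L'" if "t \<in> K" for t
    proof -
      have "w \<epsilon> t = y \<epsilon> + (w \<epsilon> t - y \<epsilon>)" "w \<epsilon> t - y \<epsilon> \<in> cball 0 \<rho>"
        using elim(1) \<eta>(3) that by auto
      then show ?thesis unfolding L'_def using \<epsilon>\<^sub>0(2)[OF elim(2)] by blast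
    qed
    then show ?case by blast
  qed
  ultimately show "\<exists>L. L \<subset>\<subset> W \<and> (\<forall>\<^sub>F \<epsilon> in at_right 0. w \<epsilon> ` K \<subseteq> L)" by blast
qed

lemma c_bounded_W_imp_U: "c_bounded J W w \<Longrightarrow> c_bounded J U w"
  unfolding c_bounded_iff using W_facts open_U
  by (auto simp: compactly_inside_open elim!: eventually_mono) (meson order_trans)

lemma colombeau_cb_W_subset: "colombeau_cb J W \<subseteq> colombeau_cb J U"
  using c_bounded_W_imp_U by (auto simp: colombeau_cb_def)

lemma initial_time_near:
  assumes "\<tau> \<in> gp_in J T" "\<kappa> > 0"
  shows "\<forall>\<^sub>F \<epsilon> in at_right 0. \<bar>\<tau> \<epsilon> - t\<^sub>0\<bar> < \<kappa>"
  using tendstoD[OF near_standard_gp_in(1)[OF T assms(1)] assms(2)] by (simp add: dist_real_def)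

lemma ivp_solution_iff:
  assumes X: "X \<in> colombeau J" "w \<in> X" "c_bounded J U w" and \<tau>: "\<tau> \<in> gp_in J T"
  shows "ivp_solution I U F T Y J X \<longleftrightarrow>
    (\<forall>K. K \<subset>\<subset> J \<longrightarrow> negligible_on K (\<lambda>\<epsilon> t. partial_deriv 1 (w \<epsilon>) t - F' \<epsilon> (t, w \<epsilon> t))) \<and>
    gp_equiv (\<lambda>\<epsilon>. w \<epsilon> (\<tau> \<epsilon>)) y"
proof -
  have "X \<in> colombeau_cb J U" using X by (auto simp: colombeau_cb_def)
  then show ?thesis
    unfolding ivp_solution_def
    using differential_equation_iff[OF J_facts(1) open_I J_facts(2) open_U F X]
      initial_condition_iff[OF J_facts(1,3) X T \<tau> Y] by blast
qed

text \<open>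
  The net of exact solutions through \<open>(\<tau> \<epsilon>, y \<epsilon>)\<close> stays in the ball of radius \<open>\<beta>\<close> up to distance \<open>h\<close>
  from \<open>\<tau> \<epsilon>\<close>. Near one end of \<open>J\<close> the distance from \<open>\<tau> \<epsilon>\<close> exceeds \<open>h\<close> unless \<open>\<tau> \<epsilon> = t\<^sub>0\<close>, and the solution may leave \<open>W\<close> or
  cease to exist. It is cut off towards \<open>y \<epsilon>\<close> there.
\<close>

lemma solution_exists: "\<exists>X \<in> colombeau_cb J W. ivp_solution I U F T Y J X"
proof -
  obtain \<tau> where \<tau>: "\<tau> \<in> gp_in J T" using gp_in_nonempty[OF T J_facts(1,3)] by blast
  have \<tau>J: "\<tau> \<epsilon> \<in> J" if "\<epsilon> \<in> {0<..1}" for \<epsilon> using \<tau> that by (auto simp: gp_in_def gp_nets_def)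
  \<comment> \<open>points of \<open>S \<epsilon>\<close> have distance less than \<open>h\<close> from \<open>\<tau> \<epsilon>\<close>\<close>
  define \<delta> where "\<delta> \<epsilon> = \<bar>\<tau> \<epsilon> - t\<^sub>0\<bar> + \<epsilon>" for \<epsilon>
  define S where "S \<epsilon> = {t\<^sub>0 - h + \<delta> \<epsilon><..<t\<^sub>0 + h - \<delta> \<epsilon>}" for \<epsilon>
  have \<delta>: "\<delta> \<epsilon> > 0" if "\<epsilon> \<in> {0<..1}" for \<epsilon> using that by (auto simp: \<delta>_def)
  have "((\<lambda>\<epsilon>. \<bar>\<tau> \<epsilon> - t\<^sub>0\<bar> + \<epsilon>) \<longlongrightarrow> \<bar>t\<^sub>0 - t\<^sub>0\<bar> + 0) (at_right 0)"
    by (intro tendsto_add tendsto_rabs tendsto_diff tendsto_const tendsto_ident_at near_standard_gp_in(1)[OF T \<tau>])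
  then have \<delta>_lim: "(\<delta> \<longlongrightarrow> 0) (at_right 0)" by (simp add: \<delta>_def[abs_def])
  have time: "a * \<bar>t - \<tau> \<epsilon>\<bar> < \<beta>" "t \<in> J" if "t \<in> S \<epsilon>" "\<epsilon> > 0" for t \<epsilon>
  proof -
    have "\<bar>t - \<tau> \<epsilon>\<bar> < h" using that by (auto simp: S_def \<delta>_def)
    then have "a * \<bar>t - \<tau> \<epsilon>\<bar> < a * h" using a by simp
    then show "a * \<bar>t - \<tau> \<epsilon>\<bar> < \<beta>" using h_bounds(3) by linarith
    show "t \<in> J" using that by (auto simp: S_def \<delta>_def J_def)
  qed
  define good where "good \<epsilon> v \<longleftrightarrow> (\<forall>j\<in>Basis. smooth_on (S \<epsilon>) (\<lambda>t. v t \<bullet> j)) \<and> (\<epsilon> \<le> \<epsilon>\<^sub>0 \<longrightarrow> v (\<tau> \<epsilon>) = y \<epsilon> \<and>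
      (\<forall>t. norm (v t - y \<epsilon>) \<le> a * \<bar>t - \<tau> \<epsilon>\<bar>) \<and>
      (\<forall>t\<in>S \<epsilon>. (v has_vector_derivative F' \<epsilon> (t, v t)) (at t)))" for \<epsilon> v
  have "\<exists>v. good \<epsilon> v" if \<epsilon>: "\<epsilon> \<in> {0<..1}" for \<epsilon>
  proof (cases "\<epsilon> \<le> \<epsilon>\<^sub>0")
    case True
    then have e: "\<epsilon> \<in> {0<..\<epsilon>\<^sub>0}" using \<epsilon> by simp
    obtain v where v: "v (\<tau> \<epsilon>) = y \<epsilon>" "\<And>t. norm (v t - y \<epsilon>) \<le> a * \<bar>t - \<tau> \<epsilon>\<bar>"
      "\<And>t. t \<in> {t\<^sub>0 - \<alpha><..<t\<^sub>0 + \<alpha>} \<Longrightarrow> a * \<bar>t - \<tau> \<epsilon>\<bar> < \<beta> \<Longrightarrow> (v has_vector_derivative F' \<epsilon> (t, v t)) (at t)"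
      "\<And>j. j \<in> Basis \<Longrightarrow> smooth_on {t \<in> {t\<^sub>0 - \<alpha><..<t\<^sub>0 + \<alpha>}. a * \<bar>t - \<tau> \<epsilon>\<bar> < \<beta>} (\<lambda>t. v t \<bullet> j)"
    proof (rule smooth_solution_exists[OF open_I open_U, where f = "F' \<epsilon>" and c = "t\<^sub>0 - \<alpha>" and d = "t\<^sub>0 + \<alpha>"
          and \<beta> = \<beta> and a = a and x\<^sub>0 = "y \<epsilon>" and \<tau> = "\<tau> \<epsilon>"])
      show "smooth_on (I \<times> U) (\<lambda>p. F' \<epsilon> p \<bullet> j)" if "j \<in> Basis" for j
        using moderate_imp_smooth_on[OF moderate_vecD[OF F'_moderate that] \<epsilon>] .
      show "norm (F' \<epsilon> (t, x)) \<le> a" if "t \<in> {t\<^sub>0 - \<alpha>..t\<^sub>0 + \<alpha>}" "x \<in> cball (y \<epsilon>) \<beta>" for t x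
        using bound[OF e that(1) \<epsilon>\<^sub>0(2)[OF e] that(2)] .
      show "cball (y \<epsilon>) \<beta> \<subseteq> U" using L(2)[OF \<epsilon>\<^sub>0(2)[OF e]] .
    qed (use \<alpha> \<beta> in auto)
    have sub: "S \<epsilon> \<subseteq> {t \<in> {t\<^sub>0 - \<alpha><..<t\<^sub>0 + \<alpha>}. a * \<bar>t - \<tau> \<epsilon>\<bar> < \<beta>}"
    proof
      fix t assume "t \<in> S \<epsilon>"
      then have "a * \<bar>t - \<tau> \<epsilon>\<bar> < \<beta>" "t \<in> J" using time \<epsilon> by auto
      then show "t \<in> {t \<in> {t\<^sub>0 - \<alpha><..<t\<^sub>0 + \<alpha>}. a * \<bar>t - \<tau> \<epsilon>\<bar> < \<beta>}" using h_bounds(2) by (auto simp: J_def)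
    qed
    have "\<forall>t\<in>S \<epsilon>. (v has_vector_derivative F' \<epsilon> (t, v t)) (at t)" using v(3) sub by blast
    moreover have "\<forall>j\<in>Basis. smooth_on (S \<epsilon>) (\<lambda>t. v t \<bullet> j)" using v(4) smooth_on_subset[OF _ sub] by blast
    ultimately show ?thesis unfolding good_def using v(1,2) by blast
  next
    case False
    have "smooth_on (S \<epsilon>) (\<lambda>t. y \<epsilon> \<bullet> j)" for j
      by (rule smooth_on_line_const) (simp add: S_def)
    then show ?thesis unfolding good_def using False by (intro exI[of _ "\<lambda>t. y \<epsilon>"]) auto
  qed
  then obtain v where "\<forall>\<epsilon>\<in>{0<..1}. good \<epsilon> (v \<epsilon>)" by metis
  then have v: "\<forall>\<epsilon>\<in>{0<..1}. (\<forall>j\<in>Basis. smooth_on (S \<epsilon>) (\<lambda>t. v \<epsilon> t \<bullet> j)) \<and>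
      (\<epsilon> \<le> \<epsilon>\<^sub>0 \<longrightarrow> v \<epsilon> (\<tau> \<epsilon>) = y \<epsilon> \<and> (\<forall>t. norm (v \<epsilon> t - y \<epsilon>) \<le> a * \<bar>t - \<tau> \<epsilon>\<bar>) \<and>
      (\<forall>t\<in>S \<epsilon>. (v \<epsilon> has_vector_derivative F' \<epsilon> (t, v \<epsilon> t)) (at t)))"
    unfolding good_def .
  obtain w where w: "\<And>\<epsilon> j. \<epsilon> \<in> {0<..1} \<Longrightarrow> j \<in> Basis \<Longrightarrow> smooth_on J (\<lambda>t. w \<epsilon> t \<bullet> j)"
    "\<And>K. K \<subset>\<subset> J \<Longrightarrow> \<forall>\<^sub>F \<epsilon> in at_right 0. \<forall>t\<in>K. w \<epsilon> t = v \<epsilon> t"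
    "\<And>\<epsilon> t. \<epsilon> \<in> {0<..1} \<Longrightarrow> t \<in> S \<epsilon> \<Longrightarrow> norm (w \<epsilon> t - y \<epsilon>) \<le> norm (v \<epsilon> t - y \<epsilon>)"
    "\<And>\<epsilon> t. \<epsilon> \<in> {0<..1} \<Longrightarrow> t \<notin> S \<epsilon> \<Longrightarrow> w \<epsilon> t = y \<epsilon>"
    unfolding J_def S_def
    by (rule cutoff_net[of \<delta> "t\<^sub>0 - h" "t\<^sub>0 + h" v y, OF \<delta> \<delta>_lim]) (use v in \<open>auto simp: S_def\<close>)
  have ball: "\<forall>\<^sub>F \<epsilon> in at_right 0. \<forall>t\<in>J. norm (w \<epsilon> t - y \<epsilon>) < \<beta>"
    using eventually_\<epsilon>\<^sub>0
  proof eventually_elim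
    case (elim \<epsilon>)
    then have \<epsilon>: "\<epsilon> \<in> {0<..1}" "\<epsilon> \<le> \<epsilon>\<^sub>0" using \<epsilon>\<^sub>0(1) by auto
    show ?case
    proof
      fix t assume "t \<in> J"
      show "norm (w \<epsilon> t - y \<epsilon>) < \<beta>"
      proof (cases "t \<in> S \<epsilon>")
        case True
        have "norm (w \<epsilon> t - y \<epsilon>) \<le> a * \<bar>t - \<tau> \<epsilon>\<bar>" using w(3)[OF \<epsilon>(1) True] v \<epsilon> by (meson order_trans)
        then show ?thesis using time(1)[OF True] \<epsilon> by simp
      qed (use w(4) \<epsilon> \<beta> in simp)
    qed
  qed
  have inner: "\<exists>\<rho><\<beta>. \<forall>\<^sub>F \<epsilon> in at_right 0. \<forall>t\<in>{t\<^sub>0 - h + \<eta>..t\<^sub>0 + h - \<eta>}. norm (w \<epsilon> t - y \<epsilon>) \<le> \<rho>"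
    if \<eta>: "0 < \<eta>" "\<eta> < h" for \<eta>
  proof (intro exI conjI)
    have "a * (h - \<eta> / 2) < a * h" using a \<eta> by simp
    then show "a * (h - \<eta> / 2) < \<beta>" using h_bounds(3) by linarith
    show "\<forall>\<^sub>F \<epsilon> in at_right 0. \<forall>t\<in>{t\<^sub>0 - h + \<eta>..t\<^sub>0 + h - \<eta>}. norm (w \<epsilon> t - y \<epsilon>) \<le> a * (h - \<eta> / 2)"
      using w(2)[OF interval_compactly_inside[OF \<eta>(1)]] eventually_\<epsilon>\<^sub>0 initial_time_near[OF \<tau> half_gt_zero[OF \<eta>(1)]]
    proof eventually_elim
      case (elim \<epsilon>)
      then have \<epsilon>: "\<epsilon> \<in> {0<..1}" "\<epsilon> \<le> \<epsilon>\<^sub>0" using \<epsilon>\<^sub>0(1) by auto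
      show ?case
      proof
        fix t assume t: "t \<in> {t\<^sub>0 - h + \<eta>..t\<^sub>0 + h - \<eta>}"
        then have "norm (w \<epsilon> t - y \<epsilon>) \<le> a * \<bar>t - \<tau> \<epsilon>\<bar>" using elim(1) v \<epsilon> by simp
        also have "\<dots> \<le> a * (h - \<eta> / 2)"
        proof (intro mult_left_mono)
          show "\<bar>t - \<tau> \<epsilon>\<bar> \<le> h - \<eta> / 2" using t elim(3) by (auto simp: abs_if split: if_splits)
        qed (use a in simp)
        finally show "norm (w \<epsilon> t - y \<epsilon>) \<le> a * (h - \<eta> / 2)" .
      qed
    qed
  qed
  have ode: "\<forall>\<^sub>F \<epsilon> in at_right 0. \<forall>t\<in>K. (w \<epsilon> has_vector_derivative F' \<epsilon> (t, w \<epsilon> t)) (at t)"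
    if K: "K \<subset>\<subset> J" for K
  proof -
    obtain K' where K': "K' \<subset>\<subset> J" "K \<subseteq> interior K'" using compactly_inside_enlarge[OF K] by metis
    obtain \<eta> where \<eta>: "0 < \<eta>" "\<eta> < h" "K \<subseteq> {t\<^sub>0 - h + \<eta>..t\<^sub>0 + h - \<eta>}" using K by (rule compact_in_J)
    show ?thesis
      using w(2)[OF K'(1)] eventually_\<epsilon>\<^sub>0 order_tendstoD(2)[OF \<delta>_lim \<eta>(1)]
    proof eventually_elim
      case (elim \<epsilon>)
      then have \<epsilon>: "\<epsilon> \<in> {0<..1}" "\<epsilon> \<le> \<epsilon>\<^sub>0" using \<epsilon>\<^sub>0(1) by auto
      show ?case
      proof
        fix t assume t: "t \<in> K"
        have "K \<subseteq> S \<epsilon>" using \<eta>(3) elim(3) by (auto simp: S_def subset_iff)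
        then have "(v \<epsilon> has_vector_derivative F' \<epsilon> (t, v \<epsilon> t)) (at t)" using v \<epsilon> t by blast
        moreover have "v \<epsilon> s = w \<epsilon> s" if "s \<in> interior K'" for s
          using elim(1) that interior_subset by force
        ultimately show "(w \<epsilon> has_vector_derivative F' \<epsilon> (t, w \<epsilon> t)) (at t)"
          using has_vector_derivative_transform_within_open[of "v \<epsilon>" "F' \<epsilon> (t, w \<epsilon> t)" t "interior K'" "w \<epsilon>"]
            K'(2) t by (metis open_interior subsetD)
      qed
    qed
  qed
  have range: "\<forall>\<^sub>F \<epsilon> in at_right 0. w \<epsilon> ` J \<subseteq> U"
    using ball eventually_\<epsilon>\<^sub>0 by eventually_elim (use W_iff W_facts(2) \<epsilon>\<^sub>0(2) in blast)
  have mod: "w \<in> moderate_vec J"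
  proof (rule ode_solution_moderate[OF J_facts(1) open_I J_facts(2) open_U F'_moderate w(1) range _ ode])
    fix K assume K: "K \<subset>\<subset> J"
    define L' where "L' = {x + z | x z. x \<in> L \<and> z \<in> cball 0 \<beta>}"
    have "compact L'" unfolding L'_def by (intro compact_sums L compact_cball)
    moreover have "L' \<subseteq> U" using L(2) by (force simp: L'_def dist_norm)
    ultimately have "L' \<subset>\<subset> U" using open_U by (simp add: compactly_inside_open)
    moreover have "\<forall>\<^sub>F \<epsilon> in at_right 0. w \<epsilon> ` K \<subseteq> L'"
      using ball eventually_\<epsilon>\<^sub>0
    proof eventually_elim
      case (elim \<epsilon>)
      have "w \<epsilon> t \<in> L'" if "t \<in> K" for t
      proof -
        have "t \<in> J" using that K J_facts(1) by (auto simp: compactly_inside_open)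
        then have "w \<epsilon> t = y \<epsilon> + (w \<epsilon> t - y \<epsilon>)" "w \<epsilon> t - y \<epsilon> \<in> cball 0 \<beta>" using elim(1) by (auto intro: less_imp_le)
        then show ?thesis unfolding L'_def using \<epsilon>\<^sub>0(2)[OF elim(2)] by blast
      qed
      then show ?case by blast
    qed
    ultimately show "\<exists>L. L \<subset>\<subset> U \<and> (\<forall>\<^sub>F \<epsilon> in at_right 0. w \<epsilon> ` K \<subseteq> L)" by blast
  qed
  have cbW: "c_bounded J W w" by (rule c_bounded_WI[OF mod ball inner])
  define X where "X = gf_class J w"
  have X: "X \<in> colombeau J" "w \<in> X"
    using gf_class_colombeau[OF mod] gf_class_self[OF J_facts(1) mod] by (auto simp: X_def)
  have "negligible_on K (\<lambda>\<epsilon> t. partial_deriv 1 (w \<epsilon>) t - F' \<epsilon> (t, w \<epsilon> t))" if K: "K \<subset>\<subset> J" for K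
  proof -
    have "K \<subseteq> J" using K J_facts(1) by (simp add: compactly_inside_open)
    have "\<forall>\<^sub>F \<epsilon> in at_right 0. \<forall>t\<in>K. partial_deriv 1 (w \<epsilon>) t - F' \<epsilon> (t, w \<epsilon> t) = 0"
      using ode[OF K] eventually_index
    proof eventually_elim
      case (elim \<epsilon>)
      then have "partial_deriv 1 (w \<epsilon>) t = F' \<epsilon> (t, w \<epsilon> t)" if "t \<in> K" for t
        using moderate_vec_derivative(1)[OF mod, of \<epsilon> t] that \<open>K \<subseteq> J\<close>
        by (intro vector_derivative_unique_at[of "w \<epsilon>" _ t]) auto
      then show ?case by simp
    qed
    from negligible_on_cong[OF this] show ?thesis
      by (simp add: negligible_on_def eventually_mono[OF eventually_index])
  qed
  moreover have "gp_equiv (\<lambda>\<epsilon>. w \<epsilon> (\<tau> \<epsilon>)) y"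
  proof (rule gp_equiv_cong)
    have "h / 2 > 0" using h_bounds(1) by simp
    show "\<forall>\<^sub>F \<epsilon> in at_right 0. w \<epsilon> (\<tau> \<epsilon>) = y \<epsilon>"
      using w(2)[OF interval_compactly_inside[OF \<open>h / 2 > 0\<close>]] initial_time_near[OF \<tau> \<open>h / 2 > 0\<close>] eventually_\<epsilon>\<^sub>0
    proof eventually_elim
      case (elim \<epsilon>)
      have "\<tau> \<epsilon> \<in> {t\<^sub>0 - h + h / 2..t\<^sub>0 + h - h / 2}" using elim(2) by (auto simp: abs_if split: if_splits)
      then have "w \<epsilon> (\<tau> \<epsilon>) = v \<epsilon> (\<tau> \<epsilon>)" using elim(1) by blast
      then show ?case using v elim(3) \<epsilon>\<^sub>0(1) by auto
    qed
  qed
  ultimately have "ivp_solution I U F T Y J X"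
    using ivp_solution_iff[OF X c_bounded_W_imp_U[OF cbW] \<tau>] by blast
  moreover have "X \<in> colombeau_cb J W" using X cbW by (auto simp: colombeau_cb_def)
  ultimately show ?thesis by blast
qed

text \<open>
  The velocity is at most \<open>a\<close> up to a negligible error, so on \<open>[t\<^sub>0 - h + \<eta>, t\<^sub>0 + h - \<eta>]\<close> the solution moves
  by at most \<open>a (h - \<eta>) \<le> \<beta> - a \<eta>\<close>, up to errors that are small compared with \<open>a \<eta>\<close>.
\<close>

lemma solution_estimate:
  assumes w: "c_bounded J U w" and \<tau>: "\<tau> \<in> gp_in J T"
    and ode: "\<And>K. K \<subset>\<subset> J \<Longrightarrow> negligible_on K (\<lambda>\<epsilon> t. partial_deriv 1 (w \<epsilon>) t - F' \<epsilon> (t, w \<epsilon> t))"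
    and init: "gp_equiv (\<lambda>\<epsilon>. w \<epsilon> (\<tau> \<epsilon>)) y" and \<eta>: "0 < \<eta>" "\<eta> < h"
  shows "\<exists>\<rho><\<beta>. \<forall>\<^sub>F \<epsilon> in at_right 0. \<forall>t\<in>{t\<^sub>0 - h + \<eta>..t\<^sub>0 + h - \<eta>}. norm (w \<epsilon> t - y \<epsilon>) \<le> \<rho>"
proof (intro exI conjI)
  show "\<beta> - a * \<eta> / 2 < \<beta>" using a \<eta> by simp
  define N where "N = {t\<^sub>0 - h + \<eta>..t\<^sub>0 + h - \<eta>}"
  \<comment> \<open>bounds the error of the initial value, the residual, and the shift of the initial time\<close>
  define \<kappa> where "\<kappa> = min (min 1 (h - \<eta>)) (a * \<eta> / (2 * (2 + a + h)))"
  have \<kappa>: "0 < \<kappa>" "\<kappa> \<le> 1" "\<kappa> \<le> h - \<eta>" "\<kappa> * (2 + a + h) \<le> a * \<eta> / 2"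
  proof -
    show "0 < \<kappa>" using \<eta> a h_bounds by (auto simp: \<kappa>_def)
    show "\<kappa> \<le> 1" "\<kappa> \<le> h - \<eta>" by (auto simp: \<kappa>_def)
    have "\<kappa> * (2 + a + h) \<le> a * \<eta> / (2 * (2 + a + h)) * (2 + a + h)"
      using a h_bounds by (intro mult_right_mono) (auto simp: \<kappa>_def)
    also have "\<dots> = a * \<eta> / 2" using a h_bounds by (simp add: field_simps)
    finally show "\<kappa> * (2 + a + h) \<le> a * \<eta> / 2" .
  qed
  have N: "N \<subset>\<subset> J" unfolding N_def by (rule interval_compactly_inside[OF \<eta>(1)])
  have "\<forall>\<^sub>F \<epsilon> in at_right 0. \<forall>t\<in>N. norm (partial_deriv 1 (w \<epsilon>) t - F' \<epsilon> (t, w \<epsilon> t)) \<le> \<epsilon> ^ 1"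
    using ode[OF N] unfolding negligible_on_def by blast
  then show "\<forall>\<^sub>F \<epsilon> in at_right 0. \<forall>t\<in>{t\<^sub>0 - h + \<eta>..t\<^sub>0 + h - \<eta>}. norm (w \<epsilon> t - y \<epsilon>) \<le> \<beta> - a * \<eta> / 2"
    using gp_equiv_eventually[OF init, of 1] initial_time_near[OF \<tau> \<kappa>(1)] eventually_\<epsilon>\<^sub>0
      eventually_index_less[OF \<kappa>(1)]
  proof eventually_elim
    case (elim \<epsilon>)
    then have \<epsilon>: "\<epsilon> \<in> {0<..1}" using \<epsilon>\<^sub>0(1) by auto
    have \<tau>N: "\<tau> \<epsilon> \<in> N" using elim(3) \<kappa>(3) by (auto simp: N_def abs_if split: if_splits)
    show ?case
    proof
      fix t assume t: "t \<in> {t\<^sub>0 - h + \<eta>..t\<^sub>0 + h - \<eta>}"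
      have seg: "closed_segment (\<tau> \<epsilon>) t \<subseteq> N"
        using \<tau>N t unfolding N_def by (intro closed_segment_subset) auto
      have "\<bar>t - \<tau> \<epsilon>\<bar> \<le> h - \<eta> + \<kappa>" using t elim(3) by (auto simp: abs_if split: if_splits)
      then have "\<kappa> + (a + \<kappa>) * \<bar>t - \<tau> \<epsilon>\<bar> \<le> \<kappa> + (a + \<kappa>) * (h - \<eta> + \<kappa>)"
        using a \<kappa>(1) by (intro add_left_mono mult_left_mono) auto
      also have "\<dots> = a * h - a * \<eta> + \<kappa> * (1 + a + (h - \<eta>) + \<kappa>)" by (simp add: algebra_simps)
      also have "\<dots> \<le> a * h - a * \<eta> + \<kappa> * (2 + a + h)"
        using \<kappa> \<eta> by (intro add_left_mono mult_left_mono) auto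
      also have "\<dots> \<le> \<beta> - a * \<eta> / 2" using \<kappa>(4) h_bounds(3) by linarith
      finally have *: "\<kappa> + (a + \<kappa>) * \<bar>t - \<tau> \<epsilon>\<bar> \<le> \<beta> - a * \<eta> / 2" .
      have "norm (w \<epsilon> t - y \<epsilon>) \<le> \<kappa> + (a + \<kappa>) * \<bar>t - \<tau> \<epsilon>\<bar>"
      proof (rule exit_time_bound[where du = "partial_deriv 1 (w \<epsilon>)" and \<beta> = \<beta>])
        fix s assume "s \<in> closed_segment (\<tau> \<epsilon>) t"
        then have s: "s \<in> N" "s \<in> J" using seg N J_facts(1) by (auto simp: compactly_inside_open)
        show "(w \<epsilon> has_vector_derivative partial_deriv 1 (w \<epsilon>) s) (at s)"
          by (rule moderate_vec_derivative[OF c_bounded_moderate_vec[OF w] \<epsilon> s(2)])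
        assume "norm (w \<epsilon> s - y \<epsilon>) \<le> \<beta>"
        then have "norm (F' \<epsilon> (s, w \<epsilon> s)) \<le> a"
          using s J_facts(4) by (intro bound[OF elim(4) _ \<epsilon>\<^sub>0(2)[OF elim(4)]]) (auto simp: dist_norm norm_minus_commute)
        moreover have "norm (partial_deriv 1 (w \<epsilon>) s - F' \<epsilon> (s, w \<epsilon> s)) \<le> \<kappa>"
          using elim(1,5) s(1) by fastforce
        ultimately show "norm (partial_deriv 1 (w \<epsilon>) s) \<le> a + \<kappa>"
          using norm_triangle_ineq[of "partial_deriv 1 (w \<epsilon>) s - F' \<epsilon> (s, w \<epsilon> s)" "F' \<epsilon> (s, w \<epsilon> s)"] by simp
      next
        show "norm (w \<epsilon> (\<tau> \<epsilon>) - y \<epsilon>) \<le> \<kappa>" using elim(2,5) by simp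
        show "\<kappa> + (a + \<kappa>) * \<bar>t - \<tau> \<epsilon>\<bar> < \<beta>"
          using * mult_pos_pos[OF a \<eta>(1)] by linarith
        show "a + \<kappa> \<ge> 0" using a \<kappa>(1) by simp
      qed
      then show "norm (w \<epsilon> t - y \<epsilon>) \<le> \<beta> - a * \<eta> / 2" using * by linarith
    qed
  qed
qed

text \<open>
  A representative of a solution takes values in \<open>W\<close> on compact subsets of \<open>J\<close>, for indices that
  depend on the compact set. Cutting off at a distance \<open>\<delta> \<epsilon>\<close> from the ends that shrinks slowly enough gives
  an equivalent representative with values in \<open>W\<close> on all of \<open>J\<close>.
\<close>

lemma solution_in_W:
  assumes "ivp_solution I U F T Y J X"
  shows "X \<in> colombeau_cb J W"
proof -
  obtain \<tau> where \<tau>: "\<tau> \<in> gp_in J T" using gp_in_nonempty[OF T J_facts(1,3)] by blast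
  have "X \<in> colombeau_cb J U" using assms by (simp add: ivp_solution_def)
  then obtain u where X: "X \<in> colombeau J" "u \<in> X" "c_bounded J U u" by (auto simp: colombeau_cb_def)
  have u: "u \<in> moderate_vec J" by (rule c_bounded_moderate_vec[OF X(3)])
  have est: "\<exists>\<rho><\<beta>. \<forall>\<^sub>F \<epsilon> in at_right 0. \<forall>t\<in>{t\<^sub>0 - h + \<eta>..t\<^sub>0 + h - \<eta>}. norm (u \<epsilon> t - y \<epsilon>) \<le> \<rho>"
    if "0 < \<eta>" "\<eta> < h" for \<eta>
    using assms ivp_solution_iff[OF X \<tau>] that by (intro solution_estimate[OF X(3) \<tau>]) auto
  define D where "D \<epsilon> = {\<eta>. 0 < \<eta> \<and> (\<forall>t\<in>{t\<^sub>0 - h + \<eta>..t\<^sub>0 + h - \<eta>}. norm (u \<epsilon> t - y \<epsilon>) < \<beta>)}" for \<epsilon>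
  define \<delta> where "\<delta> \<epsilon> = Inf (D \<epsilon>) + \<epsilon>" for \<epsilon>
  \<comment> \<open>\<open>D \<epsilon>\<close> is nonempty because the interval in its definition is empty for \<open>\<eta> > h\<close>\<close>
  have D: "h + 1 \<in> D \<epsilon>" "bdd_below (D \<epsilon>)" for \<epsilon>
    using h_bounds(1) by (auto simp: D_def intro!: bdd_belowI[of _ 0])
  have Inf: "Inf (D \<epsilon>) \<ge> 0" for \<epsilon> using D by (intro cInf_greatest) (auto simp: D_def)
  have \<delta>: "\<delta> \<epsilon> > 0" if "\<epsilon> \<in> {0<..1}" for \<epsilon> using Inf[of \<epsilon>] that by (simp add: \<delta>_def)
  have "((\<lambda>\<epsilon>. Inf (D \<epsilon>)) \<longlongrightarrow> 0) (at_right 0)"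
  proof (rule order_tendstoI)
    fix e :: real assume "e < 0"
    then show "\<forall>\<^sub>F \<epsilon> in at_right 0. e < Inf (D \<epsilon>)" using Inf less_le_trans by (intro always_eventually) blast
  next
    fix e :: real assume e: "0 < e"
    define \<eta> where "\<eta> = min e h / 2"
    have \<eta>: "0 < \<eta>" "\<eta> < h" "\<eta> < e" using e h_bounds(1) by (auto simp: \<eta>_def)
    obtain \<rho> where \<rho>: "\<rho> < \<beta>" "\<forall>\<^sub>F \<epsilon> in at_right 0. \<forall>t\<in>{t\<^sub>0 - h + \<eta>..t\<^sub>0 + h - \<eta>}. norm (u \<epsilon> t - y \<epsilon>) \<le> \<rho>"
      using est[OF \<eta>(1,2)] by blast
    show "\<forall>\<^sub>F \<epsilon> in at_right 0. Inf (D \<epsilon>) < e"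
      using \<rho>(2)
    proof eventually_elim
      case (elim \<epsilon>)
      then have "\<eta> \<in> D \<epsilon>" using \<eta>(1) \<rho>(1) by (auto simp: D_def intro: le_less_trans)
      then show ?case using cInf_lower[OF _ D(2)] \<eta>(3) le_less_trans by blast
    qed
  qed
  from tendsto_add[OF this tendsto_ident_at] have \<delta>_lim: "(\<delta> \<longlongrightarrow> 0) (at_right 0)"
    by (simp add: \<delta>_def[abs_def])
  define S where "S \<epsilon> = {t\<^sub>0 - h + \<delta> \<epsilon><..<t\<^sub>0 + h - \<delta> \<epsilon>}" for \<epsilon>
  have inner: "norm (u \<epsilon> t - y \<epsilon>) < \<beta>" if t: "t \<in> S \<epsilon>" and \<epsilon>: "\<epsilon> > 0" for t \<epsilon>
  proof -
    have "D \<epsilon> \<noteq> {}" using D(1) by blast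
    moreover have "Inf (D \<epsilon>) < \<delta> \<epsilon>" using \<epsilon> by (simp add: \<delta>_def)
    ultimately obtain \<eta> where "\<eta> \<in> D \<epsilon>" "\<eta> < \<delta> \<epsilon>" using cInf_lessD by blast
    then show ?thesis using t by (auto simp: D_def S_def)
  qed
  have SJ: "S \<epsilon> \<subseteq> J" if "\<epsilon> \<in> {0<..1}" for \<epsilon> using \<delta>[OF that] by (auto simp: S_def J_def)
  have smooth: "smooth_on J (\<lambda>t. u \<epsilon> t \<bullet> j)" if "\<epsilon> \<in> {0<..1}" "j \<in> Basis" for \<epsilon> j
    using moderate_imp_smooth_on[OF moderate_vecD[OF u that(2)] that(1)] .
  obtain w where w: "\<And>\<epsilon> j. \<epsilon> \<in> {0<..1} \<Longrightarrow> j \<in> Basis \<Longrightarrow> smooth_on J (\<lambda>t. w \<epsilon> t \<bullet> j)"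
    "\<And>K. K \<subset>\<subset> J \<Longrightarrow> \<forall>\<^sub>F \<epsilon> in at_right 0. \<forall>t\<in>K. w \<epsilon> t = u \<epsilon> t"
    "\<And>\<epsilon> t. \<epsilon> \<in> {0<..1} \<Longrightarrow> t \<in> S \<epsilon> \<Longrightarrow> norm (w \<epsilon> t - y \<epsilon>) \<le> norm (u \<epsilon> t - y \<epsilon>)"
    "\<And>\<epsilon> t. \<epsilon> \<in> {0<..1} \<Longrightarrow> t \<notin> S \<epsilon> \<Longrightarrow> w \<epsilon> t = y \<epsilon>"
    unfolding J_def S_def
    by (rule cutoff_net[of \<delta> "t\<^sub>0 - h" "t\<^sub>0 + h" u y, OF \<delta> \<delta>_lim])
       (use smooth_on_subset[OF smooth SJ] in \<open>auto simp: S_def\<close>)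
  have mod: "w \<in> moderate_vec J"
    unfolding moderate_vec_def
  proof safe
    fix j :: 'b assume j: "j \<in> Basis"
    show "(\<lambda>\<epsilon> t. w \<epsilon> t \<bullet> j) \<in> moderate J"
    proof (rule eventually_eq_imp_moderate[OF J_facts(1) w(1)[OF _ j] moderate_vecD[OF u j]])
      fix K assume "K \<subset>\<subset> J"
      from w(2)[OF this] show "\<forall>\<^sub>F \<epsilon> in at_right 0. \<forall>t\<in>K. w \<epsilon> t \<bullet> j = u \<epsilon> t \<bullet> j"
        by eventually_elim simp
    qed
  qed
  have "negligible_on K (\<lambda>\<epsilon> t. u \<epsilon> t - w \<epsilon> t)" if "K \<subset>\<subset> J" for K
    unfolding negligible_on_def
  proof
    fix m
    show "\<forall>\<^sub>F \<epsilon> in at_right 0. \<forall>t\<in>K. norm (u \<epsilon> t - w \<epsilon> t) \<le> \<epsilon> ^ m"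
      using w(2)[OF that] eventually_index by eventually_elim simp
  qed
  then have rel: "(u, w) \<in> gf_rel J" using u mod by (simp add: gf_rel_line_iff[OF J_facts(1)])
  then have "w \<in> X" using colombeau_classE(1)[OF J_facts(1) X(1,2)] by (auto simp: gf_class_def)
  moreover have "c_bounded J W w"
  proof (rule c_bounded_WI[OF mod])
    show "\<forall>\<^sub>F \<epsilon> in at_right 0. \<forall>t\<in>J. norm (w \<epsilon> t - y \<epsilon>) < \<beta>"
      using eventually_index
    proof eventually_elim
      case (elim \<epsilon>)
      have "norm (w \<epsilon> t - y \<epsilon>) < \<beta>" for t
      proof (cases "t \<in> S \<epsilon>")
        case True
        then show ?thesis using w(3)[of \<epsilon> t] inner[of t \<epsilon>] elim by auto
      qed (use w(4)[of \<epsilon> t] elim \<beta> in auto)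
      then show ?case by blast
    qed
    fix \<eta> :: real assume \<eta>: "0 < \<eta>" "\<eta> < h"
    obtain \<rho> where \<rho>: "\<rho> < \<beta>" "\<forall>\<^sub>F \<epsilon> in at_right 0. \<forall>t\<in>{t\<^sub>0 - h + \<eta>..t\<^sub>0 + h - \<eta>}. norm (u \<epsilon> t - y \<epsilon>) \<le> \<rho>"
      using est[OF \<eta>] by blast
    have "\<forall>\<^sub>F \<epsilon> in at_right 0. \<forall>t\<in>{t\<^sub>0 - h + \<eta>..t\<^sub>0 + h - \<eta>}. norm (w \<epsilon> t - y \<epsilon>) \<le> \<rho>"
      using \<rho>(2) w(2)[OF interval_compactly_inside[OF \<eta>(1)]] by eventually_elim simp
    then show "\<exists>\<rho><\<beta>. \<forall>\<^sub>F \<epsilon> in at_right 0. \<forall>t\<in>{t\<^sub>0 - h + \<eta>..t\<^sub>0 + h - \<eta>}. norm (w \<epsilon> t - y \<epsilon>) \<le> \<rho>"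
      using \<rho>(1) by blast
  qed
  ultimately show ?thesis using X(1) by (auto simp: colombeau_cb_def)
qed

lemma F'_lipschitz:
  assumes "\<epsilon> \<in> {0<..1}" "t \<in> J" and x: "x \<in> W" "z \<in> W" "closed_segment z x \<subseteq> W"
    and B: "\<And>x. x \<in> W \<Longrightarrow> onorm (frechet_derivative (\<lambda>z. F' \<epsilon> (t, z)) (at x)) \<le> B"
  shows "norm (F' \<epsilon> (t, x) - F' \<epsilon> (t, z)) \<le> B * norm (x - z)"
proof (rule differentiable_bound[of "closed_segment z x" "\<lambda>z. F' \<epsilon> (t, z)"
      "\<lambda>x. frechet_derivative (\<lambda>z. F' \<epsilon> (t, z)) (at x)"])
  fix p assume "p \<in> closed_segment z x"
  then have p: "p \<in> W" using x by blast
  have V: "open (I \<times> U)" using open_I open_U by (simp add: open_Times)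
  have "((\<lambda>z. F' \<epsilon> (t, z) \<bullet> j) differentiable (at p))" if "j \<in> Basis" for j
  proof -
    have "(t, p) \<in> I \<times> U" using assms(2) p J_facts W_facts by blast
    from smooth_on_has_derivative[OF V moderate_imp_smooth_on[OF moderate_vecD[OF F'_moderate that] assms(1)] this]
    obtain D where D: "((\<lambda>q. F' \<epsilon> q \<bullet> j) has_derivative D) (at (t, p))" by blast
    have "((\<lambda>z. (t, z)) has_derivative (\<lambda>h. (0, h))) (at p)"
      by (intro derivative_intros)
    from has_derivative_compose[OF this D] show ?thesis by (auto simp: differentiable_def)
  qed
  then have "(\<lambda>z. F' \<epsilon> (t, z)) differentiable (at p)"
    by (subst differentiable_componentwise_within) auto
  then show "((\<lambda>z. F' \<epsilon> (t, z)) has_derivative frechet_derivative (\<lambda>z. F' \<epsilon> (t, z)) (at p)) (at p within closed_segment z x)"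
    using frechet_derivative_works has_derivative_at_withinI by blast
  show "onorm (frechet_derivative (\<lambda>z. F' \<epsilon> (t, z)) (at p)) \<le> B" by (rule B[OF p])
qed auto

text \<open>
  The Lipschitz constant \<open>C \<bar>ln \<epsilon>\<bar>\<close> turns Gronwall's exponential factor into a power of \<open>1 / \<epsilon>\<close>, which a
  negligible net absorbs. Two solutions stay in a common ball, hence in a convex subset of \<open>W\<close>.
\<close>

lemma solution_unique:
  assumes log: "sup_bigo (J \<times> W) (\<lambda>\<epsilon> (t, x). onorm (frechet_derivative (\<lambda>z. F' \<epsilon> (t, z)) (at x))) (\<lambda>\<epsilon>. \<bar>ln \<epsilon>\<bar>)"
    and sol: "ivp_solution I U F T Y J X" "ivp_solution I U F T Y J X'"
  shows "X = X'"
proof -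
  obtain \<tau> where \<tau>: "\<tau> \<in> gp_in J T" using gp_in_nonempty[OF T J_facts(1,3)] by blast
  obtain u where X: "X \<in> colombeau J" "u \<in> X" "c_bounded J U u"
    using sol(1) by (auto simp: ivp_solution_def colombeau_cb_def)
  obtain w where X': "X' \<in> colombeau J" "w \<in> X'" "c_bounded J U w"
    using sol(2) by (auto simp: ivp_solution_def colombeau_cb_def)
  have u: "u \<in> moderate_vec J" "\<And>K. K \<subset>\<subset> J \<Longrightarrow> negligible_on K (\<lambda>\<epsilon> t. partial_deriv 1 (u \<epsilon>) t - F' \<epsilon> (t, u \<epsilon> t))"
    "gp_equiv (\<lambda>\<epsilon>. u \<epsilon> (\<tau> \<epsilon>)) y"
    using sol(1) ivp_solution_iff[OF X \<tau>] c_bounded_moderate_vec[OF X(3)] by auto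
  have w: "w \<in> moderate_vec J" "\<And>K. K \<subset>\<subset> J \<Longrightarrow> negligible_on K (\<lambda>\<epsilon> t. partial_deriv 1 (w \<epsilon>) t - F' \<epsilon> (t, w \<epsilon> t))"
    "gp_equiv (\<lambda>\<epsilon>. w \<epsilon> (\<tau> \<epsilon>)) y"
    using sol(2) ivp_solution_iff[OF X' \<tau>] c_bounded_moderate_vec[OF X'(3)] by auto
  obtain C' where C': "\<forall>\<^sub>F \<epsilon> in at_right 0. \<forall>p\<in>J \<times> W.
      \<bar>case p of (t, x) \<Rightarrow> onorm (frechet_derivative (\<lambda>z. F' \<epsilon> (t, z)) (at x))\<bar> \<le> C' * \<bar>\<bar>ln \<epsilon>\<bar>\<bar>"
    using log unfolding sup_bigo_def by blast
  define C where "C = max C' 0"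
  \<comment> \<open>two times in \<open>J\<close> have distance at most \<open>2 * h\<close>, so that Gronwall's factor is at most \<open>exp (2 * h) * inverse (\<epsilon> ^ M)\<close>\<close>
  define M where "M = nat \<lceil>4 * C * h\<rceil>"
  have CM: "C \<ge> 0" "4 * C * h \<le> M" using h_bounds(1) by (auto simp: C_def M_def intro: of_nat_ceiling)
  have "negligible_on K (\<lambda>\<epsilon> t. u \<epsilon> t - w \<epsilon> t)" if K: "K \<subset>\<subset> J" for K
  proof (rule negligible_onI)
    fix m
    obtain \<eta> where \<eta>: "0 < \<eta>" "\<eta> < h" "K \<subseteq> {t\<^sub>0 - h + \<eta>..t\<^sub>0 + h - \<eta>}" using K by (rule compact_in_J)
    define N where "N = {t\<^sub>0 - h + \<eta>..t\<^sub>0 + h - \<eta>}"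
    have N: "N \<subset>\<subset> J" "N \<subseteq> J"
      using interval_compactly_inside[OF \<eta>(1)] J_facts(1) by (auto simp: N_def compactly_inside_open)
    obtain \<rho> where \<rho>: "\<rho> < \<beta>" "\<forall>\<^sub>F \<epsilon> in at_right 0. \<forall>t\<in>N. norm (u \<epsilon> t - y \<epsilon>) \<le> \<rho>"
      using solution_estimate[OF X(3) \<tau> u(2,3) \<eta>(1,2)] unfolding N_def by blast
    obtain \<rho>' where \<rho>': "\<rho>' < \<beta>" "\<forall>\<^sub>F \<epsilon> in at_right 0. \<forall>t\<in>N. norm (w \<epsilon> t - y \<epsilon>) \<le> \<rho>'"
      using solution_estimate[OF X'(3) \<tau> w(2,3) \<eta>(1,2)] unfolding N_def by blast
    have res: "negligible_on N (\<lambda>\<epsilon> t. (partial_deriv 1 (u \<epsilon>) t - F' \<epsilon> (t, u \<epsilon> t)) - (partial_deriv 1 (w \<epsilon>) t - F' \<epsilon> (t, w \<epsilon> t)))"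
    proof -
      have "negligible_on N (\<lambda>\<epsilon> t. F' \<epsilon> (t, w \<epsilon> t) - partial_deriv 1 (w \<epsilon>) t)"
        using w(2)[OF N(1)] by (subst negligible_on_minus_commute)
      from negligible_on_add[OF u(2)[OF N(1)] this] show ?thesis by (simp add: algebra_simps)
    qed
    have init: "gp_equiv (\<lambda>\<epsilon>. u \<epsilon> (\<tau> \<epsilon>)) (\<lambda>\<epsilon>. w \<epsilon> (\<tau> \<epsilon>))"
      using u(3) w(3) by (blast intro: gp_equiv_trans gp_equiv_sym)
    have "h - \<eta> > 0" using \<eta> by simp
    define B where "B = sqrt (2 * exp (2 * h))"
    have "\<forall>\<^sub>F \<epsilon> in at_right 0. \<forall>t\<in>N. norm ((partial_deriv 1 (u \<epsilon>) t - F' \<epsilon> (t, u \<epsilon> t)) - (partial_deriv 1 (w \<epsilon>) t - F' \<epsilon> (t, w \<epsilon> t))) \<le> \<epsilon> ^ (m + M)"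
      using res unfolding negligible_on_def by blast
    then have "\<forall>\<^sub>F \<epsilon> in at_right 0. \<forall>t\<in>K. norm (u \<epsilon> t - w \<epsilon> t) \<le> B * \<epsilon> ^ m"
      using gp_equiv_eventually[OF init, of "m + M"] \<rho>(2) \<rho>'(2) C' eventually_\<epsilon>\<^sub>0 eventually_index
        initial_time_near[OF \<tau> \<open>h - \<eta> > 0\<close>]
    proof eventually_elim
      case (elim \<epsilon>)
      have \<epsilon>: "\<epsilon> \<in> {0<..1}" using elim(7) by auto
      define n where "n = \<epsilon> ^ (m + M)"
      define \<Lambda> where "\<Lambda> = C * \<bar>ln \<epsilon>\<bar>"
      have onorm: "onorm (frechet_derivative (\<lambda>z. F' \<epsilon> (t, z)) (at x)) \<le> \<Lambda>" if "t \<in> J" "x \<in> W" for t x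
      proof -
        have "onorm (frechet_derivative (\<lambda>z. F' \<epsilon> (t, z)) (at x)) \<le> C' * \<bar>ln \<epsilon>\<bar>"
          using elim(5) that by force
        also have "\<dots> \<le> \<Lambda>" unfolding \<Lambda>_def C_def by (intro mult_right_mono) auto
        finally show ?thesis .
      qed
      have \<tau>N: "\<tau> \<epsilon> \<in> N" using elim(8) by (auto simp: N_def abs_if split: if_splits)
      show ?case
      proof
        fix t assume "t \<in> K"
        then have t: "t \<in> N" using \<eta>(3) by (auto simp: N_def)
        have seg: "closed_segment (\<tau> \<epsilon>) t \<subseteq> N"
          using \<tau>N t unfolding N_def by (intro closed_segment_subset) auto
        have "(norm (u \<epsilon> t - w \<epsilon> t))\<^sup>2 \<le> ((norm (u \<epsilon> (\<tau> \<epsilon>) - w \<epsilon> (\<tau> \<epsilon>)))\<^sup>2 + n\<^sup>2) * exp ((2 * \<Lambda> + 1) * \<bar>t - \<tau> \<epsilon>\<bar>)"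
        proof (rule gronwall_bound[where d = "\<lambda>s. u \<epsilon> s - w \<epsilon> s" and d' = "\<lambda>s. partial_deriv 1 (u \<epsilon>) s - partial_deriv 1 (w \<epsilon>) s"])
          fix s assume "s \<in> closed_segment (\<tau> \<epsilon>) t"
          then have s: "s \<in> N" "s \<in> J" using seg N by auto
          show "((\<lambda>s. u \<epsilon> s - w \<epsilon> s) has_vector_derivative partial_deriv 1 (u \<epsilon>) s - partial_deriv 1 (w \<epsilon>) s) (at s)"
            by (intro has_vector_derivative_diff moderate_vec_derivative[OF u(1) \<epsilon> s(2)] moderate_vec_derivative[OF w(1) \<epsilon> s(2)])
          have ballW: "ball (y \<epsilon>) \<beta> \<subseteq> W"
            using \<epsilon>\<^sub>0(2)[OF elim(6)] by (auto simp: W_iff dist_norm norm_minus_commute)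
          have us: "u \<epsilon> s \<in> ball (y \<epsilon>) \<beta>" "w \<epsilon> s \<in> ball (y \<epsilon>) \<beta>"
            using elim(3,4) s(1) \<rho>(1) \<rho>'(1) by (force simp: dist_norm norm_minus_commute)+
          then have "closed_segment (w \<epsilon> s) (u \<epsilon> s) \<subseteq> W"
            using closed_segment_subset[OF us(2,1) convex_ball] ballW by blast
          then have "norm (F' \<epsilon> (s, u \<epsilon> s) - F' \<epsilon> (s, w \<epsilon> s)) \<le> \<Lambda> * norm (u \<epsilon> s - w \<epsilon> s)"
            using us ballW onorm[OF s(2)] by (intro F'_lipschitz[OF \<epsilon> s(2)]) auto
          moreover have "norm ((partial_deriv 1 (u \<epsilon>) s - F' \<epsilon> (s, u \<epsilon> s)) - (partial_deriv 1 (w \<epsilon>) s - F' \<epsilon> (s, w \<epsilon> s))) \<le> n"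
            using elim(1) s(1) by (simp add: n_def)
          ultimately show "norm (partial_deriv 1 (u \<epsilon>) s - partial_deriv 1 (w \<epsilon>) s) \<le> \<Lambda> * norm (u \<epsilon> s - w \<epsilon> s) + n"
            using norm_triangle_ineq[of "F' \<epsilon> (s, u \<epsilon> s) - F' \<epsilon> (s, w \<epsilon> s)"
              "(partial_deriv 1 (u \<epsilon>) s - F' \<epsilon> (s, u \<epsilon> s)) - (partial_deriv 1 (w \<epsilon>) s - F' \<epsilon> (s, w \<epsilon> s))"]
            by (simp add: algebra_simps)
        qed (use CM in \<open>simp add: \<Lambda>_def\<close>)
        also have "\<dots> \<le> (n\<^sup>2 + n\<^sup>2) * (exp (2 * h) * inverse (\<epsilon> ^ M))"
        proof (intro mult_mono add_right_mono)
          show "(norm (u \<epsilon> (\<tau> \<epsilon>) - w \<epsilon> (\<tau> \<epsilon>)))\<^sup>2 \<le> n\<^sup>2" using elim(2) by (intro power_mono) (auto simp: n_def)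
          have "\<bar>t - \<tau> \<epsilon>\<bar> \<le> 2 * h" using t \<tau>N \<eta> by (auto simp: N_def)
          then have "(2 * \<Lambda> + 1) * \<bar>t - \<tau> \<epsilon>\<bar> \<le> (2 * \<Lambda> + 1) * (2 * h)"
            using CM by (intro mult_left_mono) (auto simp: \<Lambda>_def)
          also have "\<dots> = 2 * h + (4 * C * h) * \<bar>ln \<epsilon>\<bar>" by (simp add: \<Lambda>_def algebra_simps)
          also have "\<dots> \<le> 2 * h + M * \<bar>ln \<epsilon>\<bar>" using CM by (intro add_left_mono mult_right_mono) auto
          also have "\<dots> = 2 * h - M * ln \<epsilon>" using elim(7) by (simp add: abs_if)
          finally have "exp ((2 * \<Lambda> + 1) * \<bar>t - \<tau> \<epsilon>\<bar>) \<le> exp (2 * h - M * ln \<epsilon>)" by simp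
          also have "\<dots> = exp (2 * h) * inverse (\<epsilon> ^ M)"
            using elim(7) by (simp add: exp_diff exp_of_nat_mult divide_inverse)
          finally show "exp ((2 * \<Lambda> + 1) * \<bar>t - \<tau> \<epsilon>\<bar>) \<le> exp (2 * h) * inverse (\<epsilon> ^ M)" .
        qed auto
        also have "\<dots> = 2 * exp (2 * h) * (\<epsilon> ^ m)\<^sup>2 * \<epsilon> ^ M"
          using elim(7) by (simp add: n_def power_add power2_eq_square field_simps)
        also have "\<dots> \<le> 2 * exp (2 * h) * (\<epsilon> ^ m)\<^sup>2 * 1"
          using elim(7) by (intro mult_left_mono power_le_one) auto
        also have "\<dots> = (B * \<epsilon> ^ m)\<^sup>2" by (simp add: B_def power_mult_distrib)
        finally show "norm (u \<epsilon> t - w \<epsilon> t) \<le> B * \<epsilon> ^ m"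
          by (rule power2_le_imp_le) (use elim(7) in \<open>auto simp: B_def\<close>)
      qed
    qed
    then show "\<exists>C. \<forall>\<^sub>F \<epsilon> in at_right 0. \<forall>t\<in>K. norm (u \<epsilon> t - w \<epsilon> t) \<le> C * \<epsilon> ^ m" by blast
  qed
  then have "(u, w) \<in> gf_rel J" using u(1) w(1) by (simp add: gf_rel_line_iff[OF J_facts(1)])
  then show ?thesis
    using gf_class_eqI[OF J_facts(1)] colombeau_classE(1)[OF J_facts(1) X(1,2)] colombeau_classE(1)[OF J_facts(1) X'(1,2)] by simp
qed

end

theorem theorem3p1:
  fixes I J :: "real set" and U L L\<^sub>\<beta> W :: "(real ^ 'n::finite) set"
    and Q :: "(real \<times> (real ^ 'n)) set"
    and tt\<^sub>0 :: "(real \<Rightarrow> real) set" and t\<^sub>0 :: real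
    and xx\<^sub>0 :: "(real \<Rightarrow> real ^ 'n) set" and x\<^sub>0 :: "real \<Rightarrow> real ^ 'n"
    and F :: "(real \<Rightarrow> real \<times> (real ^ 'n) \<Rightarrow> real ^ 'n) set"
    and F' :: "real \<Rightarrow> real \<times> (real ^ 'n) \<Rightarrow> real ^ 'n"
    and \<alpha> \<beta> a h \<epsilon>\<^sub>0 :: real
  assumes "open I" "is_interval I" "open U"
    and "near_standard I tt\<^sub>0 t\<^sub>0"
    and "xx\<^sub>0 \<in> gen_points_c U"
    and "F \<in> colombeau (I \<times> U)"
    and "\<alpha> > 0" "{t\<^sub>0 - \<alpha>..t\<^sub>0 + \<alpha>} \<subset>\<subset> I"
    and "x\<^sub>0 \<in> xx\<^sub>0" "L \<subset>\<subset> U" "\<epsilon>\<^sub>0 \<in> {0<..1}" "\<forall>\<epsilon>\<in>{0<..\<epsilon>\<^sub>0}. x\<^sub>0 \<epsilon> \<in> L"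
    and "\<beta> > 0" "L\<^sub>\<beta> = L + closure (ball 0 \<beta>)" "L\<^sub>\<beta> \<subset>\<subset> U"
    and "Q = {t\<^sub>0 - \<alpha>..t\<^sub>0 + \<alpha>} \<times> L\<^sub>\<beta>"
    and "F' \<in> F" "a > 0" "\<forall>\<epsilon>\<in>{0<..\<epsilon>\<^sub>0}. \<forall>(t, x)\<in>Q. norm (F' \<epsilon> (t, x)) \<le> a"
    and "h = min \<alpha> (\<beta> / a)" "J = {t\<^sub>0 - h<..<t\<^sub>0 + h}" "W = L + ball 0 \<beta>"
  shows "(\<exists>u \<in> colombeau_cb J W. ivp_solution I U F tt\<^sub>0 xx\<^sub>0 J u) \<and>
    (\<forall>u \<in> colombeau_cb J U. ivp_solution I U F tt\<^sub>0 xx\<^sub>0 J u \<longrightarrow> u \<in> colombeau_cb J W) \<and>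
    (sup_bigo (J \<times> W)
       (\<lambda>\<epsilon> (t, x). onorm (frechet_derivative (\<lambda>y. F' \<epsilon> (t, y)) (at x)))
       (\<lambda>\<epsilon>. \<bar>ln \<epsilon>\<bar>) \<longrightarrow>
     (\<exists>!u. u \<in> colombeau_cb J U \<and> ivp_solution I U F tt\<^sub>0 xx\<^sub>0 J u))"
proof -
  have L\<^sub>\<beta>: "cball x \<beta> \<subseteq> L\<^sub>\<beta>" if "x \<in> L" for x
  proof
    fix z assume "z \<in> cball x \<beta>"
    then have "z - x \<in> closure (ball 0 \<beta>)" using assms(13) by (simp add: dist_norm norm_minus_commute)
    moreover have "z = x + (z - x)" by simp
    ultimately show "z \<in> L\<^sub>\<beta>" unfolding assms(14) set_plus_def using that by blast
  qed
  interpret ivp_setting I J U L W F F' tt\<^sub>0 t\<^sub>0 xx\<^sub>0 x\<^sub>0 \<alpha> \<beta> a h \<epsilon>\<^sub>0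
  proof
    show "xx\<^sub>0 \<in> gen_points U" using assms(5) by (simp add: gen_points_c_def)
    show "{t\<^sub>0 - \<alpha>..t\<^sub>0 + \<alpha>} \<subseteq> I" using assms(1,8) by (simp add: compactly_inside_open)
    show "compact L" using assms(10) by (simp add: compactly_inside_def)
    show "cball x \<beta> \<subseteq> U" if "x \<in> L" for x
      using L\<^sub>\<beta>[OF that] assms(3,15) by (auto simp: compactly_inside_open)
    show "norm (F' \<epsilon> (t, z)) \<le> a"
      if "\<epsilon> \<in> {0<..\<epsilon>\<^sub>0}" "t \<in> {t\<^sub>0 - \<alpha>..t\<^sub>0 + \<alpha>}" "x \<in> L" "z \<in> cball x \<beta>" for \<epsilon> t x z
      using that assms(16,19) L\<^sub>\<beta> by blast
  qed (use assms in auto)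
  show ?thesis
    using solution_exists solution_in_W solution_unique colombeau_cb_W_subset by blast
qed


end
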